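(* Let $R$, $R_\mu$, and $\eta$ be positive constants. Then the following hold. (i) There exists a unique even stationary solution $(F_0,G_0)\in\mathcal K^2\cap H^1(\mathbb R,\mathbb R^2)$ of (RS). (ii) If $R_\mu\notin[R_\mu^-(R,\eta),R_\mu^+(R,\eta)]$, then there are a bounded interval $\Lambda:=[\ell_-,\ell_+]$ containing zero and a one-parameter family $(F_\ell,G_\ell)_{\ell\in\Lambda}\subset\mathcal K^2\cap H^1(\mathbb R,\mathbb R^2)$ of stationary solutions of (RS) which are non-symmetric if $\ell\ne0$. In addition, $(F_\ell,G_\ell)$ depends continuously on $\ell\in\Lambda$ and even analytically on $\ell\in(\ell_-,\ell_+)$. (iii) Setting $\Lambda:=\{0\}$ and $\ell_-=\ell_+=0$ for $R_\mu\in[R_\mu^-(R,\eta),R_\mu^+(R,\eta)]$, any stationary solution of (RS) belongs to the family $(F_\ell,G_\ell)_{\ell\in\Lambda}$. (iv) The map $\ell\mapsto\mathcal E_*(F_\ell,G_\ell)$ is decreasing on $[\ell_-,0]$ and increasing on $[0,\ell_+]$. Furthermore, there are $R_\mu^M(R,\eta)>R_\mu^+(R,\eta)$ and $R_\mu^m(R,\eta)\in(0,R_\mu^-(R,\eta))$ such that: (v) If $R_\mu\notin[R_\mu^-(R,\eta),R_\mu^+(R,\eta)]$ and $\ell\in\Lambda\setminus\{\ell_-,\ell_+\}$, then either $F_\ell$ or $G_\ell$ has a disconnected support. (vi) If $R_\mu\notin(R_\mu^m(R,\eta),R_\mu^M(R,\eta))$ and $\ell\in\{\ell_-,\ell_+\}$,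 then both $F_\ell$ and $G_\ell$ have connected supports. (vii) If $R_\mu\in(R_\mu^m(R,\eta),R_\mu^-(R,\eta))\cup(R_\mu^+(R,\eta),R_\mu^M(R,\eta))$ and $\ell\in\{\ell_-,\ell_+\}$, then either $F_\ell$ or $G_\ell$ has a disconnected support. The threshold value $R_\mu^M=R_\mu^M(R,\eta)$ is the unique solution in $(R+1,\infty)$ of $$\sqrt{R_\mu^M-R}\left(\eta^2-\sqrt{\frac{1+R}{R_\mu^M}}\right)=1+\eta^2,$$ and $R_\mu^m=R_\mu^m(R,\eta)$ is the unique solution in $(0,R)$ of $$\sqrt{1+R-R_\mu^m}\left(\sqrt{\frac{R}{R_\mu^m}}-\eta^2\frac{1+R}{R}\right)=1+\eta^2\frac{1+R}{R}.$$
   Context: Function space: $\mathcal K:=\{w\in L_1(\mathbb R,(1+x^2)dx)\cap L_2(\mathbb R): w\ge0\text{ a.e. and }\|w\|_1=1\}$. System (RS), with parameters $R,R_\mu,\eta>0$: $$\partial_tf=\partial_x\big(f\,\partial_x(\eta^2(1+R)f+Rg+x^2/6)\big),\qquad \partial_tg=\partial_x\big(g\,\partial_x(\eta^2R_\mu f+R_\mu g+x^2/6)\big),\quad (t,x)\in(0,\infty)\times\mathbb R.$$ A stationary solution of (RS) is a pair $(F,G)\in\mathcal K^2\cap H^1(\mathbb R,\mathbb R^2)$ with $$F\,\partial_x\big((1+R)\eta^2F+RG+x^2/6\big)=0,\qquad G\,\partial_x\big(R_\mu\eta^2F+R_\mu G+x^2/6\big)=0\qquad\text{a.e. in }\mathbb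 R.$$ The pair is even if both $F$ and $G$ are even functions, and non-symmetric otherwise. Thresholds: $$R_\mu^+(R,\eta):=R+\Big(\frac{1+\eta^2}{\eta^2}\Big)^2,\qquad R_\mu^-(R,\eta):=\frac{R^3(1+R)}{R^3+(\eta^2(1+R)+R)^2}.$$ Energy: for $(u,v)\in\mathcal K^2$, $$\mathcal E_*(u,v):=\frac{\eta^2}{2}\|u\|_2^2+\frac R2\|\eta u+\eta^{-1}v\|_2^2+\frac16\int_{\mathbb R}(u+\Theta v)(x)\,x^2\,dx,\qquad \Theta:=\frac{R}{\eta^2R_\mu}.$$ "Decreasing" and "increasing" are meant in the strict sense. Meaning of continuous/analytic dependence in (ii): there is a function $\zeta=(\gamma_1,\beta_1,\alpha_1,\alpha,\beta,\gamma)\in C(\Lambda,\mathbb R^6)$, real-analytic on $(\ell_-,\ell_+)$, with $\gamma_1\le\beta_1\le\alpha_1\le0\le\alpha\le\beta\le\gamma$, such that $(F_\ell,G_\ell)$ is the pair given by the following formulas with parameters $\zeta(\ell)$ (functions vanish outside the indicated intervals). If $R_\mu>R_\mu^+(R,\eta)$: $\eta^2F(x)=\frac{R_\mu-R}{6R_\mu}(\beta_1^2-x^2)$ on $[\beta_1,\alpha_1]$, $\frac{R\gamma_1^2+(R_\mu-R)\beta_1^2}{6(1+R)R_\mu}-\frac{x^2}{6(1+R)}$ on $[\alpha_1,\alpha]$, $\frac{R_\mu-R}{6R_\mu}(\beta^2-x^2)$ on $[\alpha,\beta]$; and $G(x)=\frac{\gamma_1^2-x^2}{6R_\mu}$ on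 $[\gamma_1,\beta_1]$, $\frac{1+R-R_\mu}{6R_\mu}(\alpha_1^2-x^2)$ on $[\beta_1,\alpha_1]$, $\frac{1+R-R_\mu}{6R_\mu}(\alpha^2-x^2)$ on $[\alpha,\beta]$, $\frac{\gamma^2-x^2}{6R_\mu}$ on $[\beta,\gamma]$. If $R_\mu<R_\mu^-(R,\eta)$: $\eta^2F(x)=\frac{\gamma_1^2-x^2}{6(1+R)}$ on $[\gamma_1,\beta_1]$, $\frac{R_\mu-R}{6R_\mu}(\alpha_1^2-x^2)$ on $[\beta_1,\alpha_1]$, $\frac{R_\mu-R}{6R_\mu}(\alpha^2-x^2)$ on $[\alpha,\beta]$, $\frac{\gamma^2-x^2}{6(1+R)}$ on $[\beta,\gamma]$; and $G(x)=\frac{1+R-R_\mu}{6R_\mu}(\beta_1^2-x^2)$ on $[\beta_1,\alpha_1]$, $\frac{(R_\mu-R)\alpha_1^2+(1+R-R_\mu)\beta_1^2}{6R_\mu}-\frac{x^2}{6R_\mu}$ on $[\alpha_1,\alpha]$, $\frac{1+R-R_\mu}{6R_\mu}(\beta^2-x^2)$ on $[\alpha,\beta]$. *)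

theory Defs
  imports "HOL-Analysis.Analysis"
begin

(* Elements of Lebesgue and Sobolev spaces are represented by functions real => real. All
   notions below except the explicit profiles are invariant under modification on null sets,
   and pairs of functions are identified through eq_ae. *)

definition eq_ae :: "(real \<Rightarrow> real) \<Rightarrow> (real \<Rightarrow> real) \<Rightarrow> bool" where
  "eq_ae u v \<longleftrightarrow> (AE x in lebesgue. u x = v x)"

definition L2 :: "(real \<Rightarrow> real) set" where
  "L2 = {w \<in> borel_measurable lebesgue. integrable lebesgue (\<lambda>x. (w x)\<^sup>2)}"

definition norm_L1 :: "(real \<Rightarrow> real) \<Rightarrow> real" where
  "norm_L1 w = (LINT x|lebesgue. \<bar>w x\<bar>)"

definition norm_L2 :: "(real \<Rightarrow> real) \<Rightarrow> real" where
  "norm_L2 w = sqrt (LINT x|lebesgue. (w x)\<^sup>2)"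

definition K_space :: "(real \<Rightarrow> real) set" where
  "K_space = {w. w \<in> borel_measurable lebesgue
                \<and> integrable lebesgue (\<lambda>x. (1 + x\<^sup>2) * w x)
                \<and> w \<in> L2
                \<and> (AE x in lebesgue. 0 \<le> w x)
                \<and> norm_L1 w = 1}"

definition locally_integrable :: "(real \<Rightarrow> real) \<Rightarrow> bool" where
  "locally_integrable u \<longleftrightarrow> (\<forall>a b. set_integrable lebesgue {a..b} u)"

definition test_function :: "(real \<Rightarrow> real) \<Rightarrow> bool" where
  "test_function \<phi> \<longleftrightarrow> \<phi> C1_differentiable_on UNIV \<and> compact (closure {x. \<phi> x \<noteq> 0})"

definition has_weak_derivative :: "(real \<Rightarrow> real) \<Rightarrow> (real \<Rightarrow> real) \<Rightarrow> bool" where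
  "has_weak_derivative u v \<longleftrightarrow> locally_integrable u \<and> locally_integrable v \<and>
     (\<forall>\<phi>. test_function \<phi> \<longrightarrow>
        (LINT x|lebesgue. u x * deriv \<phi> x) = - (LINT x|lebesgue. v x * \<phi> x))"

definition H1 :: "(real \<Rightarrow> real) set" where
  "H1 = {u \<in> L2. \<exists>v \<in> L2. has_weak_derivative u v}"

(* D1 and D2 are the weak derivatives of the two potentials; they are unique up to null sets. *)
definition stationary_solution ::
  "real \<Rightarrow> real \<Rightarrow> real \<Rightarrow> (real \<Rightarrow> real) \<Rightarrow> (real \<Rightarrow> real) \<Rightarrow> bool" where
  "stationary_solution R R\<mu> \<eta> F G \<longleftrightarrow>
     F \<in> K_space \<inter> H1 \<and> G \<in> K_space \<inter> H1 \<and>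
     (\<exists>D1 D2.
        has_weak_derivative (\<lambda>x. (1 + R) * \<eta>\<^sup>2 * F x + R * G x + x\<^sup>2 / 6) D1 \<and>
        has_weak_derivative (\<lambda>x. R\<mu> * \<eta>\<^sup>2 * F x + R\<mu> * G x + x\<^sup>2 / 6) D2 \<and>
        (AE x in lebesgue. F x * D1 x = 0) \<and>
        (AE x in lebesgue. G x * D2 x = 0))"

definition even_ae :: "(real \<Rightarrow> real) \<Rightarrow> bool" where
  "even_ae w \<longleftrightarrow> (AE x in lebesgue. w (- x) = w x)"

definition even_pair :: "(real \<Rightarrow> real) \<Rightarrow> (real \<Rightarrow> real) \<Rightarrow> bool" where
  "even_pair F G \<longleftrightarrow> even_ae F \<and> even_ae G"

definition non_symmetric :: "(real \<Rightarrow> real) \<Rightarrow> (real \<Rightarrow> real) \<Rightarrow> bool" where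
  "non_symmetric F G \<longleftrightarrow> \<not> even_pair F G"

(* The complement of the largest open set on which w vanishes almost everywhere; for a
   continuous w this is the closure of {x. w x \<noteq> 0}. *)
definition supp :: "(real \<Rightarrow> real) \<Rightarrow> real set" where
  "supp w = - \<Union>{U. open U \<and> (AE x in lebesgue. x \<in> U \<longrightarrow> w x = 0)}"

definition R\<mu>_plus :: "real \<Rightarrow> real \<Rightarrow> real" where
  "R\<mu>_plus R \<eta> = R + ((1 + \<eta>\<^sup>2) / \<eta>\<^sup>2)\<^sup>2"

definition R\<mu>_minus :: "real \<Rightarrow> real \<Rightarrow> real" where
  "R\<mu>_minus R \<eta> = R ^ 3 * (1 + R) / (R ^ 3 + (\<eta>\<^sup>2 * (1 + R) + R)\<^sup>2)"

definition energy :: "real \<Rightarrow> real \<Rightarrow> real \<Rightarrow> (real \<Rightarrow> real) \<Rightarrow> (real \<Rightarrow> real) \<Rightarrow> real" where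
  "energy R R\<mu> \<eta> u v =
     (let \<Theta> = R / (\<eta>\<^sup>2 * R\<mu>) in
        \<eta>\<^sup>2 / 2 * (norm_L2 u)\<^sup>2
      + R / 2 * (norm_L2 (\<lambda>x. \<eta> * u x + v x / \<eta>))\<^sup>2
      + 1 / 6 * (LINT x|lebesgue. (u x + \<Theta> * v x) * x\<^sup>2))"

definition real_analytic_on :: "(real \<Rightarrow> 'a::real_normed_vector) \<Rightarrow> real set \<Rightarrow> bool"
    (infixl "real'_analytic'_on" 50) where
  "f real_analytic_on S \<longleftrightarrow>
     (\<forall>x0\<in>S. \<exists>r>0. \<exists>a :: nat \<Rightarrow> 'a.
        \<forall>x. \<bar>x - x0\<bar> < r \<longrightarrow> (\<lambda>n. (x - x0) ^ n *\<^sub>R a n) sums f x)"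

(* A point of R^6, in the order (\<gamma>1, \<beta>1, \<alpha>1, \<alpha>, \<beta>, \<gamma>). *)
type_synonym params = "real \<times> real \<times> real \<times> real \<times> real \<times> real"

definition ordered_params :: "params \<Rightarrow> bool" where
  "ordered_params = (\<lambda>(\<gamma>1, \<beta>1, \<alpha>1, \<alpha>, \<beta>, \<gamma>).
     \<gamma>1 \<le> \<beta>1 \<and> \<beta>1 \<le> \<alpha>1 \<and> \<alpha>1 \<le> 0 \<and> 0 \<le> \<alpha> \<and> \<alpha> \<le> \<beta> \<and> \<beta> \<le> \<gamma>)"

(* profile_F_high etc. give \<eta>\<^sup>2 F and G: "high" for R\<mu> > R\<mu>_plus R \<eta>, "low" for
   R\<mu> < R\<mu>_minus R \<eta>. At the finitely many common endpoints of the intervals the order of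
   the conditionals decides; the profiles are only used up to null sets. *)
definition profile_F_high :: "real \<Rightarrow> real \<Rightarrow> params \<Rightarrow> real \<Rightarrow> real" where
  "profile_F_high R R\<mu> = (\<lambda>(\<gamma>1, \<beta>1, \<alpha>1, \<alpha>, \<beta>, \<gamma>) x.
     if x \<in> {\<beta>1..\<alpha>1} then (R\<mu> - R) / (6 * R\<mu>) * (\<beta>1\<^sup>2 - x\<^sup>2)
     else if x \<in> {\<alpha>1..\<alpha>} then
       (R * \<gamma>1\<^sup>2 + (R\<mu> - R) * \<beta>1\<^sup>2) / (6 * (1 + R) * R\<mu>) - x\<^sup>2 / (6 * (1 + R))
     else if x \<in> {\<alpha>..\<beta>} then (R\<mu> - R) / (6 * R\<mu>) * (\<beta>\<^sup>2 - x\<^sup>2)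
     else 0)"

definition profile_G_high :: "real \<Rightarrow> real \<Rightarrow> params \<Rightarrow> real \<Rightarrow> real" where
  "profile_G_high R R\<mu> = (\<lambda>(\<gamma>1, \<beta>1, \<alpha>1, \<alpha>, \<beta>, \<gamma>) x.
     if x \<in> {\<gamma>1..\<beta>1} then (\<gamma>1\<^sup>2 - x\<^sup>2) / (6 * R\<mu>)
     else if x \<in> {\<beta>1..\<alpha>1} then (1 + R - R\<mu>) / (6 * R\<mu>) * (\<alpha>1\<^sup>2 - x\<^sup>2)
     else if x \<in> {\<alpha>..\<beta>} then (1 + R - R\<mu>) / (6 * R\<mu>) * (\<alpha>\<^sup>2 - x\<^sup>2)
     else if x \<in> {\<beta>..\<gamma>} then (\<gamma>\<^sup>2 - x\<^sup>2) / (6 * R\<mu>)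
     else 0)"

definition profile_F_low :: "real \<Rightarrow> real \<Rightarrow> params \<Rightarrow> real \<Rightarrow> real" where
  "profile_F_low R R\<mu> = (\<lambda>(\<gamma>1, \<beta>1, \<alpha>1, \<alpha>, \<beta>, \<gamma>) x.
     if x \<in> {\<gamma>1..\<beta>1} then (\<gamma>1\<^sup>2 - x\<^sup>2) / (6 * (1 + R))
     else if x \<in> {\<beta>1..\<alpha>1} then (R\<mu> - R) / (6 * R\<mu>) * (\<alpha>1\<^sup>2 - x\<^sup>2)
     else if x \<in> {\<alpha>..\<beta>} then (R\<mu> - R) / (6 * R\<mu>) * (\<alpha>\<^sup>2 - x\<^sup>2)
     else if x \<in> {\<beta>..\<gamma>} then (\<gamma>\<^sup>2 - x\<^sup>2) / (6 * (1 + R))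
     else 0)"

definition profile_G_low :: "real \<Rightarrow> real \<Rightarrow> params \<Rightarrow> real \<Rightarrow> real" where
  "profile_G_low R R\<mu> = (\<lambda>(\<gamma>1, \<beta>1, \<alpha>1, \<alpha>, \<beta>, \<gamma>) x.
     if x \<in> {\<beta>1..\<alpha>1} then (1 + R - R\<mu>) / (6 * R\<mu>) * (\<beta>1\<^sup>2 - x\<^sup>2)
     else if x \<in> {\<alpha>1..\<alpha>} then
       ((R\<mu> - R) * \<alpha>1\<^sup>2 + (1 + R - R\<mu>) * \<beta>1\<^sup>2) / (6 * R\<mu>) - x\<^sup>2 / (6 * R\<mu>)
     else if x \<in> {\<alpha>..\<beta>} then (1 + R - R\<mu>) / (6 * R\<mu>) * (\<beta>\<^sup>2 - x\<^sup>2)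
     else 0)"

definition given_by_profiles ::
  "real \<Rightarrow> real \<Rightarrow> real \<Rightarrow> params \<Rightarrow> (real \<Rightarrow> real) \<Rightarrow> (real \<Rightarrow> real) \<Rightarrow> bool" where
  "given_by_profiles R R\<mu> \<eta> z F G \<longleftrightarrow>
     (R\<mu> > R\<mu>_plus R \<eta> \<longrightarrow>
        eq_ae (\<lambda>x. \<eta>\<^sup>2 * F x) (profile_F_high R R\<mu> z) \<and> eq_ae G (profile_G_high R R\<mu> z)) \<and>
     (R\<mu> < R\<mu>_minus R \<eta> \<longrightarrow>
        eq_ae (\<lambda>x. \<eta>\<^sup>2 * F x) (profile_F_low R R\<mu> z) \<and> eq_ae G (profile_G_low R R\<mu> z))"

end

(* In the variables u = eta^2 F, v = G the system is invariant under exchanging u and v (together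
   with its coefficients), so only the regime in which v is squeezed out of the centre has to be
   studied. On a half line a stationary pair is a combination of truncated parabolas
   max (r^2 - x^2) 0 / 2 whose three radii are, up to a common scaling h, functions of the scaled
   inner radius s. The two mass constraints reduce to chi s + chi s1 = 0 for the scaled inner radii
   of the two half lines, with one strictly increasing function chi: this gives the curve
   s = chi^-1 t, s1 = chi^-1 (-t) with chi 0 <= t, -t <= chi smax. The threshold R_mu^+ is chi 0 = 0
   and R_mu^M is chi smax = - chi 0. The energy is convex, and its first variation along the curve
   only sees the difference of the two constant potentials of v times the transferred mass. *)
theory Submission
  imports Defs "HOL-Complex_Analysis.Complex_Analysis"
begin

section \<open>Weak derivatives on the line\<close>

text \<open>The equations only make each potential constant along components of its own support, so
  the second potential may take two constants once the support of v splits at the centre; this is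
  the only source of non-uniqueness. The first potential has one constant as long as p \<ge> 0,
  which is why both half lines share the scale h. The slopes p and q on the common support change
  sign at R\<mu> = R and R\<mu> = 1 + R and are never both nonpositive. If both are nonnegative, all
  constants are global and uniqueness is a monotonicity argument that uses no formulas. For q < 0,
  chi = N phi - M psi is the combination of the two mass equations from which h cancels; it
  increases because phi increases and psi decreases. Analyticity comes from inverting a holomorphic
  extension of chi. The derivative of chi vanishes at s = 0 and s = smax, so this works only inside
  the parameter interval. Weak derivatives are reduced to antiderivatives by a du Bois-Reymond lemma
  for C1 test functions.\<close>

definition prim :: "(real \<Rightarrow> real) \<Rightarrow> real \<Rightarrow> real" where
  "prim v x = integral {0..x} v - integral {x..0} v"

lemma locally_integrable_on:
  assumes "locally_integrable u"
  shows "u integrable_on {a..b}" "(LINT x:{a..b}|lebesgue. u x) = integral {a..b} u"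
  using assms set_lebesgue_integral_eq_integral unfolding locally_integrable_def by blast+

text \<open>At most one of the two integrals in \<open>prim\<close> runs over a nondegenerate
  interval, so \<open>prim v x\<close> is the oriented integral of v from 0 to x; the cases are the
  three positions of 0 relative to x and y.\<close>

lemma prim_diff:
  assumes u: "locally_integrable u" and "x \<le> y"
  shows "prim u y - prim u x = integral {x..y} u"
proof -
  note i = locally_integrable_on(1)[OF u]
  have c: "integral {a..b} u + integral {b..d} u = integral {a..d} u" if "a \<le> b" "b \<le> d" for a b d
    using Henstock_Kurzweil_Integration.integral_combine[OF that i] .
  consider "0 \<le> x" | "y \<le> 0" | "x < 0" "0 < y" using assms by linarith
  then show ?thesis
  proof cases
    case 1
    then show ?thesis using c[of 0 x y] assms(2) by (cases "x = 0"; cases "y = 0") (auto simp: prim_def)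
  next
    case 2
    then show ?thesis using c[of x y 0] assms(2) by (cases "x = 0"; cases "y = 0") (auto simp: prim_def)
  next
    case 3
    then show ?thesis using c[of x 0 y] by (auto simp: prim_def)
  qed
qed

lemma continuous_on_prim:
  assumes u: "locally_integrable u"
  shows "continuous_on UNIV (prim u)"
proof -
  have "continuous (at x) (prim u)" for x
  proof -
    have "continuous_on {x-1..x+1} (\<lambda>y. prim u (x-1) + integral {x-1..y} u)"
      by (intro continuous_intros indefinite_integral_continuous_1 locally_integrable_on u)
    moreover have "prim u (x-1) + integral {x-1..y} u = prim u y" if "y \<in> {x-1..x+1}" for y
      using prim_diff[OF u, of "x-1" y] that by auto
    ultimately have "continuous_on {x-1..x+1} (prim u)"
      by (metis (no_types, lifting) continuous_on_cong)
    then have "continuous_on {x-1<..<x+1} (prim u)"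
      by (rule continuous_on_subset) auto
    then show ?thesis by (simp add: continuous_on_eq_continuous_at)
  qed
  then show ?thesis by (simp add: continuous_at_imp_continuous_on)
qed

lemma has_derivative_prim:
  assumes "continuous_on UNIV u"
  shows "(prim u has_real_derivative u x) (at x)"
proof -
  have li: "locally_integrable u"
    unfolding locally_integrable_def using assms
    by (meson absolutely_integrable_continuous_real continuous_on_subset subset_UNIV)
  have *: "((\<lambda>y. prim u (x-1) + integral {x-1..y} u) has_real_derivative u x) (at x within {x-1..x+1})"
    by (auto intro!: derivative_eq_intros integral_has_real_derivative continuous_on_subset[OF assms])
  have "prim u (x-1) + integral {x-1..y} u = prim u y" if "y \<in> {x-1..x+1}" for y
      using prim_diff[OF li, of "x-1" y] that by auto
  then have "(prim u has_real_derivative u x) (at x within {x-1..x+1})"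
    by (intro has_field_derivative_transform_within[OF *, where d=1]) auto
  then have "(prim u has_real_derivative u x) (at x within {x-1<..<x+1})"
    by (rule DERIV_subset) auto
  then show ?thesis by (simp add: at_within_open[of x "{x-1<..<x+1}"])
qed

lemma locally_integrable_continuous:
  fixes u :: "real \<Rightarrow> real"
  assumes "continuous_on UNIV u"
  shows "locally_integrable u"
  unfolding locally_integrable_def using assms
  by (meson absolutely_integrable_continuous_real continuous_on_subset subset_UNIV)

lemma integrable_locally_integrable_mult:
  fixes u g :: "real \<Rightarrow> real"
  assumes u: "locally_integrable u" and g: "continuous_on UNIV g"
    and z: "\<And>x. x \<notin> {-k..k} \<Longrightarrow> g x = 0"
  shows "integrable lebesgue (\<lambda>x. u x * g x)"
proof -
  have "compact (g ` {-k..k})"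
    by (rule compact_continuous_image) (auto intro: continuous_on_subset[OF g])
  then obtain B where B: "\<And>x. x \<in> {-k..k} \<Longrightarrow> \<bar>g x\<bar> \<le> B"
    by (metis compact_imp_bounded bounded_iff imageI real_norm_def)
  have si: "integrable lebesgue (\<lambda>x. indicator {-k..k} x *\<^sub>R u x)"
    using u unfolding locally_integrable_def set_integrable_def by blast
  have gm: "g \<in> borel_measurable lebesgue"
    using borel_measurable_continuous_onI[OF g] by (simp add: measurable_completion)
  have eq: "(\<lambda>x. u x * g x) = (\<lambda>x. (indicator {-k..k} x *\<^sub>R u x) * g x)"
  proof
    fix x show "u x * g x = (indicator {-k..k} x *\<^sub>R u x) * g x"
      using z[of x] by (cases "x \<in> {-k..k}") auto
  qed
  show ?thesis
    unfolding eq
  proof (rule Bochner_Integration.integrable_bound)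
    show "integrable lebesgue (\<lambda>x. B * (indicator {-k..k} x *\<^sub>R u x))"
      using si by simp
    show "(\<lambda>x. (indicator {-k..k} x *\<^sub>R u x) * g x) \<in> borel_measurable lebesgue"
      using si gm by (intro borel_measurable_times) auto
    show "AE x in lebesgue. norm ((indicator {-k..k} x *\<^sub>R u x) * g x) \<le> norm (B * (indicator {-k..k} x *\<^sub>R u x))"
    proof (rule AE_I2)
      fix x show "norm ((indicator {-k..k} x *\<^sub>R u x) * g x) \<le> norm (B * (indicator {-k..k} x *\<^sub>R u x))"
      proof (cases "x \<in> {-k..k}")
        case True
        then have "\<bar>g x\<bar> \<le> \<bar>B\<bar>" using B[of x] by linarith
        then show ?thesis using mult_right_mono[of "\<bar>g x\<bar>" "\<bar>B\<bar>" "\<bar>u x\<bar>"]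
          by (auto simp: abs_mult algebra_simps indicator_def)
      qed auto
    qed
  qed
qed

lemma test_function_bounds:
  assumes "test_function \<phi>"
  shows "\<exists>k>0. \<forall>x. \<bar>x\<bar> \<ge> k \<longrightarrow> \<phi> x = 0 \<and> deriv \<phi> x = 0"
    "continuous_on UNIV \<phi>" "continuous_on UNIV (deriv \<phi>)"
    "\<And>x. (\<phi> has_real_derivative deriv \<phi> x) (at x)"
proof -
  from assms obtain D where D: "\<And>x. (\<phi> has_vector_derivative D x) (at x)" "continuous_on UNIV D"
    unfolding test_function_def C1_differentiable_on_def by auto
  have DD: "(\<phi> has_real_derivative D x) (at x)" for x
    using D(1) by (simp add: has_real_derivative_iff_has_vector_derivative)
  then have dD: "deriv \<phi> = D" by (intro ext DERIV_imp_deriv)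
  have "bounded (closure {x. \<phi> x \<noteq> 0})"
    using assms by (simp add: test_function_def compact_imp_bounded)
  then have "bounded {x. \<phi> x \<noteq> 0}"
    by (meson bounded_subset closure_subset)
  then obtain k0 where k0: "\<And>x. \<phi> x \<noteq> 0 \<Longrightarrow> \<bar>x\<bar> \<le> k0" unfolding bounded_iff by auto
  define k where "k = \<bar>k0\<bar> + 1"
  have z: "\<phi> x = 0" if "\<bar>x\<bar> > \<bar>k0\<bar>" for x using k0[of x] that by force
  have dz: "deriv \<phi> x = 0" if "\<bar>x\<bar> > \<bar>k0\<bar>" for x
  proof -
    have "eventually (\<lambda>y. y \<in> {y. \<bar>y\<bar> > \<bar>k0\<bar>}) (nhds x)"
      by (rule eventually_nhds_in_open) (auto simp: that intro!: open_Collect_less continuous_intros)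
    then have "eventually (\<lambda>y. \<phi> y = 0) (nhds x)" by eventually_elim (use z in auto)
    then have "deriv \<phi> x = deriv (\<lambda>_. 0) x" by (intro deriv_cong_ev) auto
    then show ?thesis by simp
  qed
  have "\<phi> x = 0 \<and> deriv \<phi> x = 0" if "\<bar>x\<bar> \<ge> k" for x
    using z[of x] dz[of x] that by (simp add: k_def)
  moreover have "k > 0" by (simp add: k_def)
  ultimately show "\<exists>k>0. \<forall>x. \<bar>x\<bar> \<ge> k \<longrightarrow> \<phi> x = 0 \<and> deriv \<phi> x = 0" by blast
  show "continuous_on UNIV \<phi>"
    by (rule DERIV_continuous_on) (rule has_field_derivative_at_within[OF DD])
  show "continuous_on UNIV (deriv \<phi>)" using D dD by simp
  show "(\<phi> has_real_derivative deriv \<phi> x) (at x)" for x using DD dD by simp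
qed

lemma integral_deriv_test_function:
  assumes t: "test_function \<phi>"
  shows "integrable lebesgue (deriv \<phi>)" "(LINT x|lebesgue. deriv \<phi> x) = 0"
proof -
  from test_function_bounds(1)[OF t] obtain k where k: "k > 0"
    "\<And>x. \<bar>x\<bar> \<ge> k \<Longrightarrow> deriv \<phi> x = 0" "\<And>x. \<bar>x\<bar> \<ge> k \<Longrightarrow> \<phi> x = 0" by auto
  have "integrable lebesgue (\<lambda>x. 1 * deriv \<phi> x)"
    by (rule integrable_locally_integrable_mult[where k=k])
      (auto intro!: locally_integrable_continuous k test_function_bounds(3)[OF t])
  then show "integrable lebesgue (deriv \<phi>)" by simp
  have "(LINT x|lborel. deriv \<phi> x * indicator {-k..k} x) = \<phi> k - \<phi> (-k)"
    by (rule integral_FTC_Icc_real)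
      (use k test_function_bounds[OF t] in \<open>auto simp: continuous_on_eq_continuous_at\<close>)
  moreover have "(LINT x|lborel. deriv \<phi> x * indicator {-k..k} x) = (LINT x|lborel. deriv \<phi> x)"
  proof (rule Bochner_Integration.integral_cong[OF refl])
    fix x show "deriv \<phi> x * indicator {-k..k} x = deriv \<phi> x"
      using k(2)[of x] by (cases "\<bar>x\<bar> \<ge> k") (auto simp: indicator_def)
  qed
  moreover have "(LINT x|lebesgue. deriv \<phi> x) = (LINT x|lborel. deriv \<phi> x)"
    using borel_measurable_continuous_onI[OF test_function_bounds(3)[OF t]]
    by (intro integral_completion) simp
  ultimately show "(LINT x|lebesgue. deriv \<phi> x) = 0" using k by simp
qed

text \<open>For merely locally integrable v, \<open>prim v\<close> need not be differentiable
  everywhere, so integration by parts is replaced by Fubini: up to the constant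
  \<open>prim v (-k)\<close> the left side is a double integral of v y * deriv \<phi> x over the
  triangle y \<le> x, and its inner integral over x is - \<phi> y.\<close>

lemma weak_derivative_prim:
  assumes v: "locally_integrable v"
  shows "has_weak_derivative (prim v) v"
  unfolding has_weak_derivative_def
proof (intro conjI allI impI v)
  show "locally_integrable (prim v)"
    by (rule locally_integrable_continuous[OF continuous_on_prim[OF v]])
  fix \<phi> assume t: "test_function \<phi>"
  note c = test_function_bounds(2)[OF t] and dc = test_function_bounds(3)[OF t]
    and d = test_function_bounds(4)[OF t]
  from test_function_bounds(1)[OF t] obtain k where k: "k > 0"
    and z: "\<And>x. \<bar>x\<bar> \<ge> k \<Longrightarrow> \<phi> x = 0" and dz: "\<And>x. \<bar>x\<bar> \<ge> k \<Longrightarrow> deriv \<phi> x = 0"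
    by auto
  have si: "integrable lebesgue (\<lambda>x. indicator {-k..k} x *\<^sub>R v x)"
    using v unfolding locally_integrable_def set_integrable_def by blast
  \<comment> \<open>Fubini is applied on \<open>lborel\<close>, while v is only Lebesgue measurable;
    a Borel function equal to it almost everywhere on [-k, k] takes its place.\<close>
  then obtain w where w: "w \<in> borel_measurable lborel" "AE x in lborel. indicator {-k..k} x *\<^sub>R v x = w x"
    using completion_ex_borel_measurable_real[OF borel_measurable_integrable] by blast
  define g where "g y = indicator {-k..k} y * w y" for y
  have [measurable]: "w \<in> borel_measurable borel" using w by simp
  have gm[measurable]: "g \<in> borel_measurable borel" unfolding g_def by measurable
  have gAE: "AE x in lborel. g x = indicator {-k..k} x * v x"
    using w(2)
  proof eventually_elim
    case (elim x)
    then show ?case by (cases "x \<in> {-k..k}") (auto simp: g_def)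
  qed
  then have gAE': "AE x in lebesgue. g x = indicator {-k..k} x * v x"
    by (rule AE_completion)
  have gi: "integrable lborel g"
  proof -
    have "integrable lebesgue g"
      using si gAE' by (subst integrable_cong_AE[where g="\<lambda>x. indicator {-k..k} x * v x"])
         (auto intro: measurable_completion)
    then show ?thesis by (simp add: integrable_completion)
  qed
  have pm[measurable]: "deriv \<phi> \<in> borel_measurable borel"
    using borel_measurable_continuous_onI[OF dc] .
  have dpi: "integrable lborel (deriv \<phi>)"
    using integral_deriv_test_function(1)[OF t] by (simp add: integrable_completion)
  have ps: "(LINT x|lborel. deriv \<phi> x * indicator {y..} x) = - \<phi> y" if "y \<in> {-k..k}" for y
  proof -
    have "(LINT x|lborel. deriv \<phi> x * indicator {y..k} x) = \<phi> k - \<phi> y"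
      by (rule integral_FTC_Icc_real) (use that d dc in \<open>auto simp: continuous_on_eq_continuous_at\<close>)
    moreover have "(\<lambda>x. deriv \<phi> x * indicator {y..k} x) = (\<lambda>x. deriv \<phi> x * indicator {y..} x)"
      using dz by (auto simp: indicator_def fun_eq_iff)
    ultimately show ?thesis using z[of k] k by simp
  qed
  define f where "f x y = g y * (deriv \<phi> x * indicator {y..} x)" for x y :: real
  have fm: "case_prod f \<in> borel_measurable (lborel \<Otimes>\<^sub>M lborel)"
  proof -
    have "(\<lambda>p. g (snd p) * (deriv \<phi> (fst p) * indicator {p. snd p \<le> fst p} p))
       \<in> borel_measurable (lborel \<Otimes>\<^sub>M lborel)"
      by measurable
    moreover have "(\<lambda>p. g (snd p) * (deriv \<phi> (fst p) * indicator {p. snd p \<le> fst p} p)) = case_prod f"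
      by (auto simp: f_def indicator_def fun_eq_iff)
    ultimately show ?thesis by simp
  qed
  have fi: "integrable (lborel \<Otimes>\<^sub>M lborel) (case_prod f)"
  proof (rule Bochner_Integration.integrable_bound[OF _ fm])
    show "integrable (lborel \<Otimes>\<^sub>M lborel) (\<lambda>p. g (snd p) * deriv \<phi> (fst p))"
    proof (rule lborel_pair.Fubini_integrable)
      show "(\<lambda>p. g (snd p) * deriv \<phi> (fst p)) \<in> borel_measurable (lborel \<Otimes>\<^sub>M lborel)" by simp
    qed (use gi dpi in \<open>auto simp: abs_mult\<close>)
    show "AE x in lborel \<Otimes>\<^sub>M lborel. norm (case x of (x, y) \<Rightarrow> f x y) \<le> norm (g (snd x) * deriv \<phi> (fst x))"
      by (rule AE_I2) (auto simp: f_def indicator_def)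
  qed
  have I1: "(LINT x|lborel. f x y) = - (g y * \<phi> y)" for y
    using ps[of y] by (cases "y \<in> {-k..k}") (auto simp: f_def g_def)
  have I2: "(LINT y|lborel. f x y) = (prim v x - prim v (-k)) * deriv \<phi> x" for x
  proof (cases "\<bar>x\<bar> < k")
    case True
    have "(LINT y|lborel. f x y) = deriv \<phi> x * (LINT y|lborel. g y * indicator {..x} y)"
      unfolding f_def by (subst integral_mult_right_zero[symmetric])
        (rule arg_cong[where f="integral\<^sup>L _"], auto simp: indicator_def fun_eq_iff)
    also have "(LINT y|lborel. g y * indicator {..x} y) = (LINT y|lebesgue. g y * indicator {..x} y)"
      by (subst integral_completion) auto
    also have "\<dots> = (LINT y:{-k..x}|lebesgue. v y)"
      unfolding set_lebesgue_integral_def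
    proof (rule integral_cong_AE)
      show "(\<lambda>y. g y * indicator {..x} y) \<in> borel_measurable lebesgue"
        by (rule measurable_completion) measurable
      show "(\<lambda>y. indicator {-k..x} y *\<^sub>R v y) \<in> borel_measurable lebesgue"
        using v unfolding locally_integrable_def set_integrable_def by blast
      show "AE y in lebesgue. g y * indicator {..x} y = indicator {-k..x} y *\<^sub>R v y"
        using gAE' by eventually_elim (use True in \<open>auto simp: indicator_def\<close>)
    qed
    also have "\<dots> = prim v x - prim v (-k)"
      using prim_diff[OF v, of "-k" x] True locally_integrable_on(2)[OF v] by simp
    finally show ?thesis by simp
  qed (use dz in \<open>auto simp: f_def\<close>)
  have pi: "integrable lebesgue (\<lambda>x. prim v x * deriv \<phi> x)"
    by (rule integrable_locally_integrable_mult[where k=k])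
      (auto intro!: locally_integrable_continuous continuous_on_prim v dc dz)
  have tot: "(LINT x|lebesgue. deriv \<phi> x) = 0" by (rule integral_deriv_test_function(2)[OF t])
  have dpi': "integrable lebesgue (deriv \<phi>)" using dpi by (simp add: integrable_completion)
  \<comment> \<open>Subtracting the constant \<open>prim v (-k)\<close> changes nothing because
    \<open>deriv \<phi>\<close> has integral 0.\<close>
  have "(LINT x|lebesgue. prim v x * deriv \<phi> x)
      = (LINT x|lebesgue. prim v x * deriv \<phi> x) - prim v (-k) * (LINT x|lebesgue. deriv \<phi> x)"
    using tot by simp
  also have "\<dots> = (LINT x|lebesgue. (prim v x - prim v (-k)) * deriv \<phi> x)"
    using pi dpi' by (simp add: left_diff_distrib)
  also have "\<dots> = (LINT x|lebesgue. (LINT y|lborel. f x y))" by (simp add: I2)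
  also have "\<dots> = (LINT x|lborel. (LINT y|lborel. f x y))"
    using lborel.borel_measurable_lebesgue_integral[OF fm] by (subst integral_completion) simp_all
  also have "\<dots> = (LINT y|lborel. (LINT x|lborel. f x y))"
    using lborel_pair.Fubini_integral[OF fi] by simp
  also have "\<dots> = - (LINT y|lborel. g y * \<phi> y)" by (simp add: I1)
  also have "(LINT y|lborel. g y * \<phi> y) = (LINT y|lebesgue. g y * \<phi> y)"
    using borel_measurable_continuous_onI[OF c] by (subst integral_completion) auto
  also have "\<dots> = (LINT y|lebesgue. v y * \<phi> y)"
  proof (rule integral_cong_AE)
    show "(\<lambda>y. g y * \<phi> y) \<in> borel_measurable lebesgue"
      using borel_measurable_continuous_onI[OF c] by (intro measurable_completion) auto
    show "(\<lambda>y. v y * \<phi> y) \<in> borel_measurable lebesgue"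
      by (rule borel_measurable_integrable, rule integrable_locally_integrable_mult[where k=k])
        (auto intro!: v c z)
    show "AE y in lebesgue. g y * \<phi> y = v y * \<phi> y"
      using gAE'
    proof eventually_elim
      case (elim y)
      then show ?case using z[of y] by (cases "\<bar>y\<bar> \<ge> k") (auto simp: indicator_def)
    qed
  qed
  finally show "(LINT x|lebesgue. prim v x * deriv \<phi> x) = - (LINT x|lebesgue. v x * \<phi> x)" .
qed

section \<open>Functions orthogonal to all derivatives of test functions\<close>

lemma AE_zero_if_integral_atMost_zero:
  fixes f :: "real \<Rightarrow> real"
  assumes f: "integrable lborel f" and z: "\<And>a. (LINT x:{..a}|lborel. f x) = 0"
  shows "AE x in lborel. f x = 0"
proof (rule sigma_finite_measure.density_zero[OF sigma_finite_lborel f])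
  have si: "set_integrable lborel A f" if "A \<in> sets borel" for A
    unfolding set_integrable_def using f that by (intro integrable_mult_indicator) auto
  have tot: "integral\<^sup>L lborel f = 0"
  proof -
    have "(\<lambda>n. LINT x:{..real n}|lborel. f x) \<longlonglongrightarrow> integral\<^sup>L lborel f"
      unfolding set_lebesgue_integral_def
    proof (rule integral_dominated_convergence[where w="\<lambda>x. norm (f x)"])
      show "AE x in lborel. (\<lambda>n. indicator {..real n} x *\<^sub>R f x) \<longlonglongrightarrow> f x"
      proof (rule AE_I2)
        fix x
        obtain m :: nat where m: "x \<le> real m" using real_arch_simple by blast
        have "eventually (\<lambda>n. indicator {..real n} x *\<^sub>R f x = f x) sequentially"
          using eventually_ge_at_top[of m] by eventually_elim (use m in \<open>auto simp: indicator_def\<close>)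
        then show "(\<lambda>n. indicator {..real n} x *\<^sub>R f x) \<longlonglongrightarrow> f x"
          by (rule tendsto_eventually)
      qed
    qed (use f in \<open>auto simp: indicator_def\<close>)
    then show ?thesis using z by (simp add: LIMSEQ_const_iff)
  qed
  \<comment> \<open>Half lines are an intersection-stable generator of the Borel sets, so Dynkin
    induction extends the vanishing of the integrals to every Borel set; the complement step uses
    the total integral \<open>tot\<close>.\<close>
  have bs: "A \<in> sets borel \<longleftrightarrow> A \<in> sigma_sets UNIV (range (\<lambda>a::real. {..a}))" for A :: "real set"
    by (subst borel_eq_atMost) simp
  fix A :: "real set" assume "A \<in> sets lborel"
  then have A: "A \<in> sigma_sets UNIV (range (\<lambda>a::real. {..a}))" using bs by simp
  have stable: "Int_stable (range (\<lambda>a::real. {..a}))" by (auto simp: Int_stable_def)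
  have sub: "range (\<lambda>a::real. {..a}) \<subseteq> Pow UNIV" by simp
  from stable sub A show "(LINT x:A|lborel. f x) = 0"
  proof (induction rule: sigma_sets_induct_disjoint)
    case (basic A)
    then show ?case using z by auto
  next
    case empty
    then show ?case by (simp add: set_lebesgue_integral_def)
  next
    case (compl A)
    have A: "A \<in> sets borel" using compl(1) bs by simp
    have "(LINT x:A \<union> (UNIV - A)|lborel. f x) = (LINT x:A|lborel. f x) + (LINT x:UNIV - A|lborel. f x)"
      by (rule set_integral_Un) (use A in \<open>auto intro!: si\<close>)
    then show ?case using compl tot by (simp add: set_lebesgue_integral_def)
  next
    case (union A)
    have A: "A i \<in> sets borel" for i using union(2) bs by auto
    have "(LINT x:(\<Union>i. A i)|lborel. f x) = (\<Sum>i. LINT x:A i|lborel. f x)"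
      by (rule lebesgue_integral_countable_add)
        (use A union(1) in \<open>auto simp: disjoint_family_on_def intro!: si\<close>)
    then show ?case using union by simp
  qed
qed

lemma locally_integrable_add:
  "locally_integrable u \<Longrightarrow> locally_integrable v \<Longrightarrow> locally_integrable (\<lambda>x. u x + v x)"
  by (auto simp: locally_integrable_def)

lemma locally_integrable_diff:
  "locally_integrable u \<Longrightarrow> locally_integrable v \<Longrightarrow> locally_integrable (\<lambda>x. u x - v x)"
  by (auto simp: locally_integrable_def)

text \<open>A continuous, compactly supported function of mean zero is the derivative of a test
  function, so w annihilates it. Correcting an arbitrary continuous function by a multiple of one
  fixed hat shows that w acts as C times the Lebesgue integral; passing to indicators of intervals
  gives w = C almost everywhere.\<close>

lemma AE_const_if_orthogonal:
  assumes w: "locally_integrable w"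
    and orth: "\<And>\<phi>. test_function \<phi> \<Longrightarrow> (LINT x|lebesgue. w x * deriv \<phi> x) = 0"
  shows "\<exists>c. AE x in lebesgue. w x = c"
proof -
  have orth0: "(LINT x|lebesgue. w x * \<psi> x) = 0"
    if c: "continuous_on UNIV \<psi>" and z: "\<And>x. \<bar>x\<bar> \<ge> k \<Longrightarrow> \<psi> x = 0" and k: "k > 0"
      and i: "integral {-k..k} \<psi> = 0" for \<psi> k
  proof -
    note li = locally_integrable_continuous[OF c]
    define \<phi> where "\<phi> x = prim \<psi> x - prim \<psi> (-k)" for x
    have d: "(\<phi> has_real_derivative \<psi> x) (at x)" for x
      unfolding \<phi>_def by (auto intro!: derivative_eq_intros has_derivative_prim c)
    have dd: "deriv \<phi> = \<psi>" using d by (intro ext DERIV_imp_deriv)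
    have "\<phi> x = 0" if "\<bar>x\<bar> > k" for x
    proof (cases "x > k")
      case True
      have "\<phi> x = integral {-k..k} \<psi> + integral {k..x} \<psi>"
        using True k prim_diff[OF li, of "-k" k] prim_diff[OF li, of k x] by (simp add: \<phi>_def)
      moreover have "integral {k..x} \<psi> = integral {k..x} (\<lambda>_. 0)"
        by (rule integral_cong) (use z in auto)
      ultimately show ?thesis using i by simp
    next
      case False
      then have x: "x < -k" using that by linarith
      have "\<phi> x = - integral {x..-k} \<psi>"
        using x prim_diff[OF li, of x "-k"] by (simp add: \<phi>_def)
      moreover have "integral {x..-k} \<psi> = integral {x..-k} (\<lambda>_. 0)"
        by (rule integral_cong) (use z k in auto)
      ultimately show ?thesis by simp
    qed
    then have "{x. \<phi> x \<noteq> 0} \<subseteq> {-k..k}" by (force simp: abs_le_iff not_less)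
    then have "compact (closure {x. \<phi> x \<noteq> 0})"
      by (meson bounded_closed_interval bounded_subset compact_closure)
    moreover have "\<phi> C1_differentiable_on UNIV"
      unfolding C1_differentiable_on_def using d c
      by (auto simp: has_real_derivative_iff_has_vector_derivative)
    ultimately have "test_function \<phi>" by (simp add: test_function_def)
    from orth[OF this] show ?thesis by (simp add: dd)
  qed
  \<comment> \<open>The correcting hat; what counts is its nonzero mean \<open>I\<close>.\<close>
  define \<psi>0 :: "real \<Rightarrow> real" where "\<psi>0 x = max 0 (1 - \<bar>x\<bar>)" for x
  have \<psi>0c: "continuous_on UNIV \<psi>0" unfolding \<psi>0_def by (intro continuous_intros)
  have \<psi>0z: "\<psi>0 x = 0" if "\<bar>x\<bar> \<ge> 1" for x using that by (simp add: \<psi>0_def)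
  define I where "I = integral {-1..1} \<psi>0"
  have ext: "integral {-k..k} \<psi> = integral {-l..l} \<psi>"
    if c: "continuous_on UNIV \<psi>" and z: "\<And>x. \<bar>x\<bar> \<ge> l \<Longrightarrow> \<psi> x = 0" "l > 0" "l \<le> k" for \<psi> :: "real \<Rightarrow> real" and k l
  proof -
    have "(\<psi> has_integral integral {-l..l} \<psi>) {-l..l}"
      by (rule integrable_integral) (auto intro: integrable_continuous_real continuous_on_subset[OF c])
    then have "(\<psi> has_integral integral {-l..l} \<psi>) {-k..k}"
      by (rule has_integral_on_superset) (use z in \<open>auto simp: abs_if\<close>)
    then show ?thesis by (rule integral_unique)
  qed
  have I0: "I > 0"
  proof -
    have "integral {-1..1} \<psi>0 \<noteq> 0"
    proof
      assume "integral {-1..1} \<psi>0 = 0"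
      then have "\<psi>0 x = 0" if "x \<in> cbox (-1) 1" for x
        by (intro integral_eq_0_iff[THEN iffD1, rule_format, where a="-1" and b=1 and f=\<psi>0])
          (use that continuous_on_subset[OF \<psi>0c, of "{-1..1}"] in \<open>auto simp: \<psi>0_def\<close>)
      from this[of 0] show False by (simp add: \<psi>0_def)
    qed
    moreover have "integral {-1..1} \<psi>0 \<ge> 0"
      by (rule integral_nonneg) (auto intro!: integrable_continuous_real continuous_on_subset[OF \<psi>0c] simp: \<psi>0_def)
    ultimately show ?thesis by (simp add: I_def)
  qed
  define C where "C = (LINT x|lebesgue. w x * \<psi>0 x) / I"
  have lin: "(LINT x|lebesgue. w x * \<tau> x) = C * integral {-k..k} \<tau>"
    if c: "continuous_on UNIV \<tau>" and z: "\<And>x. \<bar>x\<bar> \<ge> k \<Longrightarrow> \<tau> x = 0" and k: "k \<ge> 1" for \<tau> k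
  proof -
    define J where "J = integral {-k..k} \<tau> / I"
    have "(LINT x|lebesgue. w x * (\<tau> x - J * \<psi>0 x)) = 0"
    proof (rule orth0)
      show "continuous_on UNIV (\<lambda>x. \<tau> x - J * \<psi>0 x)" by (intro continuous_intros c \<psi>0c)
      show "integral {-k..k} (\<lambda>x. \<tau> x - J * \<psi>0 x) = 0"
      proof -
        have "integral {-k..k} (\<lambda>x. \<tau> x - J * \<psi>0 x) = integral {-k..k} \<tau> - J * integral {-k..k} \<psi>0"
          by (subst Henstock_Kurzweil_Integration.integral_diff)
            (auto intro!: integrable_continuous_real continuous_on_subset[OF c]
              continuous_on_subset[OF \<psi>0c] continuous_intros)
        also have "integral {-k..k} \<psi>0 = I" unfolding I_def by (rule ext) (use \<psi>0c \<psi>0z k in auto)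
        finally show ?thesis using I0 by (simp add: J_def)
      qed
      show "\<tau> x - J * \<psi>0 x = 0" if "\<bar>x\<bar> \<ge> k" for x using z[OF that] \<psi>0z[of x] that k by simp
    qed (use k in auto)
    moreover have "(LINT x|lebesgue. w x * (\<tau> x - J * \<psi>0 x))
       = (LINT x|lebesgue. w x * \<tau> x) - J * (LINT x|lebesgue. w x * \<psi>0 x)"
    proof -
      have 1: "integrable lebesgue (\<lambda>x. w x * \<tau> x)"
        by (rule integrable_locally_integrable_mult[where k=k]) (use w c z in auto)
      have 2: "integrable lebesgue (\<lambda>x. w x * \<psi>0 x)"
        by (rule integrable_locally_integrable_mult[where k=1]) (use w \<psi>0c \<psi>0z in auto)
      have "(\<lambda>x. w x * (\<tau> x - J * \<psi>0 x)) = (\<lambda>x. w x * \<tau> x - J * (w x * \<psi>0 x))"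
        by (auto simp: algebra_simps)
      then show ?thesis using 1 2 by simp
    qed
    ultimately show ?thesis by (simp add: C_def J_def)
  qed
  have main: "(LINT x|lebesgue. w x * indicator {a<..<b} x) = C * (b - a)" if ab: "a < b" for a b
  proof -
    define k where "k = max 1 (max \<bar>a\<bar> \<bar>b\<bar>)"
    \<comment> \<open>Products of two ramps: they vanish outside (a, b), take values in [0, 1] and
      are eventually 1 at each interior point, so they converge boundedly to the indicator.\<close>
    define \<tau> where "\<tau> n x = max 0 (min 1 (real n * (x - a))) * max 0 (min 1 (real n * (b - x)))" for n x
    have c: "continuous_on UNIV (\<tau> n)" for n unfolding \<tau>_def by (intro continuous_intros)
    have z: "\<tau> n x = 0" if "x \<le> a \<or> b \<le> x" for n x
      using that mult_nonneg_nonpos[of "real n" "x - a"] mult_nonneg_nonpos[of "real n" "b - x"]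
      by (auto simp: \<tau>_def max_def min_def)
    have zk: "\<tau> n x = 0" if "\<bar>x\<bar> \<ge> k" for n x by (rule z) (use that in \<open>auto simp: k_def abs_if split: if_splits\<close>)
    have b01: "0 \<le> \<tau> n x" "\<tau> n x \<le> 1" for n x
      by (auto simp: \<tau>_def intro!: mult_le_one)
    have lim: "(\<lambda>n. \<tau> n x) \<longlonglongrightarrow> indicator {a<..<b} x" for x
    proof (cases "x \<in> {a<..<b}")
      case True
      obtain m1 m2 :: nat where m: "1 / (x - a) \<le> real m1" "1 / (b - x) \<le> real m2"
        by (meson real_arch_simple)
      have "eventually (\<lambda>n. \<tau> n x = 1) sequentially"
        using eventually_ge_at_top[of "max m1 m2"]
      proof eventually_elim
        case (elim n)
        have "1 / (x - a) \<le> real n" "1 / (b - x) \<le> real n" using m elim by (auto intro: order_trans)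
        then have "1 \<le> real n * (x - a)" "1 \<le> real n * (b - x)" using True by (auto simp: field_simps)
        then show ?case by (simp add: \<tau>_def)
      qed
      then show ?thesis using True by (simp add: tendsto_eventually)
    next
      case False
      then have "\<tau> n x = 0" for n by (intro z) auto
      then show ?thesis using False by simp
    qed
    have im: "w \<in> borel_measurable lebesgue"
    proof -
      have "(\<lambda>x. indicator {-real n..real n} x *\<^sub>R w x) \<in> borel_measurable lebesgue" for n
        using w unfolding locally_integrable_def set_integrable_def by blast
      moreover have "(\<lambda>n. indicator {-real n..real n} x *\<^sub>R w x) \<longlonglongrightarrow> w x" for x
      proof -
        obtain m :: nat where m: "\<bar>x\<bar> \<le> real m" using real_arch_simple by blast
        have "eventually (\<lambda>n. indicator {-real n..real n} x *\<^sub>R w x = w x) sequentially"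
          using eventually_ge_at_top[of m] by eventually_elim (use m in \<open>auto simp: indicator_def\<close>)
        then show ?thesis by (rule tendsto_eventually)
      qed
      ultimately show ?thesis by (rule borel_measurable_LIMSEQ_real[rotated])
    qed
    have si: "integrable lebesgue (\<lambda>x. indicator {a..b} x *\<^sub>R w x)"
      using w unfolding locally_integrable_def set_integrable_def by blast
    have l1: "(\<lambda>n. LINT x|lebesgue. w x * \<tau> n x) \<longlonglongrightarrow> (LINT x|lebesgue. w x * indicator {a<..<b} x)"
    proof (rule integral_dominated_convergence[where w="\<lambda>x. norm (indicator {a..b} x *\<^sub>R w x)"])
      show "AE x in lebesgue. (\<lambda>n. w x * \<tau> n x) \<longlonglongrightarrow> w x * indicator {a<..<b} x"
        by (rule AE_I2) (intro tendsto_intros lim)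
      show "AE x in lebesgue. norm (w x * \<tau> n x) \<le> norm (indicator {a..b} x *\<^sub>R w x)" for n
      proof (rule AE_I2)
        fix x show "norm (w x * \<tau> n x) \<le> norm (indicator {a..b} x *\<^sub>R w x)"
          using z[of x n] b01[of n x] mult_left_mono[of "\<tau> n x" 1 "\<bar>w x\<bar>"]
          by (cases "x \<in> {a..b}") (auto simp: abs_mult)
      qed
      show "(\<lambda>x. w x * \<tau> n x) \<in> borel_measurable lebesgue" for n
        using borel_measurable_continuous_onI[OF c]
        by (intro borel_measurable_times im) (simp add: measurable_completion)
      show "(\<lambda>x. w x * indicator {a<..<b} x) \<in> borel_measurable lebesgue"
        by (intro borel_measurable_times im) (simp add: measurable_completion)
    qed (use si im in auto)
    have l2: "(\<lambda>n. integral {-k..k} (\<tau> n)) \<longlonglongrightarrow> b - a"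
    proof -
      have "(\<lambda>n. integral {-k..k} (\<tau> n)) \<longlonglongrightarrow> integral {-k..k} (indicator {a<..<b})"
      proof (rule dominated_convergence(2)[where h="\<lambda>_. 1"])
        show "\<tau> n integrable_on {-k..k}" for n
          by (auto intro: integrable_continuous_real continuous_on_subset[OF c])
      qed (use b01 lim in auto)
      also have "integral {-k..k} (indicator {a<..<b}) = b - a"
      proof -
        have "((\<lambda>_. 1::real) has_integral (b - a)) {a<..<b}"
          using has_integral_const_real[of "1::real" a b] ab
          by (simp add: has_integral_Icc_iff_Ioo)
        then have "(indicator {a<..<b} has_integral (b - a)) {a<..<b}"
          by (rule has_integral_eq[rotated]) auto
        then have "(indicator {a<..<b} has_integral (b - a)) {-k..k}"
          by (rule has_integral_on_superset) (auto simp: k_def)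
        then show ?thesis by (rule integral_unique)
      qed
      finally show ?thesis .
    qed
    have "(\<lambda>n. C * integral {-k..k} (\<tau> n)) \<longlonglongrightarrow> (LINT x|lebesgue. w x * indicator {a<..<b} x)"
    proof -
      have "(LINT x|lebesgue. w x * \<tau> n x) = C * integral {-k..k} (\<tau> n)" for n
        by (rule lin[OF c zk]) (auto simp: k_def)
      then show ?thesis using l1 by simp
    qed
    moreover have "(\<lambda>n. C * integral {-k..k} (\<tau> n)) \<longlonglongrightarrow> C * (b - a)"
      by (intro tendsto_intros l2)
    ultimately show ?thesis by (rule LIMSEQ_unique)
  qed
  have "AE x in lebesgue. x \<in> {-real n<..<real n} \<longrightarrow> w x = C" for n
  proof -
    define k where "k = real n"
    have "integrable lebesgue (\<lambda>x. indicator {-k<..<k} x *\<^sub>R (w x - C))"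
    proof -
      have "set_integrable lebesgue {-k..k} (\<lambda>x. w x - C)"
        using w unfolding locally_integrable_def
        by (intro set_integral_diff) (auto intro!: absolutely_integrable_continuous_real)
      then have "set_integrable lebesgue {-k<..<k} (\<lambda>x. w x - C)"
        by (rule set_integrable_subset) auto
      then show ?thesis by (simp add: set_integrable_def)
    qed
    note fi = this
    then obtain f where f: "f \<in> borel_measurable lborel"
        "AE x in lborel. indicator {-k<..<k} x *\<^sub>R (w x - C) = f x"
      using completion_ex_borel_measurable_real[OF borel_measurable_integrable] by blast
    have fm: "f \<in> borel_measurable lebesgue" using f(1) by (rule measurable_completion)
    have fAE: "AE x in lebesgue. indicator {-k<..<k} x *\<^sub>R (w x - C) = f x" using f(2) by (rule AE_completion)
    have "integrable lebesgue f"
      using fi fAE fm by (subst integrable_cong_AE[symmetric, where f="\<lambda>x. indicator {-k<..<k} x *\<^sub>R (w x - C)"]) auto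
    then have fint: "integrable lborel f" using f(1) by (simp add: integrable_completion)
    have "AE x in lborel. f x = 0"
    proof (rule AE_zero_if_integral_atMost_zero[OF fint])
      fix a
      \<comment> \<open>Inside (-k, k) the half line ending at a cuts out (-k, b), which is empty
        when a \<le> -k; the single point b is discarded as a null set.\<close>
      define b where "b = min a k"
      have "(LINT x:{..a}|lborel. f x) = (LINT x|lebesgue. indicator {..a} x * f x)"
        unfolding set_lebesgue_integral_def using f(1) by (subst integral_completion) auto
      also have "\<dots> = (LINT x|lebesgue. indicator {-k<..<b} x *\<^sub>R (w x - C))"
      proof (rule integral_cong_AE)
        show "(\<lambda>x. indicator {..a} x * f x) \<in> borel_measurable lebesgue"
          using f(1) by (intro measurable_completion) auto
        have "integrable lebesgue (\<lambda>x. indicator {-k<..<b} x *\<^sub>R (indicator {-k<..<k} x *\<^sub>R (w x - C)))"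
          by (rule integrable_mult_indicator[OF _ fi]) simp
        moreover have "(\<lambda>x. indicator {-k<..<b} x *\<^sub>R (indicator {-k<..<k} x *\<^sub>R (w x - C)))
            = (\<lambda>x. indicator {-k<..<b} x *\<^sub>R (w x - C))"
          by (auto simp: indicator_def b_def fun_eq_iff)
        ultimately show "(\<lambda>x. indicator {-k<..<b} x *\<^sub>R (w x - C)) \<in> borel_measurable lebesgue"
          using borel_measurable_integrable by fastforce
        have "AE x in lebesgue. x \<notin> {b}" by (rule AE_completion) (rule AE_lborel_singleton[THEN AE_mp], auto)
        then show "AE x in lebesgue. indicator {..a} x * f x = indicator {-k<..<b} x *\<^sub>R (w x - C)"
          using fAE
        proof eventually_elim
          case (elim x)
          show ?case unfolding elim(2)[symmetric] using elim(1) by (auto simp: indicator_def b_def min_def)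
        qed
      qed
      also have "\<dots> = 0"
      proof (cases "-k < b")
        case True
        have i1: "integrable lebesgue (\<lambda>x. w x * indicator {-k<..<b} x)"
        proof -
          have "set_integrable lebesgue {-k<..<b} w"
            using w unfolding locally_integrable_def by (rule_tac set_integrable_subset[of _ "{-k..b}"]) auto
          then show ?thesis by (simp add: set_integrable_def mult.commute)
        qed
        have i2: "integrable lebesgue (\<lambda>x. C * indicator {-k<..<b} x)"
          using True by (intro integrable_mult_right integrable_real_indicator) auto
        have "(LINT x|lebesgue. indicator {-k<..<b} x *\<^sub>R (w x - C))
          = (LINT x|lebesgue. w x * indicator {-k<..<b} x - C * indicator {-k<..<b} x)"
          by (rule Bochner_Integration.integral_cong) (auto simp: algebra_simps)
        also have "\<dots> = C * (b + k) - C * (LINT x|lebesgue. indicator {-k<..<b} x)"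
          using i1 i2 main[OF True] by simp
        also have "(LINT x|lebesgue. indicator {-k<..<b} x) = b + k"
          using True by simp
        finally show ?thesis by simp
      qed simp
      finally show "(LINT x:{..a}|lborel. f x) = 0" .
    qed
    then have "AE x in lebesgue. f x = 0" by (rule AE_completion)
    with fAE show ?thesis
    proof eventually_elim
      case (elim x)
      then show ?case by (auto simp: k_def)
    qed
  qed
  then have "AE x in lebesgue. \<forall>n. x \<in> {-real n<..<real n} \<longrightarrow> w x = C"
    by (subst AE_all_countable) blast
  then have "AE x in lebesgue. w x = C"
  proof eventually_elim
    case (elim x)
    obtain n :: nat where "\<bar>x\<bar> < real n" using reals_Archimedean2 by blast
    then show ?case using elim[rule_format, of n] by (auto simp: abs_less_iff)
  qed
  then show ?thesis by blast
qed

text \<open>Both u and \<open>prim v\<close> have weak derivative v, so their difference is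
  orthogonal to the derivatives of all test functions.\<close>

lemma weak_derivative_imp_prim:
  assumes "has_weak_derivative u v"
  obtains c where "AE x in lebesgue. u x = c + prim v x"
proof -
  have u: "locally_integrable u" and v: "locally_integrable v" using assms by (auto simp: has_weak_derivative_def)
  have lp: "locally_integrable (prim v)"
    using v continuous_on_prim locally_integrable_continuous by blast
  have "\<exists>c. AE x in lebesgue. u x - prim v x = c"
  proof (rule AE_const_if_orthogonal)
    show "locally_integrable (\<lambda>x. u x - prim v x)" using u lp by (rule locally_integrable_diff)
    fix \<phi> assume t: "test_function \<phi>"
    from test_function_bounds(1)[OF t] obtain k where k: "k > 0"
      "\<And>x. \<bar>x\<bar> \<ge> k \<Longrightarrow> deriv \<phi> x = 0" by auto
    have 1: "integrable lebesgue (\<lambda>x. u x * deriv \<phi> x)" "integrable lebesgue (\<lambda>x. prim v x * deriv \<phi> x)"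
      using k test_function_bounds(3)[OF t] u lp by (auto intro!: integrable_locally_integrable_mult[where k=k])
    have "(LINT x|lebesgue. u x * deriv \<phi> x) = (LINT x|lebesgue. prim v x * deriv \<phi> x)"
      using assms weak_derivative_prim[OF v] t by (auto simp: has_weak_derivative_def)
    then show "(LINT x|lebesgue. (u x - prim v x) * deriv \<phi> x) = 0"
      using 1 by (simp add: left_diff_distrib)
  qed
  then obtain c where "AE x in lebesgue. u x - prim v x = c" by blast
  then have "AE x in lebesgue. u x = c + prim v x" by eventually_elim simp
  then show ?thesis by (rule that)
qed

lemma AE_eq_continuous_imp_eq:
  fixes f g :: "real \<Rightarrow> real"
  assumes "AE x in lebesgue. f x = g x" "continuous_on UNIV f" "continuous_on UNIV g"
  shows "f = g"
proof (rule ext, rule ccontr)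
  fix x assume x: "f x \<noteq> g x"
  have o: "open {x. f x \<noteq> g x}" using assms by (intro open_Collect_neq)
  have "negligible {x. f x \<noteq> g x}"
    using assms(1) by (auto simp: eventually_ae_filter negligible_iff_null_sets intro: null_sets_completion_subset)
  then show False using open_not_negligible[OF o] x by blast
qed

text \<open>The fundamental theorem tolerates finitely many exceptional points, so u is still an
  antiderivative of v. The explicit profiles have kinks at their radii, and this is how they obtain
  weak derivatives.\<close>

lemma weak_derivative_piecewise:
  assumes c: "continuous_on UNIV u" and v: "locally_integrable v" and S: "finite S"
    and d: "\<And>x. x \<notin> S \<Longrightarrow> (u has_real_derivative v x) (at x)"
  shows "has_weak_derivative u v"
proof -
  have eq: "u = (\<lambda>x. u 0 + prim v x)"
  proof
    fix x
    have h: "integral {a..b} v = u b - u a" if "a \<le> b" for a b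
      using fundamental_theorem_of_calculus_interior_strong[OF S that, of u v] d c
      by (auto simp: has_real_derivative_iff_has_vector_derivative intro: continuous_on_subset integral_unique)
    show "u x = u 0 + prim v x"
      using h[of 0 x] h[of x 0] by (cases "x = 0"; cases "x > 0") (auto simp: prim_def)
  qed
  have li: "locally_integrable (\<lambda>x. u 0 + prim v x)"
    by (intro locally_integrable_continuous continuous_intros continuous_on_prim v)
  have "has_weak_derivative (\<lambda>x. u 0 + prim v x) v"
    unfolding has_weak_derivative_def
  proof (intro conjI allI impI li v)
    fix \<phi> assume t: "test_function \<phi>"
    from test_function_bounds(1)[OF t] obtain k where k: "k > 0"
      "\<And>x. \<bar>x\<bar> \<ge> k \<Longrightarrow> deriv \<phi> x = 0" "\<And>x. \<bar>x\<bar> \<ge> k \<Longrightarrow> \<phi> x = 0" by auto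
    have lp: "locally_integrable (prim v)"
      using v continuous_on_prim locally_integrable_continuous by blast
    have 1: "integrable lebesgue (\<lambda>x. prim v x * deriv \<phi> x)"
      using k test_function_bounds(3)[OF t] lp by (auto intro!: integrable_locally_integrable_mult[where k=k])
    note 2 = integral_deriv_test_function[OF t]
    have "(LINT x|lebesgue. prim v x * deriv \<phi> x) = - (LINT x|lebesgue. v x * \<phi> x)"
      using weak_derivative_prim[OF v] t by (auto simp: has_weak_derivative_def)
    then show "(LINT x|lebesgue. (u 0 + prim v x) * deriv \<phi> x) = - (LINT x|lebesgue. v x * \<phi> x)"
      using 1 2 by (simp add: distrib_right)
  qed
  then show ?thesis using eq by simp
qed

section \<open>Stationary pairs on a half line\<close>

text \<open>For m = 1 this is \<open>K_space \<inter> H1\<close>. A free mass is needed since u =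
  \<open>\<eta>\<^sup>2 * F\<close> has mass \<open>\<eta>\<^sup>2\<close>, and exchanging the
  components exchanges the masses.\<close>

definition admissible :: "real \<Rightarrow> (real \<Rightarrow> real) \<Rightarrow> bool" where
  "admissible m u \<longleftrightarrow> u \<in> borel_measurable lebesgue \<and> integrable lebesgue (\<lambda>x. (1 + x\<^sup>2) * u x) \<and>
     (AE x in lebesgue. 0 \<le> u x) \<and> (LINT x|lebesgue. u x) = m \<and> u \<in> H1"

text \<open>With \<open>u = \<eta>\<^sup>2 F\<close> and \<open>v = G\<close> the system of the theorem is the case \<open>\<rho> = R / (1 + R)\<close>, \<open>\<sigma> = 1\<close>,
  \<open>A = 1 / (3 (1 + R))\<close>, \<open>B = 1 / (3 R\<mu>)\<close>, \<open>M = \<eta>\<^sup>2\<close>, \<open>N = 1\<close>.\<close>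

definition weak_sol where
  "weak_sol \<rho> \<sigma> A B M N u v \<longleftrightarrow> admissible M u \<and> admissible N v \<and>
     (\<exists>D1 D2. has_weak_derivative (\<lambda>x. u x + \<rho> * v x + A * x\<^sup>2 / 2) D1 \<and>
              has_weak_derivative (\<lambda>x. \<sigma> * u x + v x + B * x\<^sup>2 / 2) D2 \<and>
        (AE x in lebesgue. u x * D1 x = 0) \<and> (AE x in lebesgue. v x * D2 x = 0))"

lemma weak_sol_swap: "weak_sol \<rho> \<sigma> A B M N u v \<longleftrightarrow> weak_sol \<sigma> \<rho> B A N M v u"
  unfolding weak_sol_def by (auto simp: add.commute)

text \<open>What the weak equations say about continuous representatives on [0, \<infinity>): each
  potential is constant along every interval on which its own density is positive. Distinct
  components of a support may carry distinct constants.\<close>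

definition half_sol :: "real \<Rightarrow> real \<Rightarrow> real \<Rightarrow> real \<Rightarrow> (real \<Rightarrow> real) \<Rightarrow> (real \<Rightarrow> real) \<Rightarrow> bool" where
  "half_sol \<rho> \<sigma> A B u v \<longleftrightarrow> continuous_on {0..} u \<and> continuous_on {0..} v \<and>
     (\<forall>x\<ge>0. 0 \<le> u x \<and> 0 \<le> v x) \<and>
     (\<forall>x y. 0 \<le> x \<and> x \<le> y \<and> (\<forall>z\<in>{x..y}. 0 < u z) \<longrightarrow>
        u x + \<rho> * v x + A * x\<^sup>2 / 2 = u y + \<rho> * v y + A * y\<^sup>2 / 2) \<and>
     (\<forall>x y. 0 \<le> x \<and> x \<le> y \<and> (\<forall>z\<in>{x..y}. 0 < v z) \<longrightarrow>
        \<sigma> * u x + v x + B * x\<^sup>2 / 2 = \<sigma> * u y + v y + B * y\<^sup>2 / 2)"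

lemma half_sol_swap: "half_sol \<rho> \<sigma> A B u v \<longleftrightarrow> half_sol \<sigma> \<rho> B A v u"
  unfolding half_sol_def by (auto simp: add.commute)

text \<open>Positivity is asked only strictly between x and y; continuity carries the constant to
  the endpoints. In the applications an endpoint is typically a zero of u, the edge of its
  support.\<close>

lemma half_sol_potential:
  assumes "half_sol \<rho> \<sigma> A B u v" "0 \<le> x" "x \<le> y" "\<And>z. x < z \<Longrightarrow> z < y \<Longrightarrow> 0 < u z"
  shows "u x + \<rho> * v x + A * x\<^sup>2 / 2 = u y + \<rho> * v y + A * y\<^sup>2 / 2"
proof (cases "x = y")
  case False
  then have xy: "x < y" using assms by simp
  define P where "P z = u z + \<rho> * v z + A * z\<^sup>2 / 2" for z
  define m where "m = (x + y) / 2"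
  have c: "continuous_on {x..y} P" unfolding P_def
    using assms(1,2) unfolding half_sol_def
    by (intro continuous_intros) (auto elim!: continuous_on_subset)
  have "P z = P m" if "z \<in> {x<..<y}" for z
  proof (cases "z \<le> m")
    case True
    have "\<forall>t\<in>{z..m}. 0 < u t" using assms(4) that xy by (auto simp: m_def)
    then show ?thesis using assms(1,2) True that unfolding half_sol_def P_def by (meson greaterThanLessThan_iff less_eq_real_def order_trans)
  next
    case F: False
    have "\<forall>t\<in>{m..z}. 0 < u t" using assms(4) that xy by (auto simp: m_def)
    moreover have "0 \<le> m" "m \<le> z" using F assms(2,3) by (auto simp: m_def)
    ultimately show ?thesis using assms(1) unfolding half_sol_def P_def by metis
  qed
  moreover have cl: "closure {x<..<y} = {x..y}" using xy by simp
  ultimately have "P z = P m" if "z \<in> {x..y}" for z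
    using continuous_constant_on_closure[of "{x<..<y}" P "P m" z] c that by auto
  then have "P x = P y" using xy by (metis atLeastAtMost_iff less_eq_real_def order_refl)
  then show ?thesis by (simp add: P_def)
qed simp

lemma first_zero:
  fixes f :: "real \<Rightarrow> real"
  assumes c: "continuous_on {0..} f" and nn: "\<And>z. 0 \<le> z \<Longrightarrow> 0 \<le> f z" and w: "f w = 0" "0 \<le> x" "x \<le> w"
  shows "\<exists>z. x \<le> z \<and> z \<le> w \<and> f z = 0 \<and> (\<forall>t. x \<le> t \<and> t < z \<longrightarrow> 0 < f t)"
proof -
  let ?S = "{t \<in> {x..w}. f t = 0}"
  have "closed ?S"
    by (rule continuous_closed_preimage_constant[OF continuous_on_subset[OF c]]) (use w in auto)
  moreover have "?S \<subseteq> {x..w}" by auto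
  ultimately have "compact ?S" by (metis Int_absorb1 closed_Int_compact compact_Icc inf.commute)
  moreover have "?S \<noteq> {}" using w by auto
  ultimately obtain z where z: "z \<in> ?S" "\<And>t. t \<in> ?S \<Longrightarrow> z \<le> t"
    using compact_attains_inf[of ?S] by blast
  have "0 < f t" if t: "x \<le> t" "t < z" for t
  proof -
    have "f t \<noteq> 0" using z(2)[of t] t z(1) by auto
    then show ?thesis using nn[of t] w t by simp
  qed
  then show ?thesis using z(1) by auto
qed

lemma last_zero:
  fixes f :: "real \<Rightarrow> real"
  assumes c: "continuous_on {0..} f" and nn: "\<And>z. 0 \<le> z \<Longrightarrow> 0 \<le> f z" and w: "f w = 0" "0 \<le> w" "w \<le> y"
  shows "\<exists>z. w \<le> z \<and> z \<le> y \<and> f z = 0 \<and> (\<forall>t. z < t \<and> t \<le> y \<longrightarrow> 0 < f t)"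
proof -
  let ?S = "{t \<in> {w..y}. f t = 0}"
  have "closed ?S"
    by (rule continuous_closed_preimage_constant[OF continuous_on_subset[OF c]]) (use w in auto)
  moreover have "?S \<subseteq> {w..y}" by auto
  ultimately have "compact ?S" by (metis Int_absorb1 closed_Int_compact compact_Icc inf.commute)
  moreover have "?S \<noteq> {}" using w by auto
  ultimately obtain z where z: "z \<in> ?S" "\<And>t. t \<in> ?S \<Longrightarrow> t \<le> z"
    using compact_attains_sup[of ?S] by blast
  have "0 < f t" if t: "z < t" "t \<le> y" for t
  proof -
    have "f t \<noteq> 0" using z(2)[of t] t z(1) by auto
    then show ?thesis using nn[of t] w z(1) t by simp
  qed
  then show ?thesis using z(1) by auto
qed

definition bump :: "real \<Rightarrow> real \<Rightarrow> real" where
  "bump r x = max (r\<^sup>2 - x\<^sup>2) 0 / 2"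

lemma bump_inside: "0 \<le> x \<Longrightarrow> x \<le> r \<Longrightarrow> bump r x = (r\<^sup>2 - x\<^sup>2) / 2"
  using power_mono[of x r 2] by (simp add: bump_def)

lemma bump_outside: "0 \<le> r \<Longrightarrow> r \<le> x \<Longrightarrow> bump r x = 0"
  using power_mono[of r x 2] by (simp add: bump_def)

text \<open>\<open>det\<close> makes the quadratic part of the energy positive definite; in the
  application \<rho> * \<sigma> = R / (1 + R).\<close>

locale cross =
  fixes \<rho> \<sigma> A B :: real
  assumes pos: "0 < \<rho>" "0 < \<sigma>" "0 < A" "0 < B" and det: "\<rho> * \<sigma> < 1"
begin

text \<open>Where both densities are positive, u' + \<rho> v' = - A x and \<sigma> u' + v' = - B x.
  The determinant of this system is \<open>th\<close>, and its solution is u' = - p x, v' = - q x;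
  so q < 0 means that v grows away from the centre.\<close>

definition "th = 1 - \<rho> * \<sigma>"
definition "p = (A - \<rho> * B) / th"
definition "q = (B - \<sigma> * A) / th"

lemma th_pos: "0 < th" using det by (simp add: th_def)

lemma A_eq: "A = p + \<rho> * q"
proof -
  have "th * (p + \<rho> * q) = (A - \<rho> * B) + \<rho> * (B - \<sigma> * A)"
    using th_pos by (simp add: p_def q_def distrib_left)
  also have "\<dots> = th * A" by (simp add: th_def algebra_simps)
  finally show ?thesis using th_pos by simp
qed

lemma B_eq: "B = \<sigma> * p + q"
proof -
  have "th * (\<sigma> * p + q) = \<sigma> * (A - \<rho> * B) + (B - \<sigma> * A)"
    using th_pos by (simp add: p_def q_def distrib_left)
  also have "\<dots> = th * B" by (simp add: th_def algebra_simps)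
  finally show ?thesis using th_pos by simp
qed

lemma p_nonneg_iff: "0 \<le> p \<longleftrightarrow> \<rho> * B \<le> A"
  using th_pos by (simp add: p_def zero_le_divide_iff)

lemma swap: "cross \<sigma> \<rho> B A"
  using pos det by unfold_locales (auto simp: mult.commute)

lemma swap_th: "cross.th \<sigma> \<rho> = th"
  unfolding th_def cross.th_def[OF swap] by (simp add: mult.commute)

lemma swap_p: "cross.p \<sigma> \<rho> B A = q" and swap_q: "cross.q \<sigma> \<rho> B A = p"
  unfolding p_def q_def cross.p_def[OF swap] cross.q_def[OF swap] swap_th by simp_all

text \<open>B = \<sigma> p + q is positive, so the two slopes cannot both be nonpositive: at most
  one component is driven away from the centre.\<close>

lemma p_pos_if_q_nonpos: "q \<le> 0 \<Longrightarrow> 0 < p"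
proof (rule ccontr)
  assume "q \<le> 0" "\<not> 0 < p"
  then have "\<sigma> * p + q \<le> 0" using pos by (simp add: add_nonpos_nonpos mult_nonneg_nonpos)
  then show False using B_eq pos by simp
qed

text \<open>On the half line \<open>u\<close> is supported in \<open>[0, b]\<close> and \<open>v\<close> in \<open>[a, c]\<close>, with \<open>a \<le> b \<le> c\<close>. The derivative of
  \<open>u\<close> is \<open>- A x\<close> where \<open>v\<close> vanishes and \<open>- p x\<close> where it does not; that of \<open>v\<close> is \<open>- q x\<close> inside and
  \<open>- B x\<close> outside the support of \<open>u\<close>. The equations \<open>A = p + \<rho> q\<close> and \<open>B = \<sigma> p + q\<close> turn this into sums
  of bumps.\<close>

definition "hu a b x = p * bump b x + \<rho> * q * bump a x"
definition "hv a b c x = B * bump c x - \<sigma> * p * bump b x - q * bump a x"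

text \<open>Suppose u has a zero before x, and let l be the last one. The potential of u is constant
  on [l, x] while its parabola grows, which forces v l > 0. Hence both potentials are constant on a
  short interval right of l, and solving the two equations there makes u nonpositive because p \<ge>
  0.\<close>

lemma support_u_down:
  assumes h: "half_sol \<rho> \<sigma> A B u v" and p: "0 \<le> p" and x: "0 < u x" "0 \<le> y" "y \<le> x"
  shows "0 < u y"
proof (rule ccontr)
  have uc: "continuous_on {0..} u" and vc: "continuous_on {0..} v"
    and nn: "\<And>x. 0 \<le> x \<Longrightarrow> 0 \<le> u x" "\<And>x. 0 \<le> x \<Longrightarrow> 0 \<le> v x"
    using h by (auto simp: half_sol_def)
  assume "\<not> 0 < u y"
  then have "u y = 0" using nn[of y] x by auto
  then obtain l where l: "l \<in> {y..x}" "u l = 0" "\<And>t. l < t \<Longrightarrow> t \<le> x \<Longrightarrow> 0 < u t"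
    using last_zero[OF uc nn(1), of y x] x by auto
  have lx: "l < x" using l x by (cases "l = x") auto
  have l0: "0 \<le> l" using l x by auto
  have P: "\<rho> * v l + A * l\<^sup>2 / 2 = u z + \<rho> * v z + A * z\<^sup>2 / 2" if "l \<le> z" "z \<le> x" for z
    using half_sol_potential[OF h l0 that(1)] l that by auto
  have sq: "l\<^sup>2 < z\<^sup>2" if "l < z" for z using l0 that by (simp add: power_strict_mono)
  have vl: "0 < v l"
  proof -
    have "A * l\<^sup>2 < A * x\<^sup>2" using pos sq[OF lx] by simp
    moreover have "0 \<le> \<rho> * v x" using nn pos l0 lx by simp
    ultimately have "0 < \<rho> * v l" using P[of x] lx x(1) by linarith
    then show ?thesis using pos by (simp add: zero_less_mult_iff)
  qed
  have "\<exists>d>0. \<forall>z\<in>{0..}. dist z l < d \<longrightarrow> dist (v z) (v l) < v l"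
    using vc l0 vl unfolding continuous_on_iff by (meson atLeast_iff)
  then obtain d where d: "d > 0" "\<And>z. 0 \<le> z \<Longrightarrow> \<bar>z - l\<bar> < d \<Longrightarrow> \<bar>v z - v l\<bar> < v l"
    by (auto simp: dist_real_def)
  define z where "z = min x (l + d / 2)"
  have z: "l < z" "z \<le> x" "z - l < d" using d lx by (auto simp: z_def min_def)
  have "0 < v t" if "t \<in> {l..z}" for t using d(2)[of t] that z l0 by (auto simp: abs_if split: if_splits)
  then have Q: "v l + B * l\<^sup>2 / 2 = \<sigma> * u z + v z + B * z\<^sup>2 / 2"
    using h l0 z l(2) unfolding half_sol_def by (metis add.left_neutral less_eq_real_def mult_zero_right)
  have 1: "\<rho> * (v l - v z) = u z + A * (z\<^sup>2 - l\<^sup>2) / 2" using P[of z] z by (simp add: algebra_simps diff_divide_distrib)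
  have 2: "v l - v z = \<sigma> * u z + B * (z\<^sup>2 - l\<^sup>2) / 2" using Q by (simp add: algebra_simps diff_divide_distrib)
  have "\<rho> * (\<sigma> * u z + B * (z\<^sup>2 - l\<^sup>2) / 2) = u z + A * (z\<^sup>2 - l\<^sup>2) / 2" using 1 2 by simp
  then have "th * u z = (\<rho> * B - A) * ((z\<^sup>2 - l\<^sup>2) / 2)" by (simp add: th_def field_simps)
  moreover have "(\<rho> * B - A) * ((z\<^sup>2 - l\<^sup>2) / 2) \<le> 0"
    using p sq[OF z(1)] by (intro mult_nonpos_nonneg) (auto simp: p_nonneg_iff)
  moreover have "0 < th * u z" using th_pos l(3)[OF z(1,2)] by simp
  ultimately show False by linarith
qed

lemma support_u:
  assumes h: "half_sol \<rho> \<sigma> A B u v" and p: "0 \<le> p" and u0: "0 < u 0"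
  obtains b where "0 < b" "u b = 0" "\<And>x. 0 \<le> x \<Longrightarrow> 0 < u x \<longleftrightarrow> x < b"
proof -
  have uc: "continuous_on {0..} u"
    and nn: "\<And>x. 0 \<le> x \<Longrightarrow> 0 \<le> u x" "\<And>x. 0 \<le> x \<Longrightarrow> 0 \<le> v x"
    using h by (auto simp: half_sol_def)
  define K where "K = u 0 + \<rho> * v 0"
  have K: "0 < K" using u0 nn(2)[of 0] pos unfolding K_def by (simp add: add_pos_nonneg)
  \<comment> \<open>At X the parabola alone exceeds the value K of the potential at 0, so u cannot
    still be positive there; the summand 1 makes the inequality strict.\<close>
  define X where "X = sqrt (2 * K / A) + 1"
  have X: "0 < X" "K < A * X\<^sup>2 / 2"
  proof -
    show "0 < X" using K pos by (simp add: X_def add_nonneg_pos)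
    have "2 * K / A = (sqrt (2 * K / A))\<^sup>2" using K pos by simp
    also have "\<dots> < X\<^sup>2" using K pos by (intro power_strict_mono) (auto simp: X_def)
    finally show "K < A * X\<^sup>2 / 2" using pos by (simp add: field_simps)
  qed
  have "\<not> 0 < u X"
  proof
    assume a: "0 < u X"
    have "u 0 + \<rho> * v 0 + A * 0\<^sup>2 / 2 = u X + \<rho> * v X + A * X\<^sup>2 / 2"
      using support_u_down[OF h p a] X by (intro half_sol_potential[OF h]) auto
    moreover have "0 \<le> \<rho> * v X" using nn X pos by simp
    ultimately show False using a X K_def by simp
  qed
  then have "u X = 0" using nn[of X] X by simp
  then obtain b where b: "b \<in> {0..X}" "u b = 0" "\<And>t. 0 \<le> t \<Longrightarrow> t < b \<Longrightarrow> 0 < u t"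
    using first_zero[OF uc nn(1), of X 0] X by auto
  show ?thesis
  proof (rule that[of b])
    show "0 < b" using b u0 by (cases "b = 0") auto
    show "u b = 0" by (rule b)
    fix x :: real assume "0 \<le> x"
    then show "0 < u x \<longleftrightarrow> x < b" using b support_u_down[OF h p, of x b] by (metis atLeastAtMost_iff less_irrefl not_le)
  qed
qed

text \<open>The variational inequality behind both uniqueness and the monotonicity of the energy.\<close>

lemma potential_u_ge:
  assumes h: "half_sol \<rho> \<sigma> A B u v" and p: "0 \<le> p" and u0: "0 < u 0" and x: "0 \<le> x"
  shows "u 0 + \<rho> * v 0 \<le> u x + \<rho> * v x + A * x\<^sup>2 / 2"
    "0 < u x \<Longrightarrow> u x + \<rho> * v x + A * x\<^sup>2 / 2 = u 0 + \<rho> * v 0"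
proof -
  have vc: "continuous_on {0..} v"
    and nn: "\<And>x. 0 \<le> x \<Longrightarrow> 0 \<le> u x" "\<And>x. 0 \<le> x \<Longrightarrow> 0 \<le> v x"
    using h by (auto simp: half_sol_def)
  obtain b where b: "0 < b" "u b = 0" "\<And>x. 0 \<le> x \<Longrightarrow> 0 < u x \<longleftrightarrow> x < b"
    using support_u[OF h p u0] by blast
  have eq: "u y + \<rho> * v y + A * y\<^sup>2 / 2 = u 0 + \<rho> * v 0" if "0 \<le> y" "y \<le> b" for y
    using half_sol_potential[OF h, of 0 y] that b by auto
  show "0 < u x \<Longrightarrow> u x + \<rho> * v x + A * x\<^sup>2 / 2 = u 0 + \<rho> * v 0"
    using eq[of x] b x by auto
  show "u 0 + \<rho> * v 0 \<le> u x + \<rho> * v x + A * x\<^sup>2 / 2"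
  proof (cases "x \<le> b")
    case False
    have uz: "u y = 0" if "b \<le> y" for y using b(3)[of y] nn(1)[of y] that b(1) by auto
    \<comment> \<open>Off the support of u, v loses B (y^2 - b^2) / 2 along an interval of
      positivity, so the potential of u changes by (A - \<rho> B) (y^2 - b^2) / 2, which is
      nonnegative since p \<ge> 0.\<close>
    have main: "\<rho> * v b + A * b\<^sup>2 / 2 \<le> \<rho> * v y + A * y\<^sup>2 / 2"
      if y: "b \<le> y" and vp: "\<And>t. b < t \<Longrightarrow> t < y \<Longrightarrow> 0 < v t" for y
    proof -
      have "v b + \<sigma> * u b + B * b\<^sup>2 / 2 = v y + \<sigma> * u y + B * y\<^sup>2 / 2"
        by (rule half_sol_potential[OF half_sol_swap[THEN iffD1, OF h]]) (use b y vp in auto)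
      then have "v y = v b - B * (y\<^sup>2 - b\<^sup>2) / 2"
        using uz y by (simp add: algebra_simps diff_divide_distrib)
      then have "\<rho> * v y + A * y\<^sup>2 / 2 = \<rho> * v b + A * b\<^sup>2 / 2 + (A - \<rho> * B) * ((y\<^sup>2 - b\<^sup>2) / 2)"
        by (simp only:) (simp add: field_simps)
      moreover have "0 \<le> (A - \<rho> * B) * ((y\<^sup>2 - b\<^sup>2) / 2)"
        using p b y by (intro mult_nonneg_nonneg) (auto simp: p_nonneg_iff)
      ultimately show ?thesis by linarith
    qed
    have Kb: "u 0 + \<rho> * v 0 = \<rho> * v b + A * b\<^sup>2 / 2" using eq[of b] b by auto
    \<comment> \<open>If v has a zero between b and x, the estimate runs up to the first one, z;
      from z on, the nonnegative densities are dropped and the growth of the parabola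
      suffices.\<close>
    show ?thesis
    proof (cases "\<exists>w\<in>{b..x}. v w = 0")
      case True
      then obtain w where "w \<in> {b..x}" "v w = 0" by blast
      then obtain z where z: "z \<in> {b..w}" "v z = 0" "\<And>t. b \<le> t \<Longrightarrow> t < z \<Longrightarrow> 0 < v t"
        using first_zero[OF vc nn(2), of w b] b(1) by auto
      have "\<rho> * v b + A * b\<^sup>2 / 2 \<le> A * z\<^sup>2 / 2" using main[of z] z by auto
      also have "\<dots> \<le> A * x\<^sup>2 / 2" using pos z b(1) \<open>w \<in> {b..x}\<close> by auto
      also have "\<dots> \<le> u x + \<rho> * v x + A * x\<^sup>2 / 2" using nn[OF x] pos by simp
      finally show ?thesis using Kb by simp
    next
      case F: False
      have "0 < v t" if "t \<in> {b..x}" for t using F nn(2)[of t] that b(1) by force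
      then show ?thesis using main[of x] False Kb nn(1)[OF x] by auto
    qed
  qed (use eq[of x] x in auto)
qed

text \<open>Where both densities are positive, v has slope - q x \<ge> 0, so it cannot return to 0:
  at a first zero z the two potential equations give th v x = th q (z^2 - x^2) / 2 \<le> 0.\<close>

lemma v_increasing_on_support_u:
  assumes h: "half_sol \<rho> \<sigma> A B u v" and q: "q \<le> 0"
    and b: "\<And>x. 0 \<le> x \<Longrightarrow> x < b \<Longrightarrow> 0 < u x"
    and xy: "0 \<le> x" "x \<le> y" "y \<le> b" and vx: "0 < v x"
  shows "0 < v y"
proof (rule ccontr)
  have vc: "continuous_on {0..} v"
    and nn: "\<And>x. 0 \<le> x \<Longrightarrow> 0 \<le> u x" "\<And>x. 0 \<le> x \<Longrightarrow> 0 \<le> v x"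
    using h by (auto simp: half_sol_def)
  assume "\<not> 0 < v y"
  then have "v y = 0" using nn xy by (metis order_trans less_eq_real_def)
  then obtain z where z: "z \<in> {x..y}" "v z = 0" "\<And>t. x \<le> t \<Longrightarrow> t < z \<Longrightarrow> 0 < v t"
    using first_zero[OF vc nn(2), of y x] xy by auto
  have 1: "u x + \<rho> * v x + A * x\<^sup>2 / 2 = u z + \<rho> * v z + A * z\<^sup>2 / 2"
    by (rule half_sol_potential[OF h]) (use xy z b in auto)
  have 2: "v x + \<sigma> * u x + B * x\<^sup>2 / 2 = v z + \<sigma> * u z + B * z\<^sup>2 / 2"
    by (rule half_sol_potential[OF half_sol_swap[THEN iffD1, OF h]]) (use xy z in auto)
  have "th * v x = th * v z + th * q * (z\<^sup>2 - x\<^sup>2) / 2"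
  proof -
    define X Z where "X = x\<^sup>2 / 2" and "Z = z\<^sup>2 / 2"
    have "th * q = B - \<sigma> * A" using th_pos by (simp add: q_def)
    moreover have "u x + \<rho> * v x + A * X = u z + \<rho> * v z + A * Z" using 1 by (simp add: X_def Z_def)
    moreover have "v x + \<sigma> * u x + B * X = v z + \<sigma> * u z + B * Z" using 2 by (simp add: X_def Z_def)
    ultimately have "th * v x = th * v z + th * q * (Z - X)" using th_def by algebra
    then show ?thesis by (simp add: X_def Z_def diff_divide_distrib)
  qed
  moreover have "th * q * (z\<^sup>2 - x\<^sup>2) / 2 \<le> 0"
    using th_pos q z xy by (simp add: divide_le_0_iff mult_nonneg_nonpos mult_nonpos_nonneg mult_le_0_iff power_mono)
  moreover have "0 < th * v x" using th_pos vx by simp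
  moreover have "th * v z = 0" using z(2) by simp
  ultimately show False by linarith
qed

text \<open>Inside the support [0, b] of u the zeros of v, if any, form an initial segment [0, a];
  to the right of b, v is one decreasing arch that ends at c. On each piece the constant potentials
  are a linear system for u and v. The alternative \<open>a = 0 \<or> v 0 = 0\<close> records
  whether v may be positive at the centre.\<close>

lemma half_sol_explicit:
  assumes h: "half_sol \<rho> \<sigma> A B u v" and q: "q < 0" and u0: "0 < u 0"
  obtains a b c where "0 \<le> a" "a \<le> b" "b \<le> c" "0 < b" "a = 0 \<or> v 0 = 0"
    "\<And>x. 0 \<le> x \<Longrightarrow> u x = hu a b x" "\<And>x. 0 \<le> x \<Longrightarrow> v x = hv a b c x"
proof -
  have p: "0 < p" using q p_pos_if_q_nonpos by simp
  have vc: "continuous_on {0..} v"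
    and nn: "\<And>x. 0 \<le> x \<Longrightarrow> 0 \<le> u x" "\<And>x. 0 \<le> x \<Longrightarrow> 0 \<le> v x"
    using h by (auto simp: half_sol_def)
  note h' = half_sol_swap[THEN iffD1, OF h]
  obtain b where b: "0 < b" "u b = 0" "\<And>x. 0 \<le> x \<Longrightarrow> 0 < u x \<longleftrightarrow> x < b"
    using support_u[OF h _ u0] p by (metis less_eq_real_def)
  have uz: "u y = 0" if "b \<le> y" for y using b(3)[of y] nn(1)[of y] that b(1) by auto
  note inc = v_increasing_on_support_u[OF h less_imp_le[OF q], of b]
  \<comment> \<open>When v 0 = 0, a is the last zero of v on [0, b]; v vanishes at every earlier
    point, since by \<open>inc\<close> a positive value would persist up to a.\<close>
  obtain a where a: "0 \<le> a" "a \<le> b" "a = 0 \<or> v 0 = 0" "\<And>x. a < x \<Longrightarrow> x \<le> b \<Longrightarrow> 0 < v x"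
     "\<And>x. 0 \<le> x \<Longrightarrow> x \<le> a \<Longrightarrow> 0 < a \<Longrightarrow> v x = 0"
  proof (cases "v 0 = 0")
    case True
    obtain a where a: "a \<in> {0..b}" "v a = 0" "\<And>t. a < t \<Longrightarrow> t \<le> b \<Longrightarrow> 0 < v t"
      using last_zero[OF vc nn(2), of 0 b] b(1) True by auto
    show ?thesis
    proof (rule that[of a])
      fix x assume "0 \<le> x" "x \<le> a"
      then show "v x = 0" using inc[of x a] a b(3) nn(2)[of x] by fastforce
    qed (use a True in auto)
  next
    case False
    then have "0 < v 0" using nn[of 0] by simp
    then show ?thesis using inc[of 0] b by (intro that[of 0]) auto
  qed
  have E1: "u x + \<rho> * v x + A * x\<^sup>2 / 2 = \<rho> * v b + A * b\<^sup>2 / 2" if "0 \<le> x" "x \<le> b" for x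
    using half_sol_potential[OF h, of x b] that b by auto
  have E2: "v x + \<sigma> * u x + B * x\<^sup>2 / 2 = v b + B * b\<^sup>2 / 2" if "a \<le> x" "x \<le> b" for x
    using half_sol_potential[OF h', of x b] that a b by auto
  have ab: "u x = p * (b\<^sup>2 - x\<^sup>2) / 2 \<and> v x = v b + q * (b\<^sup>2 - x\<^sup>2) / 2" if "a \<le> x" "x \<le> b" for x
  proof -
    have e1: "u x + \<rho> * v x = \<rho> * v b + A * ((b\<^sup>2 - x\<^sup>2) / 2)"
      using E1[of x] that a by (simp add: field_simps)
    have e2: "v x + \<sigma> * u x = v b + B * ((b\<^sup>2 - x\<^sup>2) / 2)"
      using E2[of x] that a by (simp add: field_simps)
    define d where "d = (b\<^sup>2 - x\<^sup>2) / 2"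
    have "th * u x = th * (p * d)" using e1 e2 A_eq B_eq th_def unfolding d_def[symmetric] by algebra
    moreover have "th * v x = th * (v b + q * d)" using e1 e2 A_eq B_eq th_def unfolding d_def[symmetric] by algebra
    ultimately show ?thesis using th_pos by (auto simp: d_def)
  qed
  obtain c where c: "b \<le> c" "v b = B * (c\<^sup>2 - b\<^sup>2) / 2" "\<And>x. c \<le> x \<Longrightarrow> v x = 0"
     "\<And>x. b \<le> x \<Longrightarrow> x \<le> c \<Longrightarrow> v x = B * (c\<^sup>2 - x\<^sup>2) / 2"
  proof -
    \<comment> \<open>Beyond b no new arch can start: at a last zero l before x the potential of v
      would be B l^2 / 2, which lies below its value at x.\<close>
    have down: "0 < v y" if vxy: "0 < v x" "b \<le> y" "y \<le> x" for x y
    proof (rule ccontr)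
      assume "\<not> 0 < v y"
      then have "v y = 0" using nn(2)[of y] that b by auto
      then obtain l where l: "l \<in> {y..x}" "v l = 0" "\<And>t. l < t \<Longrightarrow> t \<le> x \<Longrightarrow> 0 < v t"
        using last_zero[OF vc nn(2), of y x] vxy b(1) by auto
      have "v l + \<sigma> * u l + B * l\<^sup>2 / 2 = v x + \<sigma> * u x + B * x\<^sup>2 / 2"
        by (rule half_sol_potential[OF h']) (use l that b in auto)
      moreover have "B * l\<^sup>2 \<le> B * x\<^sup>2" using l that b pos by (auto intro!: power_mono)
      ultimately show False using uz[of l] uz[of x] l that by auto
    qed
    have up: "v b = v x + B * (x\<^sup>2 - b\<^sup>2) / 2" if "b \<le> x" "\<And>t. b < t \<Longrightarrow> t < x \<Longrightarrow> 0 < v t" for x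
      using half_sol_potential[OF h', of b x] that b uz[of x] by (auto simp: algebra_simps diff_divide_distrib)
    define X where "X = sqrt (b\<^sup>2 + 2 * v b / B) + 1"
    have X: "b \<le> X" "b\<^sup>2 + 2 * v b / B < X\<^sup>2"
    proof -
      have s: "0 \<le> b\<^sup>2 + 2 * v b / B" using nn[of b] b pos by simp
      have "b \<le> sqrt (b\<^sup>2 + 2 * v b / B)" using nn[of b] b pos by (intro real_le_rsqrt) simp
      then show "b \<le> X" by (simp add: X_def)
      have "b\<^sup>2 + 2 * v b / B = (sqrt (b\<^sup>2 + 2 * v b / B))\<^sup>2" using s by simp
      also have "\<dots> < X\<^sup>2" using s by (intro power_strict_mono) (auto simp: X_def)
      finally show "b\<^sup>2 + 2 * v b / B < X\<^sup>2" .
    qed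
    have "v X = 0"
    proof (rule ccontr)
      assume "v X \<noteq> 0"
      then have vX: "0 < v X" using nn(2)[of X] X b by auto
      have "v b = v X + B * (X\<^sup>2 - b\<^sup>2) / 2" using down[OF vX] X by (intro up) auto
      then show False using vX X(2) pos by (simp add: field_simps)
    qed
    then obtain c where c: "c \<in> {b..X}" "v c = 0" "\<And>t. b \<le> t \<Longrightarrow> t < c \<Longrightarrow> 0 < v t"
      using first_zero[OF vc nn(2), of X b] b(1) X by auto
    show ?thesis
    proof (rule that[of c])
      show "v b = B * (c\<^sup>2 - b\<^sup>2) / 2" using up[of c] c by auto
      then show "v x = B * (c\<^sup>2 - x\<^sup>2) / 2" if "b \<le> x" "x \<le> c" for x
        using up[of x] that c by (auto simp: field_simps)
      show "v x = 0" if "c \<le> x" for x using down[of x c] c that nn(2)[of x] b by fastforce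
    qed (use c in auto)
  qed
  \<comment> \<open>Continuity of v at a: the formula valid on [a, b] must give 0 there.\<close>
  have Bc: "B * c\<^sup>2 = \<sigma> * p * b\<^sup>2 + q * a\<^sup>2" if "0 < a"
  proof -
    have "v b + q * (b\<^sup>2 - a\<^sup>2) / 2 = 0" using ab[of a] a that by auto
    then have "B * (c\<^sup>2 - b\<^sup>2) + q * (b\<^sup>2 - a\<^sup>2) = 0" using c(2) by simp
    then show ?thesis using B_eq by algebra
  qed
  show ?thesis
  proof (rule that[of a b c])
    fix x :: real assume x: "0 \<le> x"
    consider "x < a" | "a \<le> x" "x \<le> b" | "b \<le> x" "x \<le> c" | "c \<le> x" by linarith
    then show "u x = hu a b x"
    proof cases
      case 1
      then have v0: "v x = 0" using a x by auto
      have "2 * v b = B * (c\<^sup>2 - b\<^sup>2)" using c(2) by simp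
      moreover have "2 * u x + A * x\<^sup>2 = 2 * (\<rho> * v b) + A * b\<^sup>2"
        using E1[of x] x 1 a v0 by simp
      moreover have "2 * hu a b x = p * (b\<^sup>2 - x\<^sup>2) + \<rho> * q * (a\<^sup>2 - x\<^sup>2)"
      proof -
        have e: "bump a x = (a\<^sup>2 - x\<^sup>2) / 2" "bump b x = (b\<^sup>2 - x\<^sup>2) / 2"
          using 1 a x by (simp_all add: bump_inside)
        show ?thesis unfolding hu_def e by (simp add: field_simps)
      qed
      moreover have "B * c\<^sup>2 = \<sigma> * p * b\<^sup>2 + q * a\<^sup>2" using 1 x by (intro Bc) simp
      ultimately have "2 * u x = 2 * hu a b x" using A_eq B_eq by algebra
      then show ?thesis by simp
    next
      case 2
      then show ?thesis using ab[of x] x a(1) by (simp add: hu_def bump_inside bump_outside)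
    qed (use uz[of x] x a b c bump_outside[of a x] bump_outside[of b x] in \<open>simp_all add: hu_def\<close>)
    consider "x < a" | "a \<le> x" "x \<le> b" | "b \<le> x" "x \<le> c" | "c \<le> x" by linarith
    then show "v x = hv a b c x"
    proof cases
      case 1
      then have v0: "v x = 0" using a x by auto
      moreover have "2 * hv a b c x = B * (c\<^sup>2 - x\<^sup>2) - \<sigma> * p * (b\<^sup>2 - x\<^sup>2) - q * (a\<^sup>2 - x\<^sup>2)"
      proof -
        have e: "bump a x = (a\<^sup>2 - x\<^sup>2) / 2" "bump b x = (b\<^sup>2 - x\<^sup>2) / 2" "bump c x = (c\<^sup>2 - x\<^sup>2) / 2"
          using 1 a x c(1) by (simp_all add: bump_inside)
        show ?thesis unfolding hv_def e by (simp add: field_simps)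
      qed
      moreover have "B * c\<^sup>2 = \<sigma> * p * b\<^sup>2 + q * a\<^sup>2" using 1 x by (intro Bc) simp
      ultimately have "2 * v x = 2 * hv a b c x" using B_eq by algebra
      then show ?thesis by simp
    next
      case 2
      then have "2 * hv a b c x = B * (c\<^sup>2 - x\<^sup>2) - \<sigma> * p * (b\<^sup>2 - x\<^sup>2)"
      proof -
        have e: "bump a x = 0" "bump b x = (b\<^sup>2 - x\<^sup>2) / 2" "bump c x = (c\<^sup>2 - x\<^sup>2) / 2"
          using 2 a x c(1) by (simp_all add: bump_inside bump_outside)
        show ?thesis unfolding hv_def e by (simp add: field_simps)
      qed
      moreover have "2 * v x = 2 * v b + q * (b\<^sup>2 - x\<^sup>2)" using ab[of x] 2 by simp
      moreover have "2 * v b = B * (c\<^sup>2 - b\<^sup>2)" using c(2) by simp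
      ultimately have "2 * v x = 2 * hv a b c x" using B_eq by algebra
      then show ?thesis by simp
    next
      case 3
      then show ?thesis using c(4)[of x] x a(1,2) b(1) by (simp add: hv_def bump_inside bump_outside)
    next
      case 4
      then show ?thesis using c(3)[of x] x a b c(1) bump_outside[of a x] bump_outside[of b x] bump_outside[of c x]
        by (simp add: hv_def)
    qed
  qed (use a b c in auto)
qed

end

section \<open>Explicit profiles and the energy\<close>

lemma integrable_bounded_support:
  fixes w :: "real \<Rightarrow> real"
  assumes "w \<in> borel_measurable borel" "\<And>x. \<bar>w x\<bar> \<le> C" "\<And>x. k < \<bar>x\<bar> \<Longrightarrow> w x = 0"
  shows "integrable lebesgue w"
proof (rule Bochner_Integration.integrable_bound)
  have "emeasure lebesgue {-k..k} < \<infinity>" by (simp add: emeasure_lborel_Icc_eq)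
  then show "integrable lebesgue (\<lambda>x. C * indicator {-k..k} x)"
    by (intro integrable_mult_right integrable_real_indicator) auto
  show "w \<in> borel_measurable lebesgue" using assms(1) by (simp add: measurable_completion)
  show "AE x in lebesgue. norm (w x) \<le> norm (C * indicator {-k..k} x)"
  proof (rule AE_I2)
    fix x
    have "\<bar>w x\<bar> \<le> \<bar>C\<bar>" using assms(2)[of x] by linarith
    then show "norm (w x) \<le> norm (C * indicator {-k..k} x)"
      using assms(3)[of x] by (cases "k < \<bar>x\<bar>") (auto simp: indicator_def abs_le_iff)
  qed
qed

lemma continuous_compact_support_bounded:
  fixes w :: "real \<Rightarrow> real"
  assumes "continuous_on UNIV w" "\<And>x. k < \<bar>x\<bar> \<Longrightarrow> w x = 0"
  obtains C where "\<And>x. \<bar>w x\<bar> \<le> C"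
proof -
  have "compact (w ` {-k..k})"
    by (rule compact_continuous_image) (auto intro: continuous_on_subset[OF assms(1)])
  then obtain C where C: "\<And>x. x \<in> {-k..k} \<Longrightarrow> \<bar>w x\<bar> \<le> C"
    by (metis compact_imp_bounded bounded_iff imageI real_norm_def)
  have "\<bar>w x\<bar> \<le> max C 0" for x
  proof (cases "k < \<bar>x\<bar>")
    case False
    then have "\<bar>w x\<bar> \<le> C" by (intro C) auto
    then show ?thesis by simp
  qed (use assms(2) in simp)
  then show ?thesis by (rule that)
qed

lemma integrable_continuous_compact_support:
  fixes w :: "real \<Rightarrow> real"
  assumes "continuous_on UNIV w" "\<And>x. k < \<bar>x\<bar> \<Longrightarrow> w x = 0"
  shows "integrable lebesgue w"
proof -
  obtain C where "\<And>x. \<bar>w x\<bar> \<le> C" using continuous_compact_support_bounded[OF assms] by blast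
  then show ?thesis
    using assms by (intro integrable_bounded_support[where k=k]) (auto intro: borel_measurable_continuous_onI)
qed

lemma integrable_imp_locally_integrable:
  "integrable lebesgue w \<Longrightarrow> locally_integrable w"
  unfolding locally_integrable_def set_integrable_def by (intro allI integrable_mult_indicator) auto

section \<open>Continuous representatives of weak solutions\<close>

lemma admissible_integrable:
  assumes "admissible m u"
  shows "integrable lebesgue u"
proof (rule Bochner_Integration.integrable_bound)
  show "integrable lebesgue (\<lambda>x. (1 + x\<^sup>2) * u x)" using assms by (simp add: admissible_def)
  show "u \<in> borel_measurable lebesgue" using assms by (simp add: admissible_def)
  show "AE x in lebesgue. norm (u x) \<le> norm ((1 + x\<^sup>2) * u x)"
  proof (rule AE_I2)
    fix x :: real
    have "1 * \<bar>u x\<bar> \<le> (1 + x\<^sup>2) * \<bar>u x\<bar>" by (rule mult_right_mono) auto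
    then show "norm (u x) \<le> norm ((1 + x\<^sup>2) * u x)" by (simp add: abs_mult)
  qed
qed

lemma H1_continuous_representative:
  assumes "u \<in> H1"
  obtains u' where "continuous_on UNIV u'" "AE x in lebesgue. u x = u' x"
proof -
  obtain v where "has_weak_derivative u v" using assms by (auto simp: H1_def)
  then obtain c where c: "AE x in lebesgue. u x = c + prim v x"
    by (metis weak_derivative_imp_prim)
  have "locally_integrable v" using \<open>has_weak_derivative u v\<close> by (simp add: has_weak_derivative_def)
  then show ?thesis
    using c by (intro that[of "\<lambda>x. c + prim v x"]) (auto intro!: continuous_intros continuous_on_prim)
qed

text \<open>Where the density is positive, u D = 0 leaves D = 0 almost everywhere, and the increment
  of the potential is the integral of D.\<close>

lemma potential_constant:
  assumes P: "has_weak_derivative P D" and uD: "AE x in lebesgue. u x * D x = 0"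
    and u': "AE x in lebesgue. u x = u' x" and P': "AE x in lebesgue. P x = P' x" "continuous_on UNIV P'"
    and xy: "x \<le> y" and pos: "\<And>z. z \<in> {x..y} \<Longrightarrow> (0::real) < u' z"
  shows "P' x = P' y"
proof -
  have D: "locally_integrable D" using P by (simp add: has_weak_derivative_def)
  obtain c where c: "AE x in lebesgue. P x = c + prim D x" using weak_derivative_imp_prim[OF P] by blast
  have "AE x in lebesgue. P' x = c + prim D x" using c P'(1) by eventually_elim simp
  then have eq: "P' = (\<lambda>x. c + prim D x)"
    by (rule AE_eq_continuous_imp_eq) (use P'(2) D in \<open>auto intro!: continuous_intros continuous_on_prim\<close>)
  have "P' y - P' x = (LINT z:{x..y}|lebesgue. D z)"
    using prim_diff[OF D xy] locally_integrable_on(2)[OF D] eq by simp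
  also have "\<dots> = 0"
    unfolding set_lebesgue_integral_def
  proof (rule integral_eq_zero_AE)
    show "AE z in lebesgue. indicator {x..y} z *\<^sub>R D z = 0"
      using uD u'
    proof eventually_elim
      case (elim z)
      then show ?case using pos[of z] by (cases "z \<in> {x..y}") auto
    qed
  qed
  finally show ?thesis by simp
qed

lemma AE_nonneg_continuous:
  fixes f :: "real \<Rightarrow> real"
  assumes "AE x in lebesgue. 0 \<le> f x" "continuous_on UNIV f"
  shows "0 \<le> f x"
proof -
  have "f = (\<lambda>x. \<bar>f x\<bar>)"
    by (rule AE_eq_continuous_imp_eq) (use assms in \<open>auto intro!: continuous_intros\<close>)
  then show ?thesis by (metis abs_ge_zero)
qed

text \<open>x enters the potentials explicitly only through its square, so the reflected pair solves
  the same half-line problem and the negative half line is covered by the same analysis.\<close>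

lemma weak_sol_continuous:
  assumes w: "weak_sol \<rho> \<sigma> A B M N u v"
  obtains u' v' where "AE x in lebesgue. u x = u' x" "AE x in lebesgue. v x = v' x"
    "continuous_on UNIV u'" "continuous_on UNIV v'" "\<And>x. 0 \<le> u' x" "\<And>x. 0 \<le> v' x"
    "half_sol \<rho> \<sigma> A B u' v'" "half_sol \<rho> \<sigma> A B (\<lambda>x. u' (- x)) (\<lambda>x. v' (- x))"
    "integrable lebesgue u'" "integrable lebesgue v'"
    "(LINT x|lebesgue. u' x) = M" "(LINT x|lebesgue. v' x) = N"
proof -
  have ad: "admissible M u" "admissible N v" using w by (auto simp: weak_sol_def)
  obtain u' where u': "continuous_on UNIV u'" "AE x in lebesgue. u x = u' x"
    using ad(1) H1_continuous_representative unfolding admissible_def by metis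
  obtain v' where v': "continuous_on UNIV v'" "AE x in lebesgue. v x = v' x"
    using ad(2) H1_continuous_representative unfolding admissible_def by metis
  have nu: "0 \<le> u' x" for x
  proof (rule AE_nonneg_continuous[of u'])
    have "AE x in lebesgue. 0 \<le> u x" using ad(1) by (simp add: admissible_def)
    with u'(2) show "AE x in lebesgue. 0 \<le> u' x" by eventually_elim simp
  qed (rule u')
  have nv: "0 \<le> v' x" for x
  proof (rule AE_nonneg_continuous[of v'])
    have "AE x in lebesgue. 0 \<le> v x" using ad(2) by (simp add: admissible_def)
    with v'(2) show "AE x in lebesgue. 0 \<le> v' x" by eventually_elim simp
  qed (rule v')
  obtain D1 D2 where D: "has_weak_derivative (\<lambda>x. u x + \<rho> * v x + A * x\<^sup>2 / 2) D1"
      "has_weak_derivative (\<lambda>x. \<sigma> * u x + v x + B * x\<^sup>2 / 2) D2"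
      "AE x in lebesgue. u x * D1 x = 0" "AE x in lebesgue. v x * D2 x = 0"
    using w by (auto simp: weak_sol_def)
  have 1: "u' x + \<rho> * v' x + A * x\<^sup>2 / 2 = u' y + \<rho> * v' y + A * y\<^sup>2 / 2"
    if "x \<le> y" "\<And>z. z \<in> {x..y} \<Longrightarrow> 0 < u' z" for x y
  proof (rule potential_constant[OF D(1) D(3) u'(2), of "\<lambda>x. u' x + \<rho> * v' x + A * x\<^sup>2 / 2"])
    show "AE x in lebesgue. u x + \<rho> * v x + A * x\<^sup>2 / 2 = u' x + \<rho> * v' x + A * x\<^sup>2 / 2"
      using u'(2) v'(2) by eventually_elim simp
  qed (use that in \<open>auto intro!: continuous_intros u' v'\<close>)
  have 2: "\<sigma> * u' x + v' x + B * x\<^sup>2 / 2 = \<sigma> * u' y + v' y + B * y\<^sup>2 / 2"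
    if "x \<le> y" "\<And>z. z \<in> {x..y} \<Longrightarrow> 0 < v' z" for x y
  proof (rule potential_constant[OF D(2) D(4) v'(2), of "\<lambda>x. \<sigma> * u' x + v' x + B * x\<^sup>2 / 2"])
    show "AE x in lebesgue. \<sigma> * u x + v x + B * x\<^sup>2 / 2 = \<sigma> * u' x + v' x + B * x\<^sup>2 / 2"
      using u'(2) v'(2) by eventually_elim simp
  qed (use that in \<open>auto intro!: continuous_intros u' v'\<close>)
  have iu: "integrable lebesgue u" "integrable lebesgue v"
    using ad admissible_integrable by blast+
  have um: "u' \<in> borel_measurable lebesgue" "v' \<in> borel_measurable lebesgue"
    using u'(1) v'(1) by (auto intro!: measurable_completion borel_measurable_continuous_onI)
  have iu': "integrable lebesgue u'"
    using iu(1) integrable_cong_AE[OF borel_measurable_integrable[OF iu(1)] um(1) u'(2)] by simp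
  have iv': "integrable lebesgue v'"
    using iu(2) integrable_cong_AE[OF borel_measurable_integrable[OF iu(2)] um(2) v'(2)] by simp
  have M: "(LINT x|lebesgue. u' x) = M"
    using integral_cong_AE[OF borel_measurable_integrable[OF iu(1)] um(1) u'(2)] ad(1) by (simp add: admissible_def)
  have N: "(LINT x|lebesgue. v' x) = N"
    using integral_cong_AE[OF borel_measurable_integrable[OF iu(2)] um(2) v'(2)] ad(2) by (simp add: admissible_def)
  show ?thesis
  proof (rule that[OF u'(2) v'(2) u'(1) v'(1) nu nv _ _ iu' iv' M N])
    show "half_sol \<rho> \<sigma> A B u' v'"
      unfolding half_sol_def using nu nv 1 2 u'(1) v'(1) by (auto intro: continuous_on_subset)
    have "u' (-x) + \<rho> * v' (-x) + A * x\<^sup>2 / 2 = u' (-y) + \<rho> * v' (-y) + A * y\<^sup>2 / 2"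
      if "x \<le> y" "\<forall>z\<in>{x..y}. 0 < u' (-z)" for x y
    proof -
      have "0 < u' z" if "z \<in> {-y..-x}" for z
        using \<open>\<forall>z\<in>{x..y}. 0 < u' (-z)\<close>[rule_format, of "-z"] that by auto
      then show ?thesis using 1[of "-y" "-x"] that(1) by simp
    qed
    moreover have "\<sigma> * u' (-x) + v' (-x) + B * x\<^sup>2 / 2 = \<sigma> * u' (-y) + v' (-y) + B * y\<^sup>2 / 2"
      if "x \<le> y" "\<forall>z\<in>{x..y}. 0 < v' (-z)" for x y
    proof -
      have "0 < v' z" if "z \<in> {-y..-x}" for z
        using \<open>\<forall>z\<in>{x..y}. 0 < v' (-z)\<close>[rule_format, of "-z"] that by auto
      then show ?thesis using 2[of "-y" "-x"] that(1) by simp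
    qed
    moreover have "continuous_on {0..} (\<lambda>x. u' (-x))" "continuous_on {0..} (\<lambda>x. v' (-x))"
      by (rule continuous_on_compose2[OF u'(1)] continuous_on_compose2[OF v'(1)], auto intro!: continuous_intros)+
    ultimately show "half_sol \<rho> \<sigma> A B (\<lambda>x. u' (- x)) (\<lambda>x. v' (- x))"
      unfolding half_sol_def using nu nv by blast
  qed
qed

text \<open>\<open>g\<close> is evaluated at x itself, without reflection; this suits the half-line
  profiles, which are even functions on the whole line.\<close>

definition glue :: "(real \<Rightarrow> real) \<Rightarrow> (real \<Rightarrow> real) \<Rightarrow> real \<Rightarrow> real" where
  "glue f g x = (if 0 \<le> x then f x else g x)"

lemma bump_even: "bump r (- x) = bump r x"
  by (simp add: bump_def)

lemma bump_eq_0: "0 \<le> r \<Longrightarrow> r \<le> \<bar>x\<bar> \<Longrightarrow> bump r x = 0"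
  using bump_outside[of r "\<bar>x\<bar>"] by (cases "0 \<le> x") (auto simp: bump_even[of r x, symmetric] abs_if)

lemma continuous_on_bump: "continuous_on S (bump r)"
  unfolding bump_def by (intro continuous_intros) auto

lemma DERIV_bump:
  assumes "0 \<le> r" "\<bar>x\<bar> \<noteq> r"
  shows "(bump r has_real_derivative (if \<bar>x\<bar> < r then - x else 0)) (at x)"
proof (cases "\<bar>x\<bar> < r")
  case True
  have "((\<lambda>y. (r\<^sup>2 - y\<^sup>2) / 2) has_real_derivative - x) (at x)"
    by (auto intro!: derivative_eq_intros)
  then have "(bump r has_real_derivative - x) (at x)"
  proof (rule DERIV_cong_ev[THEN iffD1, rotated -1])
    have "eventually (\<lambda>y. y \<in> {y. \<bar>y\<bar> < r}) (nhds x)"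
      by (rule eventually_nhds_in_open) (use True in \<open>auto intro!: open_Collect_less continuous_intros\<close>)
    then show "eventually (\<lambda>y. (r\<^sup>2 - y\<^sup>2) / 2 = bump r y) (nhds x)"
    proof eventually_elim
      case (elim y)
      then have "y\<^sup>2 \<le> r\<^sup>2" using power_mono[of "\<bar>y\<bar>" r 2] by simp
      then show ?case by (simp add: bump_def)
    qed
  qed auto
  then show ?thesis using True by simp
next
  case False
  then have gt: "r < \<bar>x\<bar>" using assms by simp
  have "((\<lambda>y. 0) has_real_derivative 0) (at x)" by simp
  then have "(bump r has_real_derivative 0) (at x)"
  proof (rule DERIV_cong_ev[THEN iffD1, rotated -1])
    have "eventually (\<lambda>y. y \<in> {y. r < \<bar>y\<bar>}) (nhds x)"
      by (rule eventually_nhds_in_open) (use gt in \<open>auto intro!: open_Collect_less continuous_intros\<close>)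
    then show "eventually (\<lambda>y. 0 = bump r y) (nhds x)"
      by eventually_elim (use assms bump_eq_0 in auto)
  qed auto
  then show ?thesis using False by simp
qed

lemma has_integral_bump_right:
  assumes r: "0 \<le> r"
  shows "integrable lebesgue (\<lambda>x. indicator {0..} x * bump r x)"
    "(LINT x|lebesgue. indicator {0..} x * bump r x) = r ^ 3 / 3"
proof -
  have "\<bar>indicator {0..} x * bump r x\<bar> \<le> r\<^sup>2 / 2" for x :: real by (auto simp: bump_def indicator_def)
  moreover have m: "(\<lambda>x. indicator {0..} x * bump r x) \<in> borel_measurable borel"
    using borel_measurable_continuous_onI[OF continuous_on_bump] by simp
  ultimately show "integrable lebesgue (\<lambda>x. indicator {0..} x * bump r x)"
    using r bump_eq_0 by (intro integrable_bounded_support[where k=r and C="r\<^sup>2 / 2"]) auto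
  have "(LINT x|lebesgue. indicator {0..} x * bump r x) = (LINT x|lborel. indicator {0..} x * bump r x)"
    by (rule integral_completion) (use m in simp)
  also have "\<dots> = (LINT x|lborel. ((r\<^sup>2 - x\<^sup>2) / 2) * indicator {0..r} x)"
  proof (rule Bochner_Integration.integral_cong[OF refl])
    fix x show "indicator {0..} x * bump r x = ((r\<^sup>2 - x\<^sup>2) / 2) * indicator {0..r} x"
      using bump_inside[of x r] bump_outside[of r x] r by (auto simp: indicator_def)
  qed
  also have "\<dots> = (r\<^sup>2 * r / 2 - r ^ 3 / 6) - (r\<^sup>2 * 0 / 2 - 0 ^ 3 / 6)"
    by (rule integral_FTC_Icc_real[where F="\<lambda>x. r\<^sup>2 * x / 2 - x ^ 3 / 6", OF r])
      (auto intro!: derivative_eq_intros continuous_intros simp: power2_eq_square field_simps)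
  finally show "(LINT x|lebesgue. indicator {0..} x * bump r x) = r ^ 3 / 3"
    by (simp add: power2_eq_square power3_eq_cube)
qed

lemma has_integral_bump_left:
  assumes r: "0 \<le> r"
  shows "integrable lebesgue (\<lambda>x. indicator {..<0} x * bump r x)"
    "(LINT x|lebesgue. indicator {..<0} x * bump r x) = r ^ 3 / 3"
proof -
  have "\<bar>indicator {..<0} x * bump r x\<bar> \<le> r\<^sup>2 / 2" for x :: real by (auto simp: bump_def indicator_def)
  moreover have m: "(\<lambda>x. indicator {..<0} x * bump r x) \<in> borel_measurable borel"
    using borel_measurable_continuous_onI[OF continuous_on_bump] by simp
  ultimately show "integrable lebesgue (\<lambda>x. indicator {..<0} x * bump r x)"
    using r bump_eq_0 by (intro integrable_bounded_support[where k=r and C="r\<^sup>2 / 2"]) auto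
  have "(LINT x|lebesgue. indicator {..<0} x * bump r x) = (LINT x|lborel. indicator {..<0} x * bump r x)"
    by (rule integral_completion) (use m in simp)
  also have "\<dots> = (LINT x|lborel. ((r\<^sup>2 - x\<^sup>2) / 2) * indicator {-r..0} x)"
  proof (rule integral_cong_AE)
    show "AE x in lborel. indicator {..<0} x * bump r x = ((r\<^sup>2 - x\<^sup>2) / 2) * indicator {-r..0} x"
      using AE_lborel_singleton[of 0]
    proof eventually_elim
      case (elim x)
      then show ?case
        using bump_inside[of "-x" r] bump_outside[of r "-x"] r by (auto simp: indicator_def bump_even)
    qed
  qed (use m in auto)
  also have "\<dots> = (r\<^sup>2 * 0 / 2 - 0 ^ 3 / 6) - (r\<^sup>2 * (- r) / 2 - (- r) ^ 3 / 6)"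
    by (rule integral_FTC_Icc_real[where F="\<lambda>x. r\<^sup>2 * x / 2 - x ^ 3 / 6"])
      (use r in \<open>auto intro!: derivative_eq_intros continuous_intros simp: power2_eq_square field_simps\<close>)
  finally show "(LINT x|lebesgue. indicator {..<0} x * bump r x) = r ^ 3 / 3"
    by (simp add: power2_eq_square power3_eq_cube)
qed

lemma continuous_on_glue:
  assumes "continuous_on UNIV f" "continuous_on UNIV g" "f 0 = g 0"
  shows "continuous_on UNIV (glue f g)"
proof -
  have "continuous_on ({0..} \<union> {..0}) (\<lambda>x. if 0 \<le> x then f x else g x)"
    by (rule continuous_on_cases) (use assms in \<open>auto intro: continuous_on_subset\<close>)
  moreover have "{0..} \<union> {..0} = (UNIV :: real set)" by auto
  ultimately show ?thesis by (simp add: glue_def[abs_def])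
qed

lemma DERIV_glue:
  assumes "0 < x \<Longrightarrow> (f has_real_derivative d) (at x)" "x < 0 \<Longrightarrow> (g has_real_derivative d) (at x)" "x \<noteq> 0"
  shows "(glue f g has_real_derivative d) (at x)"
proof (cases "0 < x")
  case True
  then have "(f has_real_derivative d) (at x)" using assms by simp
  then show ?thesis
  proof (rule DERIV_cong_ev[THEN iffD1, rotated -1])
    have "eventually (\<lambda>y. y \<in> {0<..}) (nhds x)"
      by (rule eventually_nhds_in_open) (use True in auto)
    then show "eventually (\<lambda>y. f y = glue f g y) (nhds x)"
      by eventually_elim (auto simp: glue_def)
  qed auto
next
  case False
  then have n: "x < 0" using assms by simp
  then have "(g has_real_derivative d) (at x)" using assms by simp
  then show ?thesis
  proof (rule DERIV_cong_ev[THEN iffD1, rotated -1])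
    have "eventually (\<lambda>y. y \<in> {..<0}) (nhds x)"
      by (rule eventually_nhds_in_open) (use n in auto)
    then show "eventually (\<lambda>y. g y = glue f g y) (nhds x)"
      by eventually_elim (auto simp: glue_def)
  qed auto
qed

lemma glue_eq_indicator:
  "glue f g x = indicator {0..} x * f x + indicator {..<0} x * g x"
  by (auto simp: glue_def indicator_def)

section \<open>Half-line profiles: stationarity, masses and classification\<close>

context cross
begin

text \<open>The inequality is v \<ge> 0 at the centre, and the equality for a > 0 is the continuity
  of v at a. With a = 0 the slope q may have any sign, so the nested profiles of the middle regime
  are included.\<close>

definition "half_profile a b c \<longleftrightarrow> 0 \<le> a \<and> a \<le> b \<and> b \<le> c \<and> 0 < p \<and> \<sigma> * p * b\<^sup>2 + q * a\<^sup>2 \<le> B * c\<^sup>2 \<and>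
  (a = 0 \<or> (q \<le> 0 \<and> B * c\<^sup>2 = \<sigma> * p * b\<^sup>2 + q * a\<^sup>2))"

lemma hu_even: "hu a b (- x) = hu a b x" and hv_even: "hv a b c (- x) = hv a b c x"
  by (simp_all add: hu_def hv_def bump_even)

lemma profile_at_0:
  assumes "0 \<le> a" "0 \<le> b" "0 \<le> c"
  shows "hu a b 0 = (p * b\<^sup>2 + \<rho> * q * a\<^sup>2) / 2" "hv a b c 0 = (B * c\<^sup>2 - \<sigma> * p * b\<^sup>2 - q * a\<^sup>2) / 2"
  by (simp_all add: hu_def hv_def bump_def field_simps)

lemma half_profile_values:
  assumes g: "half_profile a b c" and x: "0 \<le> x"
  shows "x \<le> a \<Longrightarrow> hu a b x = (p * b\<^sup>2 + \<rho> * q * a\<^sup>2 - A * x\<^sup>2) / 2"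
    "a \<le> x \<Longrightarrow> x \<le> b \<Longrightarrow> hu a b x = p * (b\<^sup>2 - x\<^sup>2) / 2"
    "b \<le> x \<Longrightarrow> hu a b x = 0"
    "x \<le> a \<Longrightarrow> 0 < a \<Longrightarrow> hv a b c x = 0"
    "a \<le> x \<Longrightarrow> x \<le> b \<Longrightarrow> hv a b c x = (B * c\<^sup>2 - \<sigma> * p * b\<^sup>2 - q * x\<^sup>2) / 2"
    "b \<le> x \<Longrightarrow> x \<le> c \<Longrightarrow> hv a b c x = B * (c\<^sup>2 - x\<^sup>2) / 2"
    "c \<le> x \<Longrightarrow> hv a b c x = 0"
proof -
  have abc: "0 \<le> a" "a \<le> b" "b \<le> c" using g by (auto simp: half_profile_def)
  show "a \<le> x \<Longrightarrow> x \<le> b \<Longrightarrow> hu a b x = p * (b\<^sup>2 - x\<^sup>2) / 2"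
    "b \<le> x \<Longrightarrow> hu a b x = 0"
    "b \<le> x \<Longrightarrow> x \<le> c \<Longrightarrow> hv a b c x = B * (c\<^sup>2 - x\<^sup>2) / 2"
    "c \<le> x \<Longrightarrow> hv a b c x = 0"
    using abc x by (simp_all add: hu_def hv_def bump_inside bump_outside)
  show "hu a b x = (p * b\<^sup>2 + \<rho> * q * a\<^sup>2 - A * x\<^sup>2) / 2" if "x \<le> a"
  proof -
    have e: "bump a x = (a\<^sup>2 - x\<^sup>2) / 2" "bump b x = (b\<^sup>2 - x\<^sup>2) / 2"
      using that abc x by (simp_all add: bump_inside)
    have "2 * hu a b x = p * (b\<^sup>2 - x\<^sup>2) + \<rho> * q * (a\<^sup>2 - x\<^sup>2)"
      unfolding hu_def e by (simp add: field_simps)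
    also have "\<dots> = p * b\<^sup>2 + \<rho> * q * a\<^sup>2 - A * x\<^sup>2" using A_eq by algebra
    finally show ?thesis by simp
  qed
  show "hv a b c x = (B * c\<^sup>2 - \<sigma> * p * b\<^sup>2 - q * x\<^sup>2) / 2" if "a \<le> x" "x \<le> b"
  proof -
    have e: "bump a x = 0" "bump b x = (b\<^sup>2 - x\<^sup>2) / 2" "bump c x = (c\<^sup>2 - x\<^sup>2) / 2"
      using that abc x by (simp_all add: bump_inside bump_outside)
    have "2 * hv a b c x = B * (c\<^sup>2 - x\<^sup>2) - \<sigma> * p * (b\<^sup>2 - x\<^sup>2)"
      unfolding hv_def e by (simp add: field_simps)
    also have "\<dots> = B * c\<^sup>2 - \<sigma> * p * b\<^sup>2 - q * x\<^sup>2" using B_eq by algebra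
    finally show ?thesis by simp
  qed
  show "hv a b c x = 0" if "x \<le> a" "0 < a"
  proof -
    have e: "bump a x = (a\<^sup>2 - x\<^sup>2) / 2" "bump b x = (b\<^sup>2 - x\<^sup>2) / 2" "bump c x = (c\<^sup>2 - x\<^sup>2) / 2"
      using that abc x by (simp_all add: bump_inside)
    have "B * c\<^sup>2 = \<sigma> * p * b\<^sup>2 + q * a\<^sup>2" using that g by (auto simp: half_profile_def)
    moreover have "2 * hv a b c x = B * (c\<^sup>2 - x\<^sup>2) - \<sigma> * p * (b\<^sup>2 - x\<^sup>2) - q * (a\<^sup>2 - x\<^sup>2)"
      unfolding hv_def e by (simp add: field_simps)
    ultimately have "2 * hv a b c x = 0" using B_eq by algebra
    then show ?thesis by simp
  qed
qed

lemma half_profile_nonneg: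
  assumes g: "half_profile a b c"
  shows "0 \<le> hu a b x" "0 \<le> hv a b c x"
proof -
  have abc: "0 \<le> a" "a \<le> b" "b \<le> c" "0 < p" using g by (auto simp: half_profile_def)
  have *: "0 \<le> hu a b x \<and> 0 \<le> hv a b c x" if x: "0 \<le> x" for x
  proof
    note vals = half_profile_values[OF g x]
    consider "x < a" | "a \<le> x" "x \<le> b" | "b \<le> x" by linarith
    then show "0 \<le> hu a b x"
    proof cases
      case 1
      have "A * x\<^sup>2 \<le> A * a\<^sup>2" using pos x 1 by (simp add: power_mono)
      moreover have "A * a\<^sup>2 = p * a\<^sup>2 + \<rho> * q * a\<^sup>2" using A_eq by algebra
      moreover have "p * a\<^sup>2 \<le> p * b\<^sup>2" using abc by (simp add: power_mono)
      ultimately show ?thesis using vals(1) 1 by simp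
    next
      case 2
      have "0 \<le> p * (b\<^sup>2 - x\<^sup>2)" using abc x 2 by (simp add: power_mono)
      then show ?thesis using vals(2) 2 by simp
    qed (use vals(3) in simp)
    consider "x < a" | "a \<le> x" "x \<le> b" | "b \<le> x" "x \<le> c" | "c \<le> x" by linarith
    then show "0 \<le> hv a b c x"
    proof cases
      case 2
      have "0 \<le> B * c\<^sup>2 - \<sigma> * p * b\<^sup>2 - q * x\<^sup>2"
      \<comment> \<open>On [a, b] the density v is monotone, with its minimum at a when q \<le> 0
        and at b otherwise.\<close>
      proof (cases "q \<le> 0")
        case True
        have "q * x\<^sup>2 \<le> q * a\<^sup>2" using True 2 abc by (intro mult_left_mono_neg) (auto simp: power_mono)
        then show ?thesis using g by (simp add: half_profile_def)
      next
        case False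
        have "q * x\<^sup>2 \<le> q * b\<^sup>2" using False 2 abc x by (intro mult_left_mono) (auto simp: power_mono)
        moreover have "B * b\<^sup>2 \<le> B * c\<^sup>2" using abc pos by (simp add: power_mono)
        moreover have "B * b\<^sup>2 = \<sigma> * p * b\<^sup>2 + q * b\<^sup>2" using B_eq by algebra
        ultimately show ?thesis by simp
      qed
      then show ?thesis using vals(5) 2 by simp
    next
      case 3
      have "0 \<le> B * (c\<^sup>2 - x\<^sup>2)" using pos x 3 by (simp add: power_mono)
      then show ?thesis using vals(6) 3 by simp
    qed (use vals(4,7) x in simp_all)
  qed
  show "0 \<le> hu a b x" "0 \<le> hv a b c x"
    using *[of "\<bar>x\<bar>"] hu_even[of a b x] hv_even[of a b c x] by (cases "0 \<le> x"; auto simp: abs_if)+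
qed

definition "du a b x = - x * (p * (if \<bar>x\<bar> < b then 1 else 0) + \<rho> * q * (if \<bar>x\<bar> < a then 1 else 0))"
definition "dv a b c x = - x * (B * (if \<bar>x\<bar> < c then 1 else 0) - \<sigma> * p * (if \<bar>x\<bar> < b then 1 else 0) - q * (if \<bar>x\<bar> < a then 1 else 0))"

lemma DERIV_hu:
  assumes "0 \<le> a" "0 \<le> b" "\<bar>x\<bar> \<noteq> a" "\<bar>x\<bar> \<noteq> b"
  shows "(hu a b has_real_derivative du a b x) (at x)"
  unfolding hu_def[abs_def] using assms
  by (auto intro!: derivative_eq_intros DERIV_bump simp: du_def algebra_simps)

lemma DERIV_hv:
  assumes "0 \<le> a" "0 \<le> b" "0 \<le> c" "\<bar>x\<bar> \<noteq> a" "\<bar>x\<bar> \<noteq> b" "\<bar>x\<bar> \<noteq> c"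
  shows "(hv a b c has_real_derivative dv a b c x) (at x)"
  unfolding hv_def[abs_def] using assms
  by (auto intro!: derivative_eq_intros DERIV_bump simp: dv_def algebra_simps)

lemma half_profile_stationary:
  assumes g: "half_profile a b c" and x: "\<bar>x\<bar> \<noteq> a" "\<bar>x\<bar> \<noteq> b" "\<bar>x\<bar> \<noteq> c"
  shows "hu a b x * (du a b x + \<rho> * dv a b c x + A * x) = 0"
    "hv a b c x * (\<sigma> * du a b x + dv a b c x + B * x) = 0"
proof -
  have abc: "0 \<le> a" "a \<le> b" "b \<le> c" "0 < p" using g by (auto simp: half_profile_def)
  note vals = half_profile_values[OF g, of "\<bar>x\<bar>"]
  have ev: "hu a b \<bar>x\<bar> = hu a b x" "hv a b c \<bar>x\<bar> = hv a b c x"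
    using hu_even[of a b x] hv_even[of a b c x] by (auto simp: abs_if)
  have 1: "du a b x + \<rho> * dv a b c x + A * x = 0" if "\<bar>x\<bar> < b"
  proof (cases "\<bar>x\<bar> < a")
    case True
    then have "du a b x = - x * (p + \<rho> * q)" "dv a b c x = - x * (B - \<sigma> * p - q)"
      using abc by (simp_all add: du_def dv_def)
    then show ?thesis using A_eq B_eq by algebra
  next
    case False
    then have "du a b x = - x * p" "dv a b c x = - x * (B - \<sigma> * p)"
      using abc that by (simp_all add: du_def dv_def)
    then show ?thesis using A_eq B_eq by algebra
  qed
  then show "hu a b x * (du a b x + \<rho> * dv a b c x + A * x) = 0"
    using vals(3) ev x by (cases "\<bar>x\<bar> < b") auto
  have 2: "\<sigma> * du a b x + dv a b c x + B * x = 0" if "a < \<bar>x\<bar>" "\<bar>x\<bar> < c"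
  proof (cases "\<bar>x\<bar> < b")
    case True
    then have "du a b x = - x * p" "dv a b c x = - x * (B - \<sigma> * p)"
      using abc that by (simp_all add: du_def dv_def)
    then show ?thesis by algebra
  next
    case False
    then have "du a b x = 0" "dv a b c x = - x * B"
      using abc that by (simp_all add: du_def dv_def)
    then show ?thesis by algebra
  qed
  show "hv a b c x * (\<sigma> * du a b x + dv a b c x + B * x) = 0"
    using vals(4,7) ev x 2 abc by (cases "\<bar>x\<bar> < a"; cases "\<bar>x\<bar> < c") auto
qed

lemma integral_hu_half:
  assumes "0 \<le> a" "0 \<le> b"
  shows "integrable lebesgue (\<lambda>x. indicator {0..} x * hu a b x)" "integrable lebesgue (\<lambda>x. indicator {..<0} x * hu a b x)"
    "(LINT x|lebesgue. indicator {0..} x * hu a b x) = (p * b ^ 3 + \<rho> * q * a ^ 3) / 3"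
    "(LINT x|lebesgue. indicator {..<0} x * hu a b x) = (p * b ^ 3 + \<rho> * q * a ^ 3) / 3"
proof -
  have eq: "(\<lambda>x. indicator S x * hu a b x) =
      (\<lambda>x. p * (indicator S x * bump b x) + \<rho> * q * (indicator S x * bump a x))" for S
    by (auto simp: hu_def algebra_simps)
  note i = has_integral_bump_right[OF assms(1)] has_integral_bump_right[OF assms(2)]
    has_integral_bump_left[OF assms(1)] has_integral_bump_left[OF assms(2)]
  show "integrable lebesgue (\<lambda>x. indicator {0..} x * hu a b x)" "integrable lebesgue (\<lambda>x. indicator {..<0} x * hu a b x)"
    "(LINT x|lebesgue. indicator {0..} x * hu a b x) = (p * b ^ 3 + \<rho> * q * a ^ 3) / 3"
    "(LINT x|lebesgue. indicator {..<0} x * hu a b x) = (p * b ^ 3 + \<rho> * q * a ^ 3) / 3"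
    unfolding eq by (simp_all add: i add_divide_distrib)
qed

lemma integral_hv_half:
  assumes "0 \<le> a" "0 \<le> b" "0 \<le> c"
  shows "integrable lebesgue (\<lambda>x. indicator {0..} x * hv a b c x)" "integrable lebesgue (\<lambda>x. indicator {..<0} x * hv a b c x)"
    "(LINT x|lebesgue. indicator {0..} x * hv a b c x) = (B * c ^ 3 - \<sigma> * p * b ^ 3 - q * a ^ 3) / 3"
    "(LINT x|lebesgue. indicator {..<0} x * hv a b c x) = (B * c ^ 3 - \<sigma> * p * b ^ 3 - q * a ^ 3) / 3"
proof -
  have eq: "(\<lambda>x. indicator S x * hv a b c x) =
      (\<lambda>x. B * (indicator S x * bump c x) - \<sigma> * p * (indicator S x * bump b x) - q * (indicator S x * bump a x))" for S
    by (auto simp: hv_def algebra_simps)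
  note i = has_integral_bump_right[OF assms(1)] has_integral_bump_right[OF assms(2)] has_integral_bump_right[OF assms(3)]
    has_integral_bump_left[OF assms(1)] has_integral_bump_left[OF assms(2)] has_integral_bump_left[OF assms(3)]
  show "integrable lebesgue (\<lambda>x. indicator {0..} x * hv a b c x)" "integrable lebesgue (\<lambda>x. indicator {..<0} x * hv a b c x)"
    "(LINT x|lebesgue. indicator {0..} x * hv a b c x) = (B * c ^ 3 - \<sigma> * p * b ^ 3 - q * a ^ 3) / 3"
    "(LINT x|lebesgue. indicator {..<0} x * hv a b c x) = (B * c ^ 3 - \<sigma> * p * b ^ 3 - q * a ^ 3) / 3"
    unfolding eq by (simp_all add: i diff_divide_distrib)
qed

lemma integral_glue_hu:
  assumes "0 \<le> a" "0 \<le> b" "0 \<le> a1" "0 \<le> b1"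
  shows "(LINT x|lebesgue. glue (hu a b) (hu a1 b1) x) = (p * (b ^ 3 + b1 ^ 3) + \<rho> * q * (a ^ 3 + a1 ^ 3)) / 3"
  unfolding glue_eq_indicator using assms by (simp add: integral_hu_half) (simp add: field_simps)

lemma integral_glue_hv:
  assumes "0 \<le> a" "0 \<le> b" "0 \<le> c" "0 \<le> a1" "0 \<le> b1" "0 \<le> c1"
  shows "(LINT x|lebesgue. glue (hv a b c) (hv a1 b1 c1) x)
     = (B * (c ^ 3 + c1 ^ 3) - \<sigma> * p * (b ^ 3 + b1 ^ 3) - q * (a ^ 3 + a1 ^ 3)) / 3"
  unfolding glue_eq_indicator using assms by (simp add: integral_hv_half) (simp add: field_simps)

text \<open>Converse of the classification. Agreement of the two halves at 0 suffices: the glued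
  functions are then continuous and piecewise smooth with bounded derivatives, and vanish outside a
  compact set. The set S collects all possible kinks.\<close>

lemma profile_weak_sol:
  assumes g: "half_profile a b c" and g1: "half_profile a1 b1 c1"
    and u0: "hu a b 0 = hu a1 b1 0" and v0: "hv a b c 0 = hv a1 b1 c1 0"
    and M: "M = (p * (b ^ 3 + b1 ^ 3) + \<rho> * q * (a ^ 3 + a1 ^ 3)) / 3"
    and N: "N = (B * (c ^ 3 + c1 ^ 3) - \<sigma> * p * (b ^ 3 + b1 ^ 3) - q * (a ^ 3 + a1 ^ 3)) / 3"
  shows "weak_sol \<rho> \<sigma> A B M N (glue (hu a b) (hu a1 b1)) (glue (hv a b c) (hv a1 b1 c1))"
proof -
  have abc: "0 \<le> a" "a \<le> b" "b \<le> c" "0 \<le> a1" "a1 \<le> b1" "b1 \<le> c1"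
    using g g1 by (auto simp: half_profile_def)
  then have b0: "0 \<le> b" "0 \<le> b1" "0 \<le> c" "0 \<le> c1" by auto
  define U where "U = glue (hu a b) (hu a1 b1)"
  define V where "V = glue (hv a b c) (hv a1 b1 c1)"
  define k where "k = max c c1"
  have cU: "continuous_on UNIV U" unfolding U_def hu_def[abs_def]
    by (rule continuous_on_glue) (use u0 in \<open>auto intro!: continuous_intros continuous_on_bump simp: hu_def\<close>)
  have cV: "continuous_on UNIV V" unfolding V_def hv_def[abs_def]
    by (rule continuous_on_glue) (use v0 in \<open>auto intro!: continuous_intros continuous_on_bump simp: hv_def\<close>)
  have zU: "U x = 0" if "k < \<bar>x\<bar>" for x
    using that abc by (auto simp: U_def glue_def hu_def k_def bump_eq_0)
  have zV: "V x = 0" if "k < \<bar>x\<bar>" for x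
    using that abc by (auto simp: V_def glue_def hv_def k_def bump_eq_0)
  have nU: "0 \<le> U x" for x using half_profile_nonneg(1)[OF g] half_profile_nonneg(1)[OF g1] by (simp add: U_def glue_def)
  have nV: "0 \<le> V x" for x using half_profile_nonneg(2)[OF g] half_profile_nonneg(2)[OF g1] by (simp add: V_def glue_def)
  define DU where "DU = glue (du a b) (du a1 b1)"
  define DV where "DV = glue (dv a b c) (dv a1 b1 c1)"
  have mD: "DU \<in> borel_measurable borel" "DV \<in> borel_measurable borel"
    unfolding DU_def DV_def glue_def[abs_def] du_def[abs_def] dv_def[abs_def] by measurable
  have zD: "DU x = 0" "DV x = 0" if "k < \<bar>x\<bar>" for x
    using that abc by (auto simp: DU_def DV_def glue_def du_def dv_def k_def)
  \<comment> \<open>Every slope is x times a signed sum of some of these coefficients, and it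
    vanishes for |x| > k.\<close>
  define C where "C = k * (\<bar>p\<bar> + \<bar>\<rho> * q\<bar> + \<bar>B\<bar> + \<bar>\<sigma> * p\<bar> + \<bar>q\<bar>)"
  have bD: "\<bar>DU x\<bar> \<le> C" "\<bar>DV x\<bar> \<le> C" for x
  proof -
    define t where "t = \<bar>p\<bar> + \<bar>\<rho> * q\<bar> + \<bar>B\<bar> + \<bar>\<sigma> * p\<bar> + \<bar>q\<bar>"
    have C: "C = k * t" by (simp add: C_def t_def)
    have mul: "\<bar>- x * s\<bar> \<le> C" if "\<bar>s\<bar> \<le> t" "\<bar>x\<bar> \<le> k" for s
      unfolding C abs_mult[of "- x" s] using that by (intro mult_mono) auto
    have C0: "0 \<le> C" unfolding C using abc by (intro mult_nonneg_nonneg) (auto simp: k_def t_def)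
    have t1: "\<bar>p * (if P then 1 else 0) + \<rho> * q * (if P' then 1 else 0)\<bar> \<le> t" for P P'
      unfolding t_def by (cases P; cases P'; simp; linarith)
    have t2: "\<bar>B * (if P then 1 else 0) - \<sigma> * p * (if P' then 1 else 0) - q * (if P'' then 1 else 0)\<bar> \<le> t" for P P' P''
      unfolding t_def by (cases P; cases P'; cases P''; simp; linarith)
    show "\<bar>DU x\<bar> \<le> C"
    proof (cases "k < \<bar>x\<bar>")
      case False
      then show ?thesis unfolding DU_def glue_def du_def using mul[OF t1] by simp
    qed (use zD C0 in simp)
    show "\<bar>DV x\<bar> \<le> C"
    proof (cases "k < \<bar>x\<bar>")
      case False
      then show ?thesis unfolding DV_def glue_def dv_def using mul[OF t2] by simp
    qed (use zD C0 in simp)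
  qed
  have L2D: "DU \<in> L2" "DV \<in> L2"
  proof -
    have "\<bar>(DU x)\<^sup>2\<bar> \<le> C\<^sup>2" "\<bar>(DV x)\<^sup>2\<bar> \<le> C\<^sup>2" for x
      using power_mono[OF bD(1)[of x], of 2] power_mono[OF bD(2)[of x], of 2] by auto
    then have "integrable lebesgue (\<lambda>x. (DU x)\<^sup>2)" "integrable lebesgue (\<lambda>x. (DV x)\<^sup>2)"
      using mD zD by (auto intro!: integrable_bounded_support[where k=k and C="C\<^sup>2"])
    then show "DU \<in> L2" "DV \<in> L2" using mD by (auto simp: L2_def measurable_completion)
  qed
  have lD: "locally_integrable DU" "locally_integrable DV"
    using mD zD bD by (auto intro!: integrable_imp_locally_integrable integrable_bounded_support[where k=k and C=C])
  define S where "S = {0, a, b, c, -a, -b, -c, a1, b1, c1, -a1, -b1, -c1}"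
  have fS: "finite S" by (simp add: S_def)
  have dU: "(U has_real_derivative DU x) (at x)" if "x \<notin> S" for x
    unfolding U_def
  proof (rule DERIV_glue)
    show "(hu a b has_real_derivative DU x) (at x)" if "0 < x"
      using DERIV_hu[of a b x] that \<open>x \<notin> S\<close> abc by (auto simp: DU_def glue_def S_def abs_if)
    show "(hu a1 b1 has_real_derivative DU x) (at x)" if "x < 0"
      using DERIV_hu[of a1 b1 x] that \<open>x \<notin> S\<close> abc by (auto simp: DU_def glue_def S_def abs_if)
    show "x \<noteq> 0" using that by (auto simp: S_def)
  qed
  have dV: "(V has_real_derivative DV x) (at x)" if "x \<notin> S" for x
    unfolding V_def
  proof (rule DERIV_glue)
    show "(hv a b c has_real_derivative DV x) (at x)" if "0 < x"
      using DERIV_hv[of a b c x] that \<open>x \<notin> S\<close> abc by (auto simp: DV_def glue_def S_def abs_if)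
    show "(hv a1 b1 c1 has_real_derivative DV x) (at x)" if "x < 0"
      using DERIV_hv[of a1 b1 c1 x] that \<open>x \<notin> S\<close> abc by (auto simp: DV_def glue_def S_def abs_if)
    show "x \<noteq> 0" using that by (auto simp: S_def)
  qed
  have "integrable lebesgue (\<lambda>x. (U x)\<^sup>2)" "integrable lebesgue (\<lambda>x. (V x)\<^sup>2)"
    by (rule integrable_continuous_compact_support[where k=k]; use zU zV cU cV in \<open>auto intro!: continuous_intros\<close>)+
  then have L2: "U \<in> L2" "V \<in> L2"
    using cU cV by (auto simp: L2_def intro!: measurable_completion borel_measurable_continuous_onI)
  have H1: "U \<in> H1" "V \<in> H1"
    unfolding H1_def using L2 L2D weak_derivative_piecewise[OF cU lD(1) fS dU]
      weak_derivative_piecewise[OF cV lD(2) fS dV] by auto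
  have "integrable lebesgue (\<lambda>x. (1 + x\<^sup>2) * U x)" "integrable lebesgue (\<lambda>x. (1 + x\<^sup>2) * V x)"
    by (rule integrable_continuous_compact_support[where k=k]; use zU zV cU cV in \<open>auto intro!: continuous_intros\<close>)+
  moreover have "(LINT x|lebesgue. U x) = M" "(LINT x|lebesgue. V x) = N"
    unfolding U_def V_def
    by (rule trans[OF integral_glue_hu[OF abc(1) b0(1) abc(4) b0(2)] M[symmetric]],
        rule trans[OF integral_glue_hv[OF abc(1) b0(1,3) abc(4) b0(2,4)] N[symmetric]])
  moreover have "U \<in> borel_measurable lebesgue" "V \<in> borel_measurable lebesgue"
    using L2 by (auto simp: L2_def)
  ultimately have adm: "admissible M U" "admissible N V" using nU nV H1 by (auto simp: admissible_def)
  have lx: "locally_integrable (\<lambda>x. t * w x)" if "locally_integrable w" for t :: real and w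
    using that by (auto simp: locally_integrable_def)
  have lid: "locally_integrable (\<lambda>x. t * x)" for t :: real
    by (intro locally_integrable_continuous continuous_intros)
  have W1: "has_weak_derivative (\<lambda>x. U x + \<rho> * V x + A * x\<^sup>2 / 2) (\<lambda>x. DU x + \<rho> * DV x + A * x)"
    by (rule weak_derivative_piecewise[OF _ _ fS])
      (auto intro!: continuous_intros cU cV locally_integrable_add lD lx lid derivative_eq_intros dU dV)
  have W2: "has_weak_derivative (\<lambda>x. \<sigma> * U x + V x + B * x\<^sup>2 / 2) (\<lambda>x. \<sigma> * DU x + DV x + B * x)"
    by (rule weak_derivative_piecewise[OF _ _ fS])
      (auto intro!: continuous_intros cU cV locally_integrable_add lD lx lid derivative_eq_intros dU dV)
  have AES: "AE x in lebesgue. x \<notin> S"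
    by (rule AE_completion, rule AE_not_in) (use fS in \<open>auto intro: finite_imp_null_set_lborel\<close>)
  have "AE x in lebesgue. U x * (DU x + \<rho> * DV x + A * x) = 0"
    using AES
  proof eventually_elim
    case (elim x)
    have "\<bar>x\<bar> \<noteq> a" "\<bar>x\<bar> \<noteq> b" "\<bar>x\<bar> \<noteq> c" "\<bar>x\<bar> \<noteq> a1" "\<bar>x\<bar> \<noteq> b1" "\<bar>x\<bar> \<noteq> c1"
      using elim by (auto simp: S_def abs_if)
    then show ?case using half_profile_stationary(1)[OF g, of x] half_profile_stationary(1)[OF g1, of x]
      by (cases "0 \<le> x") (simp_all add: U_def DU_def DV_def glue_def)
  qed
  moreover have "AE x in lebesgue. V x * (\<sigma> * DU x + DV x + B * x) = 0"
    using AES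
  proof eventually_elim
    case (elim x)
    have "\<bar>x\<bar> \<noteq> a" "\<bar>x\<bar> \<noteq> b" "\<bar>x\<bar> \<noteq> c" "\<bar>x\<bar> \<noteq> a1" "\<bar>x\<bar> \<noteq> b1" "\<bar>x\<bar> \<noteq> c1"
      using elim by (auto simp: S_def abs_if)
    then show ?case using half_profile_stationary(2)[OF g, of x] half_profile_stationary(2)[OF g1, of x]
      by (cases "0 \<le> x") (simp_all add: V_def DU_def DV_def glue_def)
  qed
  ultimately show ?thesis
    using W1 W2 adm unfolding weak_sol_def U_def[symmetric] V_def[symmetric] by blast
qed

text \<open>Counterpart of \<open>potential_u_ge\<close> for the component that may leave the
  centre. The reference constant is B c^2 / 2 of this half line, not the value at 0; in the gap |x|
  < a the excess is th q (x^2 - a^2) / 2 \<ge> 0. Different outer radii on the two sides thus give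
  different constants.\<close>

lemma half_profile_potential_v_ge:
  assumes g: "half_profile a b c" and q: "q \<le> 0"
  shows "B * c\<^sup>2 / 2 \<le> \<sigma> * hu a b x + hv a b c x + B * x\<^sup>2 / 2"
    "0 < hv a b c x \<Longrightarrow> \<sigma> * hu a b x + hv a b c x + B * x\<^sup>2 / 2 = B * c\<^sup>2 / 2"
proof -
  have abc: "0 \<le> a" "a \<le> b" "b \<le> c" "0 < p" using g by (auto simp: half_profile_def)
  note vals = half_profile_values[OF g, of "\<bar>x\<bar>"]
  have ev: "hu a b \<bar>x\<bar> = hu a b x" "hv a b c \<bar>x\<bar> = hv a b c x"
    using hu_even[of a b x] hv_even[of a b c x] by (auto simp: abs_if)
  have mid: "\<sigma> * hu a b x + hv a b c x + B * x\<^sup>2 / 2 = B * c\<^sup>2 / 2" if "a \<le> \<bar>x\<bar>" "\<bar>x\<bar> \<le> c"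
  proof (cases "\<bar>x\<bar> \<le> b")
    case True
    have "2 * hu a b x = p * (b\<^sup>2 - x\<^sup>2)" "2 * hv a b c x = B * c\<^sup>2 - \<sigma> * p * b\<^sup>2 - q * x\<^sup>2"
      using vals(2,5) ev True that by simp_all
    then have "2 * (\<sigma> * hu a b x + hv a b c x) + B * x\<^sup>2 = B * c\<^sup>2" using B_eq by algebra
    then show ?thesis by simp
  next
    case False
    then have "hu a b x = 0" "hv a b c x = B * (c\<^sup>2 - x\<^sup>2) / 2" using vals(3,6) ev that by simp_all
    then show ?thesis by (simp add: field_simps)
  qed
  show "B * c\<^sup>2 / 2 \<le> \<sigma> * hu a b x + hv a b c x + B * x\<^sup>2 / 2"
  proof -
    consider "\<bar>x\<bar> < a" | "a \<le> \<bar>x\<bar>" "\<bar>x\<bar> \<le> c" | "c < \<bar>x\<bar>" by linarith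
    then show ?thesis
    proof cases
      case 1
      have h0: "hv a b c x = 0" using vals(4) 1 ev by simp
      have "2 * hu a b x = p * b\<^sup>2 + \<rho> * q * a\<^sup>2 - A * x\<^sup>2" using vals(1) 1 ev by simp
      moreover have "B * c\<^sup>2 = \<sigma> * p * b\<^sup>2 + q * a\<^sup>2" using g 1 by (auto simp: half_profile_def)
      ultimately have "2 * (\<sigma> * hu a b x) + B * x\<^sup>2 - B * c\<^sup>2 = (th * q) * (x\<^sup>2 - a\<^sup>2)"
        using A_eq B_eq th_def by algebra
      moreover have "0 \<le> (th * q) * (x\<^sup>2 - a\<^sup>2)"
      proof (rule mult_nonpos_nonpos)
        show "th * q \<le> 0" using th_pos q by (simp add: mult_nonneg_nonpos)
        show "x\<^sup>2 - a\<^sup>2 \<le> 0" using power_mono[of "\<bar>x\<bar>" a 2] 1 by simp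
      qed
      ultimately show ?thesis using h0 by simp
    next
      case 2
      then show ?thesis using mid by simp
    next
      case 3
      have "B * c\<^sup>2 \<le> B * x\<^sup>2" using power_mono[of c "\<bar>x\<bar>" 2] 3 abc pos by simp
      then show ?thesis using vals(3,7) ev 3 abc by simp
    qed
  qed
  show "\<sigma> * hu a b x + hv a b c x + B * x\<^sup>2 / 2 = B * c\<^sup>2 / 2" if "0 < hv a b c x"
  proof (rule mid)
    show "a \<le> \<bar>x\<bar>"
    proof (rule ccontr)
      assume "\<not> a \<le> \<bar>x\<bar>"
      then have "\<bar>x\<bar> \<le> a" "0 < a" using abs_ge_zero[of x] by linarith+
      then show False using vals(4) ev that by simp
    qed
    show "\<bar>x\<bar> \<le> c" using vals(7) ev that by (rule_tac ccontr) simp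
  qed
qed

text \<open>By \<open>support_u_down\<close> on both half lines, u would vanish identically if it
  vanished at 0, against the positive mass.\<close>

lemma weak_sol_pos_at_0:
  assumes p: "0 \<le> p" and M: "0 < M"
    and h: "half_sol \<rho> \<sigma> A B u v" "half_sol \<rho> \<sigma> A B (\<lambda>x. u (- x)) (\<lambda>x. v (- x))"
    and nn: "\<And>x. 0 \<le> u x" and i: "(LINT x|lebesgue. u x) = M"
  shows "0 < u 0"
proof (rule ccontr)
  assume "\<not> 0 < u 0"
  then have "\<not> 0 < u x" for x
    using support_u_down[OF h(1) p, of x 0] support_u_down[OF h(2) p, of "-x" 0] by (cases "0 \<le> x") auto
  then have "u x = 0" for x using nn[of x] by (metis less_eq_real_def)
  then have "u = (\<lambda>_. 0)" by auto
  then show False using i M by simp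
qed

text \<open>Both half lines see the same value v 0. If it is positive, both inner radii are 0; if it
  is 0, the matching condition between the radii holds on both sides.\<close>

lemma weak_sol_classify:
  assumes w: "weak_sol \<rho> \<sigma> A B M N u v" and q: "q < 0" and M: "0 < M"
  obtains a b c a1 b1 c1 where "half_profile a b c" "half_profile a1 b1 c1" "0 < b" "0 < b1"
    "hu a b 0 = hu a1 b1 0" "hv a b c 0 = hv a1 b1 c1 0" "a = 0 \<and> a1 = 0 \<or> hv a b c 0 = 0"
    "M = (p * (b ^ 3 + b1 ^ 3) + \<rho> * q * (a ^ 3 + a1 ^ 3)) / 3"
    "N = (B * (c ^ 3 + c1 ^ 3) - \<sigma> * p * (b ^ 3 + b1 ^ 3) - q * (a ^ 3 + a1 ^ 3)) / 3"
    "eq_ae u (glue (hu a b) (hu a1 b1))" "eq_ae v (glue (hv a b c) (hv a1 b1 c1))"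
proof -
  have p: "0 < p" using q p_pos_if_q_nonpos by simp
  obtain u' v' where r: "AE x in lebesgue. u x = u' x" "AE x in lebesgue. v x = v' x"
    "continuous_on UNIV u'" "continuous_on UNIV v'" "\<And>x. 0 \<le> u' x" "\<And>x. 0 \<le> v' x"
    "half_sol \<rho> \<sigma> A B u' v'" "half_sol \<rho> \<sigma> A B (\<lambda>x. u' (- x)) (\<lambda>x. v' (- x))"
    "integrable lebesgue u'" "integrable lebesgue v'"
    "(LINT x|lebesgue. u' x) = M" "(LINT x|lebesgue. v' x) = N"
    using weak_sol_continuous[OF w] by blast
  have u0: "0 < u' 0" using weak_sol_pos_at_0[OF less_imp_le[OF p] M r(7,8,5,11)] .
  obtain a b c where abc: "0 \<le> a" "a \<le> b" "b \<le> c" "0 < b" "a = 0 \<or> v' 0 = 0"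
    "\<And>x. 0 \<le> x \<Longrightarrow> u' x = hu a b x" "\<And>x. 0 \<le> x \<Longrightarrow> v' x = hv a b c x"
    using half_sol_explicit[OF r(7) q u0] by metis
  obtain a1 b1 c1 where abc1: "0 \<le> a1" "a1 \<le> b1" "b1 \<le> c1" "0 < b1" "a1 = 0 \<or> v' 0 = 0"
    "\<And>x. 0 \<le> x \<Longrightarrow> u' (-x) = hu a1 b1 x" "\<And>x. 0 \<le> x \<Longrightarrow> v' (-x) = hv a1 b1 c1 x"
    using half_sol_explicit[OF r(8) q] u0 by auto
  have eu: "u' = glue (hu a b) (hu a1 b1)"
  proof
    fix x show "u' x = glue (hu a b) (hu a1 b1) x"
      using abc(6)[of x] abc1(6)[of "-x"] hu_even by (auto simp: glue_def)
  qed
  have ev: "v' = glue (hv a b c) (hv a1 b1 c1)"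
  proof
    fix x show "v' x = glue (hv a b c) (hv a1 b1 c1) x"
      using abc(7)[of x] abc1(7)[of "-x"] hv_even by (auto simp: glue_def)
  qed
  have nn: "0 \<le> a" "0 \<le> b" "0 \<le> c" "0 \<le> a1" "0 \<le> b1" "0 \<le> c1" using abc(1-4) abc1(1-4) by linarith+
  have 0: "v' 0 = hv a b c 0" "v' 0 = hv a1 b1 c1 0" "u' 0 = hu a b 0" "u' 0 = hu a1 b1 0"
    using abc(6,7)[of 0] abc1(6,7)[of 0] by auto
  have "0 \<le> v' 0" by (rule r)
  then have "half_profile a b c" "half_profile a1 b1 c1"
    using abc abc1 p q 0 nn unfolding half_profile_def by (auto simp: profile_at_0)
  then show ?thesis
    using abc abc1 0 integral_glue_hu[OF nn(1,2,4,5)] integral_glue_hv[OF nn] r(1,2,11,12) eu ev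
    by (intro that[of a b c a1 b1 c1]) (auto simp: eq_ae_def)
qed

text \<open>For p, q \<ge> 0 both densities are positive at the centre, hence each potential has one
  constant for the whole line. These are the complementarity conditions of a variational inequality;
  for q < 0 the global constant L may be lost.\<close>

lemma weak_sol_variational:
  assumes w: "weak_sol \<rho> \<sigma> A B M N u v" and pq: "0 \<le> p" "0 \<le> q" and MN: "0 < M" "0 < N"
  obtains u' v' K L where "AE x in lebesgue. u x = u' x" "AE x in lebesgue. v x = v' x"
    "integrable lebesgue u'" "integrable lebesgue v'"
    "(LINT x|lebesgue. u' x) = M" "(LINT x|lebesgue. v' x) = N" "\<And>x. 0 \<le> u' x" "\<And>x. 0 \<le> v' x"
    "\<And>x. K \<le> u' x + \<rho> * v' x + A * x\<^sup>2 / 2" "\<And>x. 0 < u' x \<Longrightarrow> u' x + \<rho> * v' x + A * x\<^sup>2 / 2 = K"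
    "\<And>x. L \<le> \<sigma> * u' x + v' x + B * x\<^sup>2 / 2" "\<And>x. 0 < v' x \<Longrightarrow> \<sigma> * u' x + v' x + B * x\<^sup>2 / 2 = L"
proof -
  obtain u' v' where r: "AE x in lebesgue. u x = u' x" "AE x in lebesgue. v x = v' x"
    "continuous_on UNIV u'" "continuous_on UNIV v'" "\<And>x. 0 \<le> u' x" "\<And>x. 0 \<le> v' x"
    "half_sol \<rho> \<sigma> A B u' v'" "half_sol \<rho> \<sigma> A B (\<lambda>x. u' (- x)) (\<lambda>x. v' (- x))"
    "integrable lebesgue u'" "integrable lebesgue v'"
    "(LINT x|lebesgue. u' x) = M" "(LINT x|lebesgue. v' x) = N"
    using weak_sol_continuous[OF w] by blast
  have r': "half_sol \<sigma> \<rho> B A v' u'" "half_sol \<sigma> \<rho> B A (\<lambda>x. v' (- x)) (\<lambda>x. u' (- x))"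
    using r(7,8) half_sol_swap by blast+
  note q' = pq(2)[folded swap_p]
  have u0: "0 < u' 0" using weak_sol_pos_at_0[OF pq(1) MN(1) r(7,8,5,11)] .
  have v0: "0 < v' 0" using cross.weak_sol_pos_at_0[OF swap q' MN(2) r' r(6,12)] .
  note gu = potential_u_ge[OF r(7) pq(1) u0] potential_u_ge[OF r(8) pq(1)]
  note gv = cross.potential_u_ge[OF swap r'(1) q' v0] cross.potential_u_ge[OF swap r'(2) q']
  show ?thesis
  proof (rule that[OF r(1,2,9,10,11,12,5,6)])
    fix x :: real
    show "u' 0 + \<rho> * v' 0 \<le> u' x + \<rho> * v' x + A * x\<^sup>2 / 2"
      using gu(1)[of x] gu(3)[of "-x"] u0 by (cases "0 \<le> x") auto
    show "u' x + \<rho> * v' x + A * x\<^sup>2 / 2 = u' 0 + \<rho> * v' 0" if "0 < u' x"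
      using gu(2)[of x] gu(4)[of "-x"] u0 that by (cases "0 \<le> x") auto
    show "\<sigma> * u' 0 + v' 0 \<le> \<sigma> * u' x + v' x + B * x\<^sup>2 / 2"
      using gv(1)[of x] gv(3)[of "-x"] v0 by (cases "0 \<le> x") (auto simp: add.commute)
    show "\<sigma> * u' x + v' x + B * x\<^sup>2 / 2 = \<sigma> * u' 0 + v' 0" if "0 < v' x"
      using gv(2)[of x] gv(4)[of "-x"] v0 that by (cases "0 \<le> x") (auto simp: add.commute)
  qed
qed

section \<open>Convexity: uniqueness for nonnegative slopes, and the energy gap\<close>

lemma quad_nonneg: "0 \<le> \<sigma> * d\<^sup>2 + 2 * (\<rho> * \<sigma> * (d * e)) + \<rho> * e\<^sup>2"
  and quad_zero: "\<sigma> * d\<^sup>2 + 2 * (\<rho> * \<sigma> * (d * e)) + \<rho> * e\<^sup>2 \<le> 0 \<Longrightarrow> d = 0 \<and> e = 0"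
proof -
  have eq: "\<sigma> * d\<^sup>2 + 2 * (\<rho> * \<sigma> * (d * e)) + \<rho> * e\<^sup>2 = \<sigma> * (d + \<rho> * e)\<^sup>2 + \<rho> * th * e\<^sup>2"
    by (simp add: th_def power2_eq_square algebra_simps)
  have nn: "0 \<le> \<sigma> * (d + \<rho> * e)\<^sup>2" "0 \<le> \<rho> * th * e\<^sup>2" using pos th_pos by simp_all
  then show "0 \<le> \<sigma> * d\<^sup>2 + 2 * (\<rho> * \<sigma> * (d * e)) + \<rho> * e\<^sup>2" using eq by simp
  assume "\<sigma> * d\<^sup>2 + 2 * (\<rho> * \<sigma> * (d * e)) + \<rho> * e\<^sup>2 \<le> 0"
  then have "\<rho> * th * e\<^sup>2 = 0" "\<sigma> * (d + \<rho> * e)\<^sup>2 = 0" using eq nn by linarith+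
  then show "d = 0 \<and> e = 0" using pos th_pos by auto
qed

text \<open>Monotonicity argument: the complementarity conditions of both solutions are tested with
  the differences d and e. Their weighted sum bounds a positive definite form in d and e by h, which
  is linear in d and e and integrates to 0 because the masses agree.\<close>

lemma weak_sol_unique_mid:
  assumes w: "weak_sol \<rho> \<sigma> A B M N u v" "weak_sol \<rho> \<sigma> A B M N f g"
    and pq: "0 \<le> p" "0 \<le> q" and MN: "0 < M" "0 < N"
  shows "eq_ae u f" "eq_ae v g"
proof -
  obtain u' v' K L where r: "AE x in lebesgue. u x = u' x" "AE x in lebesgue. v x = v' x"
    "integrable lebesgue u'" "integrable lebesgue v'"
    "(LINT x|lebesgue. u' x) = M" "(LINT x|lebesgue. v' x) = N" "\<And>x. 0 \<le> u' x" "\<And>x. 0 \<le> v' x"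
    "\<And>x. K \<le> u' x + \<rho> * v' x + A * x\<^sup>2 / 2" "\<And>x. 0 < u' x \<Longrightarrow> u' x + \<rho> * v' x + A * x\<^sup>2 / 2 = K"
    "\<And>x. L \<le> \<sigma> * u' x + v' x + B * x\<^sup>2 / 2" "\<And>x. 0 < v' x \<Longrightarrow> \<sigma> * u' x + v' x + B * x\<^sup>2 / 2 = L"
    using weak_sol_variational[OF w(1) pq MN] by blast
  obtain f' g' K' L' where s: "AE x in lebesgue. f x = f' x" "AE x in lebesgue. g x = g' x"
    "integrable lebesgue f'" "integrable lebesgue g'"
    "(LINT x|lebesgue. f' x) = M" "(LINT x|lebesgue. g' x) = N" "\<And>x. 0 \<le> f' x" "\<And>x. 0 \<le> g' x"
    "\<And>x. K' \<le> f' x + \<rho> * g' x + A * x\<^sup>2 / 2" "\<And>x. 0 < f' x \<Longrightarrow> f' x + \<rho> * g' x + A * x\<^sup>2 / 2 = K'"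
    "\<And>x. L' \<le> \<sigma> * f' x + g' x + B * x\<^sup>2 / 2" "\<And>x. 0 < g' x \<Longrightarrow> \<sigma> * f' x + g' x + B * x\<^sup>2 / 2 = L'"
    using weak_sol_variational[OF w(2) pq MN] by blast
  define d where "d x = u' x - f' x" for x
  define e where "e x = v' x - g' x" for x
  define h where "h x = \<sigma> * (K - K') * d x + \<rho> * (L - L') * e x" for x
  \<comment> \<open>Pointwise complementarity: s (P - k) = 0 and t (P' - k') = 0, while P \<ge> k
    and P' \<ge> k'.\<close>
  have compl: "(s - t) * (P - P') \<le> (k - k') * (s - t)"
    if "0 \<le> s" "0 \<le> t" "k \<le> P" "k' \<le> P'" "0 < s \<Longrightarrow> P = k" "0 < t \<Longrightarrow> P' = k'" for s t P P' k k' :: real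
  proof -
    have "s * P = s * k" "t * P' = t * k'" using that by (cases "s = 0"; cases "t = 0"; auto)+
    moreover have "s * k' \<le> s * P'" "t * k \<le> t * P" using that by (auto intro: mult_left_mono)
    moreover have "(s - t) * (P - P') = s * P - s * P' - t * P + t * P'" "(k - k') * (s - t) = s * k - s * k' - t * k + t * k'"
      by (simp_all add: algebra_simps)
    ultimately show ?thesis by linarith
  qed
  have qh: "\<sigma> * (d x)\<^sup>2 + 2 * (\<rho> * \<sigma> * (d x * e x)) + \<rho> * (e x)\<^sup>2 \<le> h x" for x
  proof -
    have 1: "d x * (d x + \<rho> * e x) \<le> (K - K') * d x"
      using compl[OF r(7)[of x] s(7)[of x] r(9)[of x] s(9)[of x] r(10)[of x] s(10)[of x]]
      by (simp add: d_def e_def algebra_simps)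
    have 2: "e x * (\<sigma> * d x + e x) \<le> (L - L') * e x"
      using compl[OF r(8)[of x] s(8)[of x] r(11)[of x] s(11)[of x] r(12)[of x] s(12)[of x]]
      by (simp add: d_def e_def algebra_simps)
    have "\<sigma> * (d x * (d x + \<rho> * e x)) + \<rho> * (e x * (\<sigma> * d x + e x)) \<le> \<sigma> * ((K - K') * d x) + \<rho> * ((L - L') * e x)"
      using 1 2 pos by (intro add_mono mult_left_mono) auto
    then show ?thesis by (simp add: h_def power2_eq_square algebra_simps)
  qed
  have hn: "0 \<le> h x" for x using qh[of x] quad_nonneg[of "d x" "e x"] by linarith
  have hi: "integrable lebesgue h" unfolding h_def[abs_def] d_def e_def using r(3,4) s(3,4) by simp
  have "(LINT x|lebesgue. h x) = 0" unfolding h_def d_def e_def using r(3-6) s(3-6) by simp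
  then have "AE x in lebesgue. h x = 0"
    using integral_nonneg_eq_0_iff_AE[OF hi] hn by simp
  then have de: "AE x in lebesgue. d x = 0 \<and> e x = 0"
  proof eventually_elim
    case (elim x)
    then show ?case using quad_zero[of "d x" "e x"] qh[of x] by simp
  qed
  show "eq_ae u f" unfolding eq_ae_def using de r(1) s(1)
    by eventually_elim (simp add: d_def)
  show "eq_ae v g" unfolding eq_ae_def using de r(2) s(2)
    by eventually_elim (simp add: e_def)
qed

text \<open>The factors \<sigma> and \<rho> symmetrise the interaction: the partial derivatives in s
  and t are \<sigma> times the first and \<rho> times the second potential.\<close>

definition "energy_density s t x = \<sigma> * s\<^sup>2 / 2 + \<rho> * \<sigma> * s * t + \<rho> * t\<^sup>2 / 2 + \<sigma> * A * x\<^sup>2 * s / 2 + \<rho> * B * x\<^sup>2 * t / 2"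

text \<open>Convexity of the energy: the first variation at a stationary profile is controlled by its two
  potentials, of which the second takes different constant values on the two half lines.\<close>

lemma energy_gap:
  assumes g: "half_profile a b c" "half_profile a1 b1 c1" "0 < b" "hu a b 0 = hu a1 b1 0" "hv a b c 0 = hv a1 b1 c1 0"
    and M: "M = (p * (b ^ 3 + b1 ^ 3) + \<rho> * q * (a ^ 3 + a1 ^ 3)) / 3"
    and N: "N = (B * (c ^ 3 + c1 ^ 3) - \<sigma> * p * (b ^ 3 + b1 ^ 3) - q * (a ^ 3 + a1 ^ 3)) / 3"
    and g': "half_profile a' b' c'" "half_profile a1' b1' c1'" "hu a' b' 0 = hu a1' b1' 0" "hv a' b' c' 0 = hv a1' b1' c1' 0"
    and M': "M = (p * (b' ^ 3 + b1' ^ 3) + \<rho> * q * (a' ^ 3 + a1' ^ 3)) / 3"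
    and N': "N = (B * (c' ^ 3 + c1' ^ 3) - \<sigma> * p * (b' ^ 3 + b1' ^ 3) - q * (a' ^ 3 + a1' ^ 3)) / 3"
    and q: "q \<le> 0" and M0: "0 < M"
  shows "\<rho> * (B * (c\<^sup>2 - c1\<^sup>2) / 2) * ((B * c' ^ 3 - \<sigma> * p * b' ^ 3 - q * a' ^ 3) / 3 - (B * c ^ 3 - \<sigma> * p * b ^ 3 - q * a ^ 3) / 3)
    \<le> (LINT x|lebesgue. energy_density (glue (hu a' b') (hu a1' b1') x) (glue (hv a' b' c') (hv a1' b1' c1') x) x)
    - (LINT x|lebesgue. energy_density (glue (hu a b) (hu a1 b1) x) (glue (hv a b c) (hv a1 b1 c1) x) x)"
proof -
  have abc: "0 \<le> a" "0 \<le> b" "0 \<le> c" "0 \<le> a1" "0 \<le> b1" "0 \<le> c1" "a \<le> c" "b \<le> c" "a1 \<le> c1" "b1 \<le> c1"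
    using g by (auto simp: half_profile_def)
  have abc': "0 \<le> a'" "0 \<le> b'" "0 \<le> c'" "0 \<le> a1'" "0 \<le> b1'" "0 \<le> c1'" "a' \<le> c'" "b' \<le> c'" "a1' \<le> c1'" "b1' \<le> c1'"
    using g' by (auto simp: half_profile_def)
  have p0: "0 \<le> p" using g(1) by (simp add: half_profile_def)
  define U V U' V' where "U = glue (hu a b) (hu a1 b1)" and "V = glue (hv a b c) (hv a1 b1 c1)"
    and "U' = glue (hu a' b') (hu a1' b1')" and "V' = glue (hv a' b' c') (hv a1' b1' c1')"
  have cont: "continuous_on UNIV U" "continuous_on UNIV V" "continuous_on UNIV U'" "continuous_on UNIV V'"
    unfolding U_def V_def U'_def V'_def hu_def[abs_def] hv_def[abs_def]
    by (rule continuous_on_glue; use g(4,5) g'(3,4) in \<open>auto intro!: continuous_intros continuous_on_bump simp: hu_def hv_def\<close>)+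
  define k where "k = max (max c c1) (max c' c1')"
  have z: "U x = 0" "V x = 0" "U' x = 0" "V' x = 0" if "k < \<bar>x\<bar>" for x
    using that abc abc' by (auto simp: U_def V_def U'_def V'_def glue_def hu_def hv_def k_def bump_eq_0)
  have ie: "integrable lebesgue (\<lambda>x. energy_density (U x) (V x) x)" "integrable lebesgue (\<lambda>x. energy_density (U' x) (V' x) x)"
    by (rule integrable_continuous_compact_support[where k=k];
        use z cont in \<open>auto simp: energy_density_def intro!: continuous_intros\<close>)+
  have iU: "integrable lebesgue U" "integrable lebesgue U'"
    by (rule integrable_continuous_compact_support[where k=k]; use z cont in auto)+
  define K where "K = U 0 + \<rho> * V 0"
  \<comment> \<open>The inequality for the first potential is not recomputed: the glued profile is a
    weak solution, so \<open>potential_u_ge\<close> applies to its continuous representative, which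
    is the profile itself.\<close>
  have w: "weak_sol \<rho> \<sigma> A B M N U V" unfolding U_def V_def by (rule profile_weak_sol) fact+
  obtain u v where r: "AE x in lebesgue. U x = u x" "AE x in lebesgue. V x = v x"
    "continuous_on UNIV u" "continuous_on UNIV v" "\<And>x. 0 \<le> u x" "\<And>x. 0 \<le> v x"
    "half_sol \<rho> \<sigma> A B u v" "half_sol \<rho> \<sigma> A B (\<lambda>x. u (- x)) (\<lambda>x. v (- x))"
    "integrable lebesgue u" "integrable lebesgue v"
    "(LINT x|lebesgue. u x) = M" "(LINT x|lebesgue. v x) = N"
    using weak_sol_continuous[OF w] by blast
  have uv: "U = u" "V = v" using AE_eq_continuous_imp_eq r(1-4) cont by blast+
  have u0: "0 < u 0" using weak_sol_pos_at_0[OF p0 M0 r(7,8,5,11)] .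
  have K1: "K \<le> U x + \<rho> * V x + A * x\<^sup>2 / 2" for x
    using potential_u_ge(1)[OF r(7) p0 u0, of x] potential_u_ge(1)[OF r(8) p0, of "-x"] u0 uv
    by (cases "0 \<le> x") (auto simp: K_def)
  have K2: "U x + \<rho> * V x + A * x\<^sup>2 / 2 = K" if "0 < U x" for x
    using potential_u_ge(2)[OF r(7) p0 u0, of x] potential_u_ge(2)[OF r(8) p0, of "-x"] u0 uv that
    by (cases "0 \<le> x") (auto simp: K_def)
  define L where "L x = (if 0 \<le> x then B * c\<^sup>2 / 2 else B * c1\<^sup>2 / 2)" for x :: real
  have L1: "L x \<le> \<sigma> * U x + V x + B * x\<^sup>2 / 2" for x
    using half_profile_potential_v_ge(1)[OF g(1) q] half_profile_potential_v_ge(1)[OF g(2) q]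
    by (auto simp: L_def U_def V_def glue_def)
  have L2: "\<sigma> * U x + V x + B * x\<^sup>2 / 2 = L x" if "0 < V x" for x
    using half_profile_potential_v_ge(2)[OF g(1) q, of x] half_profile_potential_v_ge(2)[OF g(2) q, of x] that
    by (auto simp: L_def U_def V_def glue_def split: if_splits)
  have nn: "0 \<le> U x" "0 \<le> V x" "0 \<le> U' x" "0 \<le> V' x" for x
    using half_profile_nonneg g(1,2) g'(1,2) by (auto simp: U_def V_def U'_def V'_def glue_def)
  have compl: "k * (t - s) \<le> P * (t - s)" if "0 \<le> s" "0 \<le> t" "k \<le> P" "0 < s \<Longrightarrow> P = k" for s t P k :: real
    using that by (cases "s = 0") (auto intro!: mult_right_mono)
  \<comment> \<open>The first variation with both potentials replaced by their constants. The energy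
    is quadratic, so the true first variation plus half the quadratic form of the differences is the
    exact energy difference.\<close>
  define F where "F x = \<sigma> * K * (U' x - U x) + \<rho> * (L x * (V' x - V x))" for x
  have F: "F x \<le> energy_density (U' x) (V' x) x - energy_density (U x) (V x) x" for x
  proof -
    have 1: "K * (U' x - U x) \<le> (U x + \<rho> * V x + A * x\<^sup>2 / 2) * (U' x - U x)"
      by (rule compl) (use nn K1 K2 in auto)
    have 2: "L x * (V' x - V x) \<le> (\<sigma> * U x + V x + B * x\<^sup>2 / 2) * (V' x - V x)"
      by (rule compl) (use nn L1 L2 in auto)
    have "F x \<le> \<sigma> * ((U x + \<rho> * V x + A * x\<^sup>2 / 2) * (U' x - U x)) + \<rho> * ((\<sigma> * U x + V x + B * x\<^sup>2 / 2) * (V' x - V x))"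
      unfolding F_def mult.assoc using 1 2 pos by (intro add_mono mult_left_mono) auto
    also have "\<dots> \<le> \<sigma> * ((U x + \<rho> * V x + A * x\<^sup>2 / 2) * (U' x - U x)) + \<rho> * ((\<sigma> * U x + V x + B * x\<^sup>2 / 2) * (V' x - V x))
       + (\<sigma> * (U' x - U x)\<^sup>2 + 2 * (\<rho> * \<sigma> * ((U' x - U x) * (V' x - V x))) + \<rho> * (V' x - V x)\<^sup>2) / 2"
      using quad_nonneg[of "U' x - U x" "V' x - V x"] by simp
    also have "\<dots> = energy_density (U' x) (V' x) x - energy_density (U x) (V x) x"
      by (simp add: energy_density_def field_simps power2_eq_square)
    finally show ?thesis .
  qed
  have Feq: "F = (\<lambda>x. \<sigma> * K * (U' x - U x) + \<rho> * (B * c\<^sup>2 / 2 * (indicator {0..} x * hv a' b' c' x - indicator {0..} x * hv a b c x)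
      + B * c1\<^sup>2 / 2 * (indicator {..<0} x * hv a1' b1' c1' x - indicator {..<0} x * hv a1 b1 c1 x)))"
  proof
    fix x
    show "F x = \<sigma> * K * (U' x - U x) + \<rho> * (B * c\<^sup>2 / 2 * (indicator {0..} x * hv a' b' c' x - indicator {0..} x * hv a b c x)
      + B * c1\<^sup>2 / 2 * (indicator {..<0} x * hv a1' b1' c1' x - indicator {..<0} x * hv a1 b1 c1 x))"
      by (cases "0 \<le> x") (simp_all add: F_def L_def V_def V'_def glue_def)
  qed
  note hvi = integral_hv_half[OF abc(1-3)] integral_hv_half[OF abc(4-6)] integral_hv_half[OF abc'(1-3)] integral_hv_half[OF abc'(4-6)]
  have iF: "integrable lebesgue F" unfolding Feq using iU hvi by simp
  have IU: "(LINT x|lebesgue. U x) = M" "(LINT x|lebesgue. U' x) = M"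
    unfolding U_def U'_def
    by (rule trans[OF integral_glue_hu[OF abc(1,2,4,5)] M[symmetric]],
        rule trans[OF integral_glue_hu[OF abc'(1,2,4,5)] M'[symmetric]])
  have "(LINT x|lebesgue. F x) = \<rho> * (B * c\<^sup>2 / 2 * ((B * c' ^ 3 - \<sigma> * p * b' ^ 3 - q * a' ^ 3) / 3 - (B * c ^ 3 - \<sigma> * p * b ^ 3 - q * a ^ 3) / 3)
      + B * c1\<^sup>2 / 2 * ((B * c1' ^ 3 - \<sigma> * p * b1' ^ 3 - q * a1' ^ 3) / 3 - (B * c1 ^ 3 - \<sigma> * p * b1 ^ 3 - q * a1 ^ 3) / 3))"
    unfolding Feq using iU by (simp add: hvi IU)
  \<comment> \<open>The total mass of v is fixed, so the left half line gains what the right one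
    loses; the term with K has already dropped out because the mass of u is fixed.\<close>
  also have "(B * c1' ^ 3 - \<sigma> * p * b1' ^ 3 - q * a1' ^ 3) / 3 - (B * c1 ^ 3 - \<sigma> * p * b1 ^ 3 - q * a1 ^ 3) / 3
     = - ((B * c' ^ 3 - \<sigma> * p * b' ^ 3 - q * a' ^ 3) / 3 - (B * c ^ 3 - \<sigma> * p * b ^ 3 - q * a ^ 3) / 3)"
    using N N' by (simp add: field_simps)
  finally have IF: "(LINT x|lebesgue. F x) = \<rho> * (B * (c\<^sup>2 - c1\<^sup>2) / 2) * ((B * c' ^ 3 - \<sigma> * p * b' ^ 3 - q * a' ^ 3) / 3 - (B * c ^ 3 - \<sigma> * p * b ^ 3 - q * a ^ 3) / 3)"
    by (simp add: field_simps)
  have "(LINT x|lebesgue. F x) \<le> (LINT x|lebesgue. energy_density (U' x) (V' x) x - energy_density (U x) (V x) x)"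
    by (rule integral_mono) (use iF ie F in auto)
  then show ?thesis using ie IF unfolding U_def V_def U'_def V'_def by simp
qed

end

section \<open>Real analyticity through holomorphic extensions\<close>

text \<open>A real germ with a holomorphic extension. In this form composition, division, roots and
  inversion are inherited from complex analysis, and a power series is extracted only once, at the
  end.\<close>

definition real_holo :: "(real \<Rightarrow> real) \<Rightarrow> real \<Rightarrow> bool" where
  "real_holo f x \<longleftrightarrow> (\<exists>g. g analytic_on {of_real x} \<and>
     eventually (\<lambda>y. g (of_real y) = complex_of_real (f y)) (nhds x))"

lemma real_holo_at:
  assumes "g analytic_on {of_real x}" "eventually (\<lambda>y. g (of_real y) = complex_of_real (f y)) (nhds x)"
  shows "real_holo f x" "g (of_real x) = of_real (f x)"
  using assms eventually_nhds_x_imp_x by (fastforce simp: real_holo_def)+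

lemma eventually_isCont:
  assumes "isCont f x" "eventually P (nhds (f x))"
  shows "eventually (\<lambda>y. P (f y)) (nhds x)"
proof -
  have "filterlim f (nhds (f x)) (nhds x)"
    using assms(1) unfolding isCont_def tendsto_at_iff_tendsto_nhds .
  then show ?thesis using assms(2) by (simp add: filterlim_iff)
qed

lemma real_holo_const: "real_holo (\<lambda>_. c) x"
  by (rule real_holo_at[where g="\<lambda>_. of_real c"]) (auto intro!: analytic_intros)

lemma real_holo_ident: "real_holo (\<lambda>y. y) x"
  by (rule real_holo_at[where g="\<lambda>z. z"]) (auto intro!: analytic_intros)

lemma real_holo_uminus_arg:
  assumes "real_holo f (- x)"
  shows "real_holo (\<lambda>y. f (- y)) x"
proof -
  obtain g where g: "g analytic_on {of_real (- x)}" "eventually (\<lambda>y. g (of_real y) = complex_of_real (f y)) (nhds (- x))"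
    using assms by (auto simp: real_holo_def)
  have "(\<lambda>z. - z) analytic_on {complex_of_real x}" by (intro analytic_intros)
  then have "(g \<circ> (\<lambda>z. - z)) analytic_on {complex_of_real x}"
    by (rule analytic_on_compose) (use g(1) in simp)
  moreover have "eventually (\<lambda>y. g (of_real (- y)) = complex_of_real (f (- y))) (nhds x)"
    by (rule eventually_isCont[where f=uminus]) (use g(2) in auto)
  ultimately show ?thesis
    by (intro real_holo_at(1)[where g="g \<circ> (\<lambda>z. - z)"]) (auto elim!: eventually_mono)
qed

text \<open>The values of F and K at x are handed to \<open>op\<close> so that a condition at that
  point, such as a nonzero denominator, can be checked there.\<close>

lemma real_holo_binop:
  assumes f: "real_holo f x" and k: "real_holo k x"
    and op: "\<And>F K. F analytic_on {complex_of_real x} \<Longrightarrow> K analytic_on {of_real x} \<Longrightarrow>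
        F (of_real x) = of_real (f x) \<Longrightarrow> K (of_real x) = of_real (k x) \<Longrightarrow> (\<lambda>z. opc (F z) (K z)) analytic_on {of_real x}"
    and ev: "\<And>u v. opc (of_real u) (of_real v) = complex_of_real (opr u v)"
  shows "real_holo (\<lambda>y. opr (f y) (k y)) x"
proof -
  obtain F where F: "F analytic_on {of_real x}" "eventually (\<lambda>y. F (of_real y) = complex_of_real (f y)) (nhds x)"
    using f by (auto simp: real_holo_def)
  obtain K where K: "K analytic_on {of_real x}" "eventually (\<lambda>y. K (of_real y) = complex_of_real (k y)) (nhds x)"
    using k by (auto simp: real_holo_def)
  show ?thesis
  proof (rule real_holo_at(1))
    show "(\<lambda>z. opc (F z) (K z)) analytic_on {of_real x}"
      by (rule op) (use F K real_holo_at(2) in blast)+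
    show "eventually (\<lambda>y. opc (F (of_real y)) (K (of_real y)) = of_real (opr (f y) (k y))) (nhds x)"
      using F(2) K(2) by eventually_elim (simp add: ev)
  qed
qed

lemma real_holo_add: "real_holo f x \<Longrightarrow> real_holo k x \<Longrightarrow> real_holo (\<lambda>y. f y + k y) x"
  by (rule real_holo_binop[where opc="(+)"]) (auto intro!: analytic_intros)

lemma real_holo_diff: "real_holo f x \<Longrightarrow> real_holo k x \<Longrightarrow> real_holo (\<lambda>y. f y - k y) x"
  by (rule real_holo_binop[where opc="(-)"]) (auto intro!: analytic_intros)

lemma real_holo_mult: "real_holo f x \<Longrightarrow> real_holo k x \<Longrightarrow> real_holo (\<lambda>y. f y * k y) x"
  by (rule real_holo_binop[where opc="(*)"]) (auto intro!: analytic_intros)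

lemma real_holo_divide: "real_holo f x \<Longrightarrow> real_holo k x \<Longrightarrow> k x \<noteq> 0 \<Longrightarrow> real_holo (\<lambda>y. f y / k y) x"
  by (rule real_holo_binop[where opc="(/)"]) (auto intro!: analytic_intros)

lemma real_holo_uminus: "real_holo f x \<Longrightarrow> real_holo (\<lambda>y. - f y) x"
  using real_holo_diff[OF real_holo_const[of 0]] by simp

lemma real_holo_power: "real_holo f x \<Longrightarrow> real_holo (\<lambda>y. f y ^ n) x"
  by (induction n) (auto intro: real_holo_const real_holo_mult)

lemma real_holo_compose:
  assumes f: "real_holo f x" and k: "real_holo k (f x)" and c: "isCont f x"
  shows "real_holo (\<lambda>y. k (f y)) x"
proof -
  obtain F where F: "F analytic_on {of_real x}" "eventually (\<lambda>y. F (of_real y) = complex_of_real (f y)) (nhds x)"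
    using f by (auto simp: real_holo_def)
  obtain K where K: "K analytic_on {of_real (f x)}" "eventually (\<lambda>y. K (of_real y) = complex_of_real (k y)) (nhds (f x))"
    using k by (auto simp: real_holo_def)
  have Fx: "F (of_real x) = of_real (f x)" by (rule real_holo_at(2)[OF F])
  show ?thesis
  proof (rule real_holo_at(1))
    show "(K \<circ> F) analytic_on {of_real x}"
      by (rule analytic_on_compose[OF F(1)]) (simp add: Fx K(1))
    show "eventually (\<lambda>y. (K \<circ> F) (of_real y) = complex_of_real (k (f y))) (nhds x)"
      using eventually_isCont[OF c K(2)] F(2) by eventually_elim simp
  qed
qed

lemma real_holo_sqrt:
  assumes "0 < x"
  shows "real_holo sqrt x"
proof (rule real_holo_at(1))
  show "csqrt analytic_on {of_real x}"
    using assms by (intro analytic_intros) (auto simp: complex_nonpos_Reals_iff)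
  have "eventually (\<lambda>y. y \<in> {0<..}) (nhds x)"
    by (rule eventually_nhds_in_open) (use assms in auto)
  then show "eventually (\<lambda>y. csqrt (of_real y) = of_real (sqrt y)) (nhds x)"
    by eventually_elim simp
qed

lemma real_holo_root3:
  assumes "0 < x"
  shows "real_holo (root 3) x"
proof (rule real_holo_at(1))
  show "(\<lambda>z. exp (Ln z / 3)) analytic_on {complex_of_real x}"
    using assms by (intro analytic_intros) (auto simp: complex_nonpos_Reals_iff)
  have "eventually (\<lambda>y. y \<in> {0<..}) (nhds x)"
    by (rule eventually_nhds_in_open) (use assms in auto)
  then show "eventually (\<lambda>y. exp (Ln (of_real y) / 3) = complex_of_real (root 3 y)) (nhds x)"
  proof eventually_elim
    case (elim y)
    then have "root 3 y = exp (ln y / 3)" by (simp add: root_powr_inverse powr_def)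
    moreover have "Ln (of_real y) = complex_of_real (ln y)" using elim by (simp add: Ln_of_real)
    ultimately show ?case by (simp flip: exp_of_real)
  qed
qed

lemma real_holo_isCont:
  assumes "real_holo f x"
  shows "isCont f x"
proof -
  obtain F where F: "F analytic_on {of_real x}" "eventually (\<lambda>y. F (of_real y) = complex_of_real (f y)) (nhds x)"
    using assms by (auto simp: real_holo_def)
  have "isCont F (of_real x)" using F(1) analytic_at_imp_isCont by blast
  then have "isCont (\<lambda>y. F (of_real y)) x"
    by (intro isCont_o2[where g=F and f=complex_of_real]) auto
  then have "isCont (\<lambda>y. Re (F (of_real y))) x"
    by (rule continuous_Re)
  moreover have "eventually (\<lambda>y. Re (F (of_real y)) = f y) (nhds x)"
    using F(2) by eventually_elim simp
  ultimately show ?thesis by (metis isCont_cong)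
qed

text \<open>The complex derivative of an extension of \<open>f\<close> restricts to the real derivative, so the complex
  inverse function theorem applies; its inverse takes real values at real points because the real
  inverse exists.\<close>

lemma real_holo_inverse:
  assumes f: "real_holo f (s t)" and d: "(f has_real_derivative D) (at (s t))" "D \<noteq> 0"
    and s: "isCont s t" and inv: "eventually (\<lambda>y. f (s y) = y) (nhds t)"
  shows "real_holo s t"
proof -
  obtain F where F: "F analytic_on {of_real (s t)}" "eventually (\<lambda>y. F (of_real y) = complex_of_real (f y)) (nhds (s t))"
    using f by (auto simp: real_holo_def)
  then obtain e where e: "e > 0" "F holomorphic_on ball (of_real (s t)) e"
    by (auto simp: analytic_on_def)
  have dF: "(F has_field_derivative deriv F (of_real (s t))) (at (of_real (s t)))"
    using e by (intro holomorphic_derivI[of F "ball (of_real (s t)) e"]) auto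
  have "((\<lambda>y. F (of_real y)) has_vector_derivative deriv F (of_real (s t))) (at (s t))"
    using has_vector_derivative_real_field[OF dF] .
  then have "((\<lambda>y. Re (F (of_real y))) has_vector_derivative Re (deriv F (of_real (s t)))) (at (s t))"
    by (rule bounded_linear.has_vector_derivative[OF bounded_linear_Re])
  then have "((\<lambda>y. Re (F (of_real y))) has_real_derivative Re (deriv F (of_real (s t)))) (at (s t))"
    by (simp add: has_real_derivative_iff_has_vector_derivative)
  moreover have "eventually (\<lambda>y. Re (F (of_real y)) = f y) (nhds (s t))"
    using F(2) by eventually_elim simp
  ultimately have "(f has_real_derivative Re (deriv F (of_real (s t)))) (at (s t))"
    by (subst DERIV_cong_ev[symmetric]) auto
  then have "Re (deriv F (of_real (s t))) = D" using d(1) DERIV_unique by blast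
  then have nz: "deriv F (of_real (s t)) \<noteq> 0" using d(2) by auto
  obtain r where r: "r > 0" "ball (complex_of_real (s t)) r \<subseteq> ball (of_real (s t)) e"
     "open (F ` (ball (of_real (s t)) r))" "inj_on F (ball (of_real (s t)) r)"
    by (rule has_complex_derivative_locally_invertible[OF e(2) _ open_ball nz]) (use e(1) in auto)
  have hol: "F holomorphic_on ball (of_real (s t)) r" using e(2) r(2) holomorphic_on_subset by blast
  obtain G where G: "G holomorphic_on (F ` ball (of_real (s t)) r)"
     "\<And>z. z \<in> ball (of_real (s t)) r \<Longrightarrow> G (F z) = z"
    by (rule holomorphic_has_inverse[OF hol open_ball r(4)]) auto
  have Ft: "F (of_real (s t)) = of_real t"
    using real_holo_at(2)[OF F] eventually_nhds_x_imp_x[OF inv] by simp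
  show ?thesis
  proof (rule real_holo_at(1))
    have "of_real t \<in> F ` ball (of_real (s t)) r"
      using Ft r(1) by (metis centre_in_ball imageI)
    then show "G analytic_on {of_real t}"
      using G(1) r(3) by (meson analytic_at)
    have "eventually (\<lambda>y. F (of_real (s y)) = complex_of_real (f (s y))) (nhds t)"
      by (rule eventually_isCont[OF s F(2)])
    moreover have "eventually (\<lambda>y. s y \<in> ball (s t) r) (nhds t)"
    proof -
      have "eventually (\<lambda>y. y \<in> ball (s t) r) (nhds (s t))"
        by (rule eventually_nhds_in_open) (use r in auto)
      then show ?thesis by (rule eventually_isCont[OF s])
    qed
    ultimately show "eventually (\<lambda>y. G (of_real y) = of_real (s y)) (nhds t)"
      using inv
    proof eventually_elim
      case (elim y)
      have "complex_of_real (s y) \<in> ball (of_real (s t)) r"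
        using elim(2) by (simp add: dist_of_real)
      then have "G (F (of_real (s y))) = of_real (s y)" by (rule G(2))
      then show ?case using elim by simp
    qed
  qed
qed

lemma real_holo_power_series:
  assumes "real_holo f x0"
  shows "\<exists>r>0. \<exists>a. \<forall>x. \<bar>x - x0\<bar> < r \<longrightarrow> (\<lambda>n. (x - x0) ^ n *\<^sub>R a n) sums f x"
proof -
  obtain F where F: "F analytic_on {of_real x0}" "eventually (\<lambda>y. F (of_real y) = complex_of_real (f y)) (nhds x0)"
    using assms by (auto simp: real_holo_def)
  obtain e where e: "e > 0" "F holomorphic_on ball (of_real x0) e"
    using F(1) by (auto simp: analytic_on_def)
  obtain d where d: "d > 0" "\<And>y. dist y x0 < d \<Longrightarrow> F (of_real y) = of_real (f y)"
    using F(2) by (auto simp: eventually_nhds_metric)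
  \<comment> \<open>Real parts of the complex Taylor coefficients: x - x0 and f x are real, so the
    real part of the expansion of F is an expansion of f.\<close>
  define a where "a n = Re ((deriv ^^ n) F (of_real x0) / fact n)" for n
  have "(\<lambda>n. (x - x0) ^ n *\<^sub>R a n) sums f x" if "\<bar>x - x0\<bar> < min e d" for x
  proof -
    have "complex_of_real x \<in> ball (of_real x0) e"
      using that by (simp add: dist_of_real dist_real_def abs_minus_commute)
    then have "(\<lambda>n. (deriv ^^ n) F (of_real x0) / fact n * (of_real x - of_real x0) ^ n) sums F (of_real x)"
      by (rule holomorphic_power_series[OF e(2)])
    then have "(\<lambda>n. Re ((deriv ^^ n) F (of_real x0) / fact n * of_real ((x - x0) ^ n))) sums Re (F (of_real x))"
      by (intro sums_Re) simp
    moreover have "Re (w * of_real t) = t *\<^sub>R Re w" for w t by simp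
    ultimately have "(\<lambda>n. (x - x0) ^ n *\<^sub>R a n) sums Re (F (of_real x))"
      unfolding a_def by (simp only:)
    then show ?thesis using d(2)[of x] that by (simp add: dist_real_def)
  qed
  then show ?thesis using e d by (intro exI[of _ "min e d"]) auto
qed

lemma real_analytic_onI:
  assumes "\<And>x. x \<in> S \<Longrightarrow> real_holo f x"
  shows "f real_analytic_on S"
  using real_holo_power_series assms unfolding real_analytic_on_def by blast

lemma real_analytic_on_Pair:
  assumes "f real_analytic_on S" "g real_analytic_on S"
  shows "(\<lambda>x. (f x, g x)) real_analytic_on S"
  unfolding real_analytic_on_def
proof
  fix x0 assume x: "x0 \<in> S"
  obtain r a where r: "r > 0" "\<And>x. \<bar>x - x0\<bar> < r \<Longrightarrow> (\<lambda>n. (x - x0) ^ n *\<^sub>R a n) sums f x"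
    using assms(1) x unfolding real_analytic_on_def by meson
  obtain r' b where r': "r' > 0" "\<And>x. \<bar>x - x0\<bar> < r' \<Longrightarrow> (\<lambda>n. (x - x0) ^ n *\<^sub>R b n) sums g x"
    using assms(2) x unfolding real_analytic_on_def by meson
  have "(\<lambda>n. (x - x0) ^ n *\<^sub>R (a n, b n)) sums (f x, g x)" if "\<bar>x - x0\<bar> < min r r'" for x
  proof -
    have "(\<lambda>n. \<Sum>i<n. (x - x0) ^ i *\<^sub>R (a i, b i)) = (\<lambda>n. (\<Sum>i<n. (x - x0) ^ i *\<^sub>R a i, \<Sum>i<n. (x - x0) ^ i *\<^sub>R b i))"
      by (auto simp: fun_eq_iff prod_eq_iff fst_sum snd_sum)
    then show ?thesis using r(2)[of x] r'(2)[of x] that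
      unfolding sums_def by (auto intro!: tendsto_Pair)
  qed
  then show "\<exists>r>0. \<exists>a. \<forall>x. \<bar>x - x0\<bar> < r \<longrightarrow> (\<lambda>n. (x - x0) ^ n *\<^sub>R a n) sums (f x, g x)"
    using r(1) r'(1) by (intro exI[of _ "min r r'"] conjI exI[of _ "\<lambda>n. (a n, b n)"]) auto
qed

text \<open>A continuous function that is zero almost everywhere on an open set is zero on it,
  because a nonempty open set is not null; so the union in \<open>supp\<close> is the interior of
  the zero set.\<close>

lemma supp_continuous:
  assumes w: "continuous_on UNIV w"
  shows "supp w = closure {x. w x \<noteq> 0}"
proof -
  have o: "open {x. w x \<noteq> 0}" using w by (intro open_Collect_neq continuous_intros)
  have iff: "(AE x in lebesgue. x \<in> U \<longrightarrow> w x = 0) \<longleftrightarrow> U \<inter> {x. w x \<noteq> 0} = {}" if "open U" for U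
  proof
    assume "AE x in lebesgue. x \<in> U \<longrightarrow> w x = 0"
    then have "negligible (U \<inter> {x. w x \<noteq> 0})"
      by (auto simp: eventually_ae_filter negligible_iff_null_sets Int_def conj_commute intro: null_sets_completion_subset)
    moreover have "open (U \<inter> {x. w x \<noteq> 0})" using that o by blast
    ultimately show "U \<inter> {x. w x \<noteq> 0} = {}" using open_not_negligible by blast
  qed (auto intro!: AE_I2)
  have "\<Union>{U. open U \<and> (AE x in lebesgue. x \<in> U \<longrightarrow> w x = 0)} = \<Union>{U. open U \<and> U \<inter> {x. w x \<noteq> 0} = {}}"
    using iff by (intro arg_cong[where f=Union]) auto
  also have "\<dots> = - closure {x. w x \<noteq> 0}"
  proof -
    have "interior (- {x. w x \<noteq> 0}) = \<Union>{U. open U \<and> U \<inter> {x. w x \<noteq> 0} = {}}"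
      unfolding interior_def by (rule arg_cong[where f=Union]) auto
    then show ?thesis using closure_interior[of "{x. w x \<noteq> 0}"] by simp
  qed
  finally show ?thesis by (simp add: supp_def)
qed

section \<open>The reduced mass equation\<close>

lemma (in cross) hu_pos_iff:
  assumes g: "half_profile a b c" and x: "0 \<le> x"
  shows "0 < hu a b x \<longleftrightarrow> x < b"
proof
  assume "x < b"
  have ab: "0 \<le> a" "a \<le> b" "0 < p" using g by (auto simp: half_profile_def)
  show "0 < hu a b x"
  proof (cases "x < a")
    case True
    have "A * x\<^sup>2 < A * a\<^sup>2" using pos x True by (simp add: power_strict_mono)
    moreover have "A * a\<^sup>2 = p * a\<^sup>2 + \<rho> * q * a\<^sup>2" using A_eq by algebra
    moreover have "p * a\<^sup>2 \<le> p * b\<^sup>2" using ab by (simp add: power_mono)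
    ultimately show ?thesis using half_profile_values(1)[OF g x] True by simp
  next
    case False
    have "0 < p * (b\<^sup>2 - x\<^sup>2)" using ab x \<open>x < b\<close> by (simp add: power_strict_mono)
    then show ?thesis using half_profile_values(2)[OF g x] False \<open>x < b\<close> by simp
  qed
next
  assume "0 < hu a b x"
  then show "x < b" using half_profile_values(3)[OF g x] by (rule_tac ccontr) simp
qed

lemma (in cross) hv_pos_iff:
  assumes g: "half_profile a b c" and q: "q < 0" and z: "hv a b c 0 = 0" and x: "0 \<le> x"
  shows "0 < hv a b c x \<longleftrightarrow> a < x \<and> x < c"
proof -
  have abc: "0 \<le> a" "a \<le> b" "b \<le> c" "0 < p" using g by (auto simp: half_profile_def)
  then have "0 \<le> b" "0 \<le> c" by linarith+
  then have eq: "B * c\<^sup>2 = \<sigma> * p * b\<^sup>2 + q * a\<^sup>2" using z profile_at_0(2)[OF abc(1)] by simp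
  note vals = half_profile_values[OF g x]
  consider "x \<le> a" | "a < x" "x \<le> b" | "b < x" "x < c" "a < x" | "c \<le> x" "a < x" using abc by linarith
  then show ?thesis
  proof cases
    case 1
    then show ?thesis using vals(4) z x by (cases "a = 0") auto
  next
    case 2
    then have "2 * hv a b c x = (- q) * (x\<^sup>2 - a\<^sup>2)" using vals(5) eq by (simp add: algebra_simps)
    moreover have "0 < (- q) * (x\<^sup>2 - a\<^sup>2)" using q 2 abc by (intro mult_pos_pos) (auto simp: power_strict_mono)
    ultimately have h: "0 < hv a b c x" by linarith
    moreover have "x < c" using h vals(7) by (rule_tac ccontr) simp
    ultimately show ?thesis using 2 by simp
  next
    case 3
    have "0 < B * (c\<^sup>2 - x\<^sup>2)" using pos x 3 by (simp add: power_strict_mono)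
    then show ?thesis using vals(6) 3 by simp
  qed (use vals(7) in simp)
qed

lemma (in cross) connected_supp_hu:
  assumes g: "half_profile a b c" "half_profile a1 b1 c1" and u0: "hu a b 0 = hu a1 b1 0" and b: "0 < b" "0 < b1"
  shows "connected (supp (glue (hu a b) (hu a1 b1)))"
proof -
  have c: "continuous_on UNIV (glue (hu a b) (hu a1 b1))"
    unfolding hu_def[abs_def]
    by (rule continuous_on_glue) (use u0 in \<open>auto intro!: continuous_intros continuous_on_bump simp: hu_def\<close>)
  have iff: "glue (hu a b) (hu a1 b1) x \<noteq> 0 \<longleftrightarrow> x \<in> {-b1<..<b}" for x
  proof (cases "0 \<le> x")
    case True
    then show ?thesis using hu_pos_iff[OF g(1) True] half_profile_nonneg(1)[OF g(1), of x] b
      by (auto simp: glue_def)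
  next
    case False
    then show ?thesis using hu_pos_iff[OF g(2), of "-x"] half_profile_nonneg(1)[OF g(2), of x] b
      by (auto simp: glue_def hu_even)
  qed
  have "{x. glue (hu a b) (hu a1 b1) x \<noteq> 0} = {-b1<..<b}"
    unfolding iff by auto
  then show ?thesis using supp_continuous[OF c] by (simp add: connected_imp_connected_closure)
qed

section \<open>Scaled radii and masses as functions of the scaled inner radius\<close>

locale cross_high = cross +
  fixes M N :: real
  assumes MN: "0 < M" "0 < N" and q_neg: "q < 0"
begin

lemma p_pos: "0 < p" using q_neg p_pos_if_q_nonpos by simp

text \<open>Radii normalised by u 0 = 1/2: \<open>bb s\<close> solves p b^2 + \<rho> q s^2 = 1, and
  \<open>cc s\<close> solves the matching condition B c^2 = \<sigma> p b^2 + q s^2. At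
  \<open>smax\<close> all three radii coincide, so v has no arch left; \<open>phi\<close> and
  \<open>psi\<close> are three times the masses of u and v on the half line.\<close>

definition "smax = 1 / sqrt A"
definition "bb s = sqrt ((1 - \<rho> * q * s\<^sup>2) / p)"
definition "cc s = sqrt ((\<sigma> + th * q * s\<^sup>2) / B)"
definition "phi s = p * bb s ^ 3 + \<rho> * q * s ^ 3"
definition "psi s = B * cc s ^ 3 - \<sigma> * p * bb s ^ 3 - q * s ^ 3"
text \<open>The mass equations are h^3 (phi s + phi s1) = 3 M and h^3 (psi s + psi s1) = 3 N; this
  combination eliminates h.\<close>

definition "chi s = N * phi s - M * psi s"

lemma smax: "0 < smax" "A * smax\<^sup>2 = 1"
  using pos by (simp_all add: smax_def power_divide)

lemma A_sq_le: "0 \<le> s \<Longrightarrow> s \<le> smax \<Longrightarrow> A * s\<^sup>2 \<le> 1"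
  using power_mono[of s smax 2] smax pos by (metis mult_left_mono less_imp_le)

lemma A_sq_less: "0 \<le> s \<Longrightarrow> s < smax \<Longrightarrow> A * s\<^sup>2 < 1"
  using power_strict_mono[of s smax 2] smax pos by (metis mult_strict_left_mono zero_less_numeral)

lemma rq_sq: "0 < 1 - \<rho> * q * s\<^sup>2"
proof -
  have "\<rho> * q * s\<^sup>2 \<le> 0" using pos q_neg by (simp add: mult_nonneg_nonpos mult_nonpos_nonneg)
  then show ?thesis by simp
qed

lemma bb: "0 < bb s" "p * (bb s)\<^sup>2 = 1 - \<rho> * q * s\<^sup>2"
  using rq_sq[of s] p_pos by (simp_all add: bb_def)

lemma le_bb: "0 \<le> s \<Longrightarrow> s \<le> smax \<Longrightarrow> s \<le> bb s"
proof -
  assume s: "0 \<le> s" "s \<le> smax"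
  have "p * s\<^sup>2 + \<rho> * q * s\<^sup>2 = A * s\<^sup>2" using A_eq by algebra
  then have "p * s\<^sup>2 \<le> p * (bb s)\<^sup>2" using A_sq_le[OF s] bb(2)[of s] by simp
  then have "s\<^sup>2 \<le> (bb s)\<^sup>2" using p_pos by simp
  then show ?thesis by (rule power2_le_imp_le) (use bb(1)[of s] in simp)
qed

lemma less_bb: "0 \<le> s \<Longrightarrow> s < smax \<Longrightarrow> s < bb s"
proof -
  assume s: "0 \<le> s" "s < smax"
  have "p * s\<^sup>2 + \<rho> * q * s\<^sup>2 = A * s\<^sup>2" using A_eq by algebra
  then have "p * s\<^sup>2 < p * (bb s)\<^sup>2" using A_sq_less[OF s] bb(2)[of s] by simp
  then have "s\<^sup>2 < (bb s)\<^sup>2" using p_pos by simp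
  then show ?thesis by (rule power2_less_imp_less) (use bb(1)[of s] in simp)
qed

lemma cc_arg: "\<sigma> + th * q * s\<^sup>2 = B * (bb s)\<^sup>2 + q * (s\<^sup>2 - (bb s)\<^sup>2)"
  using bb(2)[of s] B_eq th_def by algebra

lemma cc_arg_pos:
  assumes "0 \<le> s" "s \<le> smax"
  shows "B * (bb s)\<^sup>2 \<le> \<sigma> + th * q * s\<^sup>2" "0 < \<sigma> + th * q * s\<^sup>2"
proof -
  have "s\<^sup>2 \<le> (bb s)\<^sup>2" using le_bb[OF assms] assms by (simp add: power_mono)
  then have "0 \<le> q * (s\<^sup>2 - (bb s)\<^sup>2)" using q_neg by (intro mult_nonpos_nonpos) auto
  then show 1: "B * (bb s)\<^sup>2 \<le> \<sigma> + th * q * s\<^sup>2" unfolding cc_arg by simp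
  have "0 < B * (bb s)\<^sup>2" using pos bb(1)[of s] by simp
  with 1 show "0 < \<sigma> + th * q * s\<^sup>2" by linarith
qed

lemma cc:
  assumes "0 \<le> s" "s \<le> smax"
  shows "0 < cc s" "B * (cc s)\<^sup>2 = \<sigma> + th * q * s\<^sup>2" "bb s \<le> cc s"
proof -
  show 1: "0 < cc s" "B * (cc s)\<^sup>2 = \<sigma> + th * q * s\<^sup>2"
    using cc_arg_pos(2)[OF assms] pos by (simp_all add: cc_def)
  have "B * (bb s)\<^sup>2 \<le> B * (cc s)\<^sup>2" using cc_arg_pos(1)[OF assms] 1(2) by simp
  then have "(bb s)\<^sup>2 \<le> (cc s)\<^sup>2" using pos by simp
  then show "bb s \<le> cc s" by (rule power2_le_imp_le) (use 1(1) in simp)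
qed

lemma at_smax: "bb smax = smax" "cc smax = smax"
proof -
  have "p * (bb smax)\<^sup>2 = p * smax\<^sup>2" using bb(2)[of smax] smax(2) A_eq by algebra
  then have "(bb smax)\<^sup>2 = smax\<^sup>2" using p_pos by simp
  then show 1: "bb smax = smax" by (rule power2_eq_imp_eq) (use bb(1)[of smax] smax(1) in simp_all)
  have "B * (cc smax)\<^sup>2 = B * smax\<^sup>2" using cc(2)[of smax] cc_arg[of smax] 1 smax(1) by simp
  then have "(cc smax)\<^sup>2 = smax\<^sup>2" using pos by simp
  then show "cc smax = smax" by (rule power2_eq_imp_eq) (use cc(1)[of smax] smax(1) in simp_all)
qed

lemma DERIV_bb: "(bb has_real_derivative - \<rho> * q * s / (p * bb s)) (at s)"
proof -
  have "((\<lambda>s. sqrt ((1 - \<rho> * q * s\<^sup>2) / p)) has_real_derivative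
     (inverse (sqrt ((1 - \<rho> * q * s\<^sup>2) / p)) / 2) * (- (2 * \<rho> * q * s) / p)) (at s)"
    by (rule DERIV_chain2[where f=sqrt], rule DERIV_real_sqrt)
      (use rq_sq[of s] p_pos in \<open>auto intro!: derivative_eq_intros simp: field_simps\<close>)
  then show ?thesis unfolding bb_def[abs_def] by (rule DERIV_cong) (simp add: field_simps)
qed

lemma DERIV_cc:
  assumes "0 \<le> s" "s \<le> smax"
  shows "(cc has_real_derivative th * q * s / (B * cc s)) (at s)"
proof -
  have "((\<lambda>s. sqrt ((\<sigma> + th * q * s\<^sup>2) / B)) has_real_derivative
     (inverse (sqrt ((\<sigma> + th * q * s\<^sup>2) / B)) / 2) * (2 * th * q * s / B)) (at s)"
    by (rule DERIV_chain2[where f=sqrt], rule DERIV_real_sqrt)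
      (use cc_arg_pos(2)[OF assms] pos in \<open>auto intro!: derivative_eq_intros simp: field_simps\<close>)
  then show ?thesis unfolding cc_def[abs_def] by (rule DERIV_cong) (simp add: field_simps)
qed

lemma DERIV_bb3: "((\<lambda>s. p * bb s ^ 3) has_real_derivative - 3 * \<rho> * q * s * bb s) (at s)"
proof -
  have "((\<lambda>s. p * bb s ^ 3) has_real_derivative p * (3 * bb s ^ 2 * (- \<rho> * q * s / (p * bb s)))) (at s)"
    by (auto intro!: derivative_eq_intros DERIV_bb)
  then show ?thesis by (rule DERIV_cong) (use bb(1)[of s] p_pos in \<open>simp add: power2_eq_square\<close>)
qed

lemma DERIV_cc3:
  assumes "0 \<le> s" "s \<le> smax"
  shows "((\<lambda>s. B * cc s ^ 3) has_real_derivative 3 * th * q * s * cc s) (at s)"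
proof -
  have "((\<lambda>s. B * cc s ^ 3) has_real_derivative B * (3 * cc s ^ 2 * (th * q * s / (B * cc s)))) (at s)"
    by (auto intro!: derivative_eq_intros DERIV_cc assms)
  then show ?thesis by (rule DERIV_cong) (use cc(1)[OF assms] pos in \<open>simp add: power2_eq_square\<close>)
qed

lemma DERIV_phi: "(phi has_real_derivative - 3 * \<rho> * q * s * (bb s - s)) (at s)"
  unfolding phi_def[abs_def]
  by (rule DERIV_cong, rule DERIV_add, rule DERIV_bb3, rule DERIV_cmult, rule DERIV_power, rule DERIV_ident)
    (simp add: algebra_simps power2_eq_square)

lemma DERIV_psi:
  assumes "0 \<le> s" "s \<le> smax"
  shows "(psi has_real_derivative 3 * q * s * (th * cc s + \<sigma> * \<rho> * bb s - s)) (at s)"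
proof -
  have "((\<lambda>s. B * cc s ^ 3 - \<sigma> * (p * bb s ^ 3) - q * s ^ 3) has_real_derivative
     3 * th * q * s * cc s - \<sigma> * (- 3 * \<rho> * q * s * bb s) - q * (real 3 * (1 * s ^ (3 - Suc 0)))) (at s)"
    by (intro DERIV_diff DERIV_cmult DERIV_bb3 DERIV_cc3 DERIV_power DERIV_ident assms)
  then show ?thesis
    unfolding psi_def[abs_def] mult.assoc[of \<sigma> p] by (rule DERIV_cong) (simp add: algebra_simps power2_eq_square)
qed

text \<open>At \<open>smax\<close> the radii coincide and both brackets vanish, while at 0 the
  common factor s of the derivatives of \<open>phi\<close> and \<open>psi\<close> vanishes. Signs
  are therefore strict only inside, which still gives strict monotonicity on the closed interval but
  a nonzero derivative only on the open one.\<close>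

lemma slope_pos:
  assumes "0 < s" "s < smax"
  shows "0 < bb s - s" "0 < th * cc s + \<sigma> * \<rho> * bb s - s"
proof -
  show "0 < bb s - s" using less_bb[of s] assms by simp
  have "s < bb s" "s < cc s" using less_bb[of s] cc(3)[of s] assms by simp_all
  then have "th * s < th * cc s" "\<sigma> * \<rho> * s < \<sigma> * \<rho> * bb s" using th_pos pos by simp_all
  moreover have "th * s + \<sigma> * \<rho> * s = s" by (simp add: th_def algebra_simps)
  ultimately show "0 < th * cc s + \<sigma> * \<rho> * bb s - s" by linarith
qed

lemma continuous_on_bb: "continuous_on S bb" and continuous_on_cc: "continuous_on S cc"
  unfolding bb_def[abs_def] cc_def[abs_def] using p_pos pos by (auto intro!: continuous_intros)

lemma continuous_on_phi: "continuous_on S phi" and continuous_on_psi: "continuous_on S psi"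
  and continuous_on_chi: "continuous_on S chi"
  unfolding chi_def[abs_def] phi_def[abs_def] psi_def[abs_def]
  by (auto intro!: continuous_intros continuous_on_bb continuous_on_cc)

lemma phi_less: "0 \<le> s \<Longrightarrow> s < t \<Longrightarrow> t \<le> smax \<Longrightarrow> phi s < phi t"
proof (rule DERIV_pos_imp_increasing_open[where f=phi and a=s and b=t])
  fix x assume "0 \<le> s" "t \<le> smax" "s < x" "x < t"
  then have x: "0 < x" "x < smax" by auto
  have "0 < - (3 * \<rho> * q * x)" using pos q_neg x by (simp add: mult_pos_neg mult_neg_pos)
  then have "0 < - (3 * \<rho> * q * x) * (bb x - x)" using slope_pos(1)[OF x] by (rule mult_pos_pos)
  then show "\<exists>y. (phi has_real_derivative y) (at x) \<and> 0 < y" using DERIV_phi[of x] by (auto simp: mult.assoc)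
qed (auto intro: continuous_on_phi)

lemma psi_less: "0 \<le> s \<Longrightarrow> s < t \<Longrightarrow> t \<le> smax \<Longrightarrow> psi t < psi s"
proof (rule DERIV_neg_imp_decreasing_open[where f=psi and a=s and b=t])
  fix x assume "0 \<le> s" "t \<le> smax" "s < x" "x < t"
  then have x: "0 < x" "x < smax" by auto
  have "3 * q * x < 0" using q_neg x by (simp add: mult_neg_pos)
  then have "3 * q * x * (th * cc x + \<sigma> * \<rho> * bb x - x) < 0"
    using slope_pos(2)[OF x] by (rule mult_neg_pos)
  then show "\<exists>y. (psi has_real_derivative y) (at x) \<and> y < 0" using DERIV_psi[of x] x by auto
qed (auto intro: continuous_on_psi)

lemma chi_less: "0 \<le> s \<Longrightarrow> s < t \<Longrightarrow> t \<le> smax \<Longrightarrow> chi s < chi t"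
  unfolding chi_def using phi_less[of s t] psi_less[of s t] MN by (smt (verit) mult_strict_left_mono)

lemma chi_less_iff: "s \<in> {0..smax} \<Longrightarrow> t \<in> {0..smax} \<Longrightarrow> chi s < chi t \<longleftrightarrow> s < t"
  using chi_less[of s t] chi_less[of t s] by (cases s t rule: linorder_cases) auto

lemma chi_le_iff: "s \<in> {0..smax} \<Longrightarrow> t \<in> {0..smax} \<Longrightarrow> chi s \<le> chi t \<longleftrightarrow> s \<le> t"
  using chi_less_iff[of t s] by (auto simp: not_less[symmetric])

lemma DERIV_chi_nonzero:
  assumes "0 < s" "s < smax"
  shows "\<exists>D. (chi has_real_derivative D) (at s) \<and> D \<noteq> 0"
proof -
  have "0 < - 3 * \<rho> * q * s" using pos q_neg assms by (simp add: mult_pos_neg mult_neg_pos)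
  then have "0 < - 3 * \<rho> * q * s * (bb s - s)" using slope_pos(1)[OF assms] by (rule mult_pos_pos)
  moreover have "3 * q * s < 0" using q_neg assms by (simp add: mult_neg_pos)
  then have "3 * q * s * (th * cc s + \<sigma> * \<rho> * bb s - s) < 0"
    using slope_pos(2)[OF assms] by (rule mult_neg_pos)
  ultimately have "0 < N * (- 3 * \<rho> * q * s * (bb s - s)) - M * (3 * q * s * (th * cc s + \<sigma> * \<rho> * bb s - s))"
    using MN by (smt (verit) mult_pos_pos mult_pos_neg)
  moreover have "(chi has_real_derivative N * (- 3 * \<rho> * q * s * (bb s - s)) - M * (3 * q * s * (th * cc s + \<sigma> * \<rho> * bb s - s))) (at s)"
    unfolding chi_def[abs_def] using assms
    by (intro DERIV_diff DERIV_cmult DERIV_phi DERIV_psi) auto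
  ultimately show ?thesis by (metis less_irrefl)
qed

lemma phi_0: "phi 0 = 1 / sqrt p" and psi_0: "psi 0 = \<sigma> * sqrt (\<sigma> / B) - \<sigma> / sqrt p"
proof -
  have 1: "p * bb 0 ^ 3 = 1 / sqrt p"
  proof -
    have "p * bb 0 ^ 3 = (p * (bb 0)\<^sup>2) * bb 0" by (simp add: power2_eq_square power3_eq_cube)
    also have "\<dots> = bb 0" using bb(2)[of 0] by simp
    finally show ?thesis by (simp add: bb_def real_sqrt_divide)
  qed
  have 2: "B * cc 0 ^ 3 = \<sigma> * sqrt (\<sigma> / B)"
  proof -
    have "B * cc 0 ^ 3 = (B * (cc 0)\<^sup>2) * cc 0" by (simp add: power2_eq_square power3_eq_cube)
    also have "\<dots> = \<sigma> * cc 0" using cc(2)[of 0] smax by simp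
    finally show ?thesis by (simp add: cc_def)
  qed
  show "phi 0 = 1 / sqrt p" using 1 by (simp add: phi_def)
  have "psi 0 = B * cc 0 ^ 3 - \<sigma> * (p * bb 0 ^ 3)" by (simp add: psi_def)
  then show "psi 0 = \<sigma> * sqrt (\<sigma> / B) - \<sigma> / sqrt p" using 1 2 by simp
qed

lemma chi_0: "chi 0 = (N + \<sigma> * M) / sqrt p - M * \<sigma> * sqrt (\<sigma> / B)"
  unfolding chi_def phi_0 psi_0 by (simp add: algebra_simps add_divide_distrib)

lemma phi_smax: "phi smax = 1 / sqrt A" and psi_smax: "psi smax = 0"
proof -
  have "phi smax = (p + \<rho> * q) * smax ^ 3" by (simp add: phi_def at_smax algebra_simps)
  also have "\<dots> = A * smax ^ 3" using A_eq by simp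
  also have "\<dots> = (A * smax\<^sup>2) * smax" by (simp add: power2_eq_square power3_eq_cube)
  finally show "phi smax = 1 / sqrt A" using smax(2) by (simp add: smax_def)
  have "psi smax = (B - \<sigma> * p - q) * smax ^ 3" by (simp add: psi_def at_smax algebra_simps)
  also have "B - \<sigma> * p - q = 0" using B_eq by linarith
  finally show "psi smax = 0" by simp
qed

lemma chi_smax: "chi smax = N / sqrt A"
  by (simp add: chi_def phi_smax psi_smax)

lemma phi_pos: "0 \<le> s \<Longrightarrow> s \<le> smax \<Longrightarrow> 0 < phi s"
proof -
  assume "0 \<le> s" "s \<le> smax"
  then have "phi 0 \<le> phi s" using phi_less[of 0 s] by (cases "s = 0") auto
  then show ?thesis using phi_0 p_pos by (smt (verit) divide_pos_pos real_sqrt_gt_zero)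
qed

lemma psi_nonneg: "0 \<le> s \<Longrightarrow> s \<le> smax \<Longrightarrow> 0 \<le> psi s"
  using psi_less[of s smax] psi_smax by (cases "s = smax") auto

text \<open>Scaling by \<open>h\<close>, where \<open>h\<^sup>2 / 2\<close> is the common value of the first potential, reduces a stationary
  profile to its two scaled inner radii.\<close>

lemma half_profile_scale:
  assumes g: "half_profile a b c" and z: "hv a b c 0 = 0" and b: "0 < b"
  obtains h s where "0 < h" "h\<^sup>2 = 2 * hu a b 0" "0 \<le> s" "s \<le> smax" "a = h * s" "b = h * bb s" "c = h * cc s"
proof -
  have abc: "0 \<le> a" "a \<le> b" "b \<le> c" "0 \<le> b" "0 \<le> c" using g b by (auto simp: half_profile_def)
  \<comment> \<open>Twice the value of u at the centre. Since a \<le> b and q < 0 it is at least A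
    b^2 > 0, so its root can serve as the scale.\<close>
  define H where "H = p * b\<^sup>2 + \<rho> * q * a\<^sup>2"
  have "\<rho> * q * b\<^sup>2 \<le> \<rho> * q * a\<^sup>2" using pos q_neg abc
    by (intro mult_left_mono_neg power_mono) (auto simp: mult_nonneg_nonpos)
  moreover have "A * b\<^sup>2 = p * b\<^sup>2 + \<rho> * q * b\<^sup>2" using A_eq by algebra
  ultimately have H1: "A * b\<^sup>2 \<le> H" by (simp add: H_def)
  moreover have "0 < A * b\<^sup>2" using pos b by simp
  ultimately have H: "0 < H" by linarith
  define h where "h = sqrt H"
  have h: "0 < h" "h\<^sup>2 = H" using H by (simp_all add: h_def)
  define s where "s = a / h"
  have a: "a = h * s" using h by (simp add: s_def)
  have s0: "0 \<le> s" using abc h by (simp add: s_def)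
  have "A * a\<^sup>2 \<le> A * b\<^sup>2" using pos abc by (simp add: power_mono)
  then have "A * a\<^sup>2 \<le> H" using H1 by linarith
  then have "h\<^sup>2 * (A * s\<^sup>2) \<le> h\<^sup>2 * 1" using h a by (simp add: power_mult_distrib algebra_simps)
  then have "A * s\<^sup>2 \<le> A * smax\<^sup>2" using h(1) smax(2) by simp
  then have "s\<^sup>2 \<le> smax\<^sup>2" using pos by simp
  then have sm: "s \<le> smax" by (rule power2_le_imp_le) (use smax(1) in simp)
  have "p * b\<^sup>2 = p * (h * bb s)\<^sup>2"
    using bb(2)[of s] h(2) a H_def by algebra
  then have "b\<^sup>2 = (h * bb s)\<^sup>2" using p_pos by simp
  then have b': "b = h * bb s" by (rule power2_eq_imp_eq) (use abc h bb(1)[of s] in simp_all)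
  have "B * c\<^sup>2 = \<sigma> * p * b\<^sup>2 + q * a\<^sup>2" using z profile_at_0(2)[OF abc(1,4,5)] by simp
  then have "B * c\<^sup>2 = B * (h * cc s)\<^sup>2"
    using cc(2)[OF s0 sm] bb(2)[of s] b' a th_def by algebra
  then have "c\<^sup>2 = (h * cc s)\<^sup>2" using pos by simp
  then have c': "c = h * cc s" by (rule power2_eq_imp_eq) (use abc h cc(1)[OF s0 sm] in simp_all)
  show ?thesis using that[OF h(1) _ s0 sm a b' c'] h(2) profile_at_0(1)[OF abc(1,4,5)] by (simp add: H_def)
qed

lemma scale_half_profile:
  assumes "0 < h" "0 \<le> s" "s \<le> smax"
  shows "half_profile (h * s) (h * bb s) (h * cc s)" "hu (h * s) (h * bb s) 0 = h\<^sup>2 / 2"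
    "hv (h * s) (h * bb s) (h * cc s) 0 = 0"
proof -
  have e: "B * (h * cc s)\<^sup>2 = \<sigma> * p * (h * bb s)\<^sup>2 + q * (h * s)\<^sup>2"
    using cc(2)[OF assms(2,3)] bb(2)[of s] th_def by algebra
  show "half_profile (h * s) (h * bb s) (h * cc s)"
    using assms le_bb[OF assms(2,3)] cc(3)[OF assms(2,3)] p_pos q_neg e by (simp add: half_profile_def)
  have nn: "0 \<le> h * s" "0 \<le> h * bb s" "0 \<le> h * cc s"
    using assms bb(1)[of s] cc(1)[OF assms(2,3)] by simp_all
  have "p * (h * bb s)\<^sup>2 + \<rho> * q * (h * s)\<^sup>2 = h\<^sup>2" using bb(2)[of s] by algebra
  then show "hu (h * s) (h * bb s) 0 = h\<^sup>2 / 2" using profile_at_0(1)[OF nn] by simp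
  show "hv (h * s) (h * bb s) (h * cc s) 0 = 0" using profile_at_0(2)[OF nn] e by simp
qed

text \<open>If v is positive at the centre, the inner radii are 0 and the common centre values force
  equal radii on both sides. If v 0 = 0, both sides are matched and have the same scale because h^2
  = 2 u 0; the two mass equations then combine into the equation for \<open>chi\<close>.\<close>

lemma weak_sol_cases:
  assumes w: "weak_sol \<rho> \<sigma> A B M N u v"
  obtains (nested) b c where "half_profile 0 b c" "0 < b" "M = 2 * p * b ^ 3 / 3" "N = 2 * (B * c ^ 3 - \<sigma> * p * b ^ 3) / 3"
      "eq_ae u (hu 0 b)" "eq_ae v (hv 0 b c)"
  | (split) h s s1 where "0 < h" "0 \<le> s" "s \<le> smax" "0 \<le> s1" "s1 \<le> smax" "chi s + chi s1 = 0"
      "h ^ 3 * (phi s + phi s1) = 3 * M"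
      "eq_ae u (glue (hu (h * s) (h * bb s)) (hu (h * s1) (h * bb s1)))"
      "eq_ae v (glue (hv (h * s) (h * bb s) (h * cc s)) (hv (h * s1) (h * bb s1) (h * cc s1)))"
proof -
  obtain a b c a1 b1 c1 where g: "half_profile a b c" "half_profile a1 b1 c1" "0 < b" "0 < b1"
    "hu a b 0 = hu a1 b1 0" "hv a b c 0 = hv a1 b1 c1 0" "a = 0 \<and> a1 = 0 \<or> hv a b c 0 = 0"
    "M = (p * (b ^ 3 + b1 ^ 3) + \<rho> * q * (a ^ 3 + a1 ^ 3)) / 3"
    "N = (B * (c ^ 3 + c1 ^ 3) - \<sigma> * p * (b ^ 3 + b1 ^ 3) - q * (a ^ 3 + a1 ^ 3)) / 3"
    "eq_ae u (glue (hu a b) (hu a1 b1))" "eq_ae v (glue (hv a b c) (hv a1 b1 c1))"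
    by (rule weak_sol_classify[OF w q_neg MN(1)]) blast
  have nn: "0 \<le> a" "0 \<le> b" "0 \<le> c" "0 \<le> a1" "0 \<le> b1" "0 \<le> c1" using g(1-4) by (auto simp: half_profile_def)
  show ?thesis
  proof (cases "hv a b c 0 = 0")
    case True
    obtain h s where hs: "0 < h" "h\<^sup>2 = 2 * hu a b 0" "0 \<le> s" "s \<le> smax" "a = h * s" "b = h * bb s" "c = h * cc s"
      using half_profile_scale[OF g(1) True g(3)] by blast
    have True1: "hv a1 b1 c1 0 = 0" using True g(6) by simp
    obtain h1 s1 where hs1: "0 < h1" "h1\<^sup>2 = 2 * hu a1 b1 0" "0 \<le> s1" "s1 \<le> smax" "a1 = h1 * s1" "b1 = h1 * bb s1" "c1 = h1 * cc s1"
      using half_profile_scale[OF g(2) True1 g(4)] by blast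
    have "h\<^sup>2 = h1\<^sup>2" using hs(2) hs1(2) g(5) by simp
    then have hh: "h1 = h" using hs(1) hs1(1) by (metis less_imp_le power2_eq_imp_eq)
    have M3: "h ^ 3 * (phi s + phi s1) = 3 * M"
      using g(8) hs hs1 hh unfolding phi_def by (simp add: power_mult_distrib algebra_simps)
    have N3: "h ^ 3 * (psi s + psi s1) = 3 * N"
      using g(9) hs hs1 hh unfolding psi_def by (simp add: power_mult_distrib algebra_simps)
    have "h ^ 3 * (chi s + chi s1) = N * (h ^ 3 * (phi s + phi s1)) - M * (h ^ 3 * (psi s + psi s1))"
      by (simp add: chi_def algebra_simps)
    also have "\<dots> = 0" unfolding M3 N3 by simp
    finally have "chi s + chi s1 = 0" using hs(1) by simp
    then show ?thesis using split[of h s s1] hs hs1 hh M3 g(10,11) by simp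
  next
    case False
    then have a0: "a = 0" "a1 = 0" using g(7) by auto
    have "p * b\<^sup>2 = p * b1\<^sup>2" using g(5) a0 nn by (simp add: profile_at_0)
    then have bb1: "b1 = b" using p_pos nn power2_eq_imp_eq[of b b1] by simp
    have "B * c\<^sup>2 = B * c1\<^sup>2" using g(6) a0 nn bb1 by (simp add: profile_at_0)
    then have cc1: "c1 = c" using pos nn power2_eq_imp_eq[of c c1] by simp
    have "glue f f = f" for f :: "real \<Rightarrow> real" by (auto simp: glue_def)
    then show ?thesis
      using nested[of b c] g a0 bb1 cc1 by (simp add: algebra_simps)
  qed
qed

text \<open>Scale so that u is the profile with s = 0. Nonnegativity of v at the centre makes c at
  least the matched radius \<open>h * cc 0\<close>, so N is at least the matched mass: 2 h^3 psi 0
  \<le> 3 N, while 2 h^3 phi 0 = 3 M.\<close>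

lemma nested_imp_chi_0_nonneg:
  assumes g: "half_profile 0 b c" and b: "0 < b" and M: "M = 2 * p * b ^ 3 / 3" and N: "N = 2 * (B * c ^ 3 - \<sigma> * p * b ^ 3) / 3"
  shows "0 \<le> chi 0"
proof -
  define h where "h = b / bb 0"
  have h: "0 < h" "b = h * bb 0" using b bb(1)[of 0] by (simp_all add: h_def)
  have c0: "0 \<le> c" "\<sigma> * p * b\<^sup>2 \<le> B * c\<^sup>2" using g b by (auto simp: half_profile_def)
  have "B * (h * cc 0)\<^sup>2 = \<sigma> * p * b\<^sup>2" using cc(2)[of 0] bb(2)[of 0] smax(1) h(2)
    by (simp add: power_mult_distrib)
  then have "(h * cc 0)\<^sup>2 \<le> c\<^sup>2" using c0(2) pos by (metis mult_le_cancel_left_pos)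
  then have "h * cc 0 \<le> c" using c0(1) by (rule power2_le_imp_le)
  then have "(h * cc 0) ^ 3 \<le> c ^ 3" using h cc(1)[of 0] smax(1) by (intro power_mono) auto
  then have "B * (h * cc 0) ^ 3 \<le> B * c ^ 3" using pos by simp
  then have "2 * (h ^ 3 * psi 0) \<le> 3 * N" using N h(2) by (simp add: psi_def power_mult_distrib algebra_simps)
  moreover have "2 * (h ^ 3 * phi 0) = 3 * M" using M h(2) by (simp add: phi_def power_mult_distrib algebra_simps)
  ultimately have "M * (2 * (h ^ 3 * psi 0)) \<le> N * (2 * (h ^ 3 * phi 0))"
    using MN by (metis mult.commute mult.left_commute mult_left_mono less_imp_le)
  then have "0 \<le> 2 * h ^ 3 * chi 0" by (simp add: chi_def algebra_simps)
  then show ?thesis using h(1) by (simp add: zero_le_mult_iff)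
qed

text \<open>Both terms of chi s + chi s1 = 0 are at least chi 0 \<ge> 0, so they vanish and s = s1 =
  0: a split solution can only be the borderline nested one with v 0 = 0.\<close>

lemma weak_sol_nested:
  assumes w: "weak_sol \<rho> \<sigma> A B M N u v" and chi0: "0 \<le> chi 0"
  obtains b c where "half_profile 0 b c" "0 < b" "M = 2 * p * b ^ 3 / 3" "N = 2 * (B * c ^ 3 - \<sigma> * p * b ^ 3) / 3"
      "eq_ae u (hu 0 b)" "eq_ae v (hv 0 b c)"
  using w
proof (cases rule: weak_sol_cases)
  case (nested b c)
  then show ?thesis by (rule that)
next
  case (split h s s1)
  have "chi 0 \<le> chi s" "chi 0 \<le> chi s1" using split smax by (auto simp: chi_le_iff)
  then have "chi s = chi 0" "chi s1 = chi 0" "chi 0 = 0" using split(6) chi0 by linarith+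
  then have s: "s = 0" "s1 = 0" using chi_less[of 0 s] chi_less[of 0 s1] split by (metis less_eq_real_def less_irrefl)+
  have gl: "glue f f = f" for f :: "real \<Rightarrow> real" by (auto simp: glue_def)
  have M3: "2 * (h ^ 3 * phi 0) = 3 * M" using split(7) s by simp
  have "N * phi 0 = M * psi 0" using \<open>chi 0 = 0\<close> by (simp add: chi_def)
  then have "3 * M * N = 2 * h ^ 3 * (M * psi 0)" using M3 by algebra
  then have N3: "2 * (h ^ 3 * psi 0) = 3 * N" using MN by simp
  have g: "half_profile 0 (h * bb 0) (h * cc 0)"
    using scale_half_profile(1)[OF split(1), of 0] smax by simp
  show ?thesis
  proof (rule that[OF g])
    show "0 < h * bb 0" using split(1) bb(1)[of 0] by simp
    show "M = 2 * p * (h * bb 0) ^ 3 / 3" using M3 by (simp add: phi_def power_mult_distrib algebra_simps)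
    show "N = 2 * (B * (h * cc 0) ^ 3 - \<sigma> * p * (h * bb 0) ^ 3) / 3"
      using N3 by (simp add: psi_def power_mult_distrib algebra_simps)
    show "eq_ae u (hu 0 (h * bb 0))" "eq_ae v (hv 0 (h * bb 0) (h * cc 0))" using split(8,9) s gl by simp_all
  qed
qed

end

section \<open>The one-parameter family\<close>

lemma glue_same: "glue f f = f"
  by (auto simp: glue_def)

lemma cube_eq_imp_eq: "x ^ 3 = y ^ 3 \<Longrightarrow> 0 \<le> x \<Longrightarrow> 0 \<le> y \<Longrightarrow> x = (y::real)"
  using power_eq_imp_eq_base[of x 3 y] by simp

text \<open>Uniqueness is required among all solutions, not only the even ones; this is the
  situation between the thresholds.\<close>

definition even_unique where
  "even_unique \<rho> \<sigma> A B M N u v \<longleftrightarrow> weak_sol \<rho> \<sigma> A B M N u v \<and> even_pair u v \<and>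
     (\<forall>f g. weak_sol \<rho> \<sigma> A B M N f g \<longrightarrow> eq_ae f u \<and> eq_ae g v)"

lemma even_unique_swap: "even_unique \<rho> \<sigma> A B M N u v \<longleftrightarrow> even_unique \<sigma> \<rho> B A N M v u"
  unfolding even_unique_def by (subst weak_sol_swap, subst weak_sol_swap[of \<rho>]) (auto simp: even_pair_def)

section \<open>Even solutions in the range between the thresholds\<close>

context cross
begin

lemma nested_weak_sol:
  assumes "half_profile 0 b c" "M = 2 * p * b ^ 3 / 3" "N = 2 * (B * c ^ 3 - \<sigma> * p * b ^ 3) / 3"
  shows "weak_sol \<rho> \<sigma> A B M N (hu 0 b) (hv 0 b c)" "even_pair (hu 0 b) (hv 0 b c)"
proof -
  have "weak_sol \<rho> \<sigma> A B M N (glue (hu 0 b) (hu 0 b)) (glue (hv 0 b c) (hv 0 b c))"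
    by (rule profile_weak_sol) (use assms in \<open>auto simp: field_simps\<close>)
  then show "weak_sol \<rho> \<sigma> A B M N (hu 0 b) (hv 0 b c)" by (simp add: glue_same)
  show "even_pair (hu 0 b) (hv 0 b c)" by (auto simp: even_pair_def even_ae_def hu_even hv_even)
qed

text \<open>b is fixed by the mass M and then c by the mass N. The condition q M \<le> N p amounts
  to b \<le> c, that is, to u being the component with the smaller support; otherwise the components
  trade places.\<close>

lemma even_unique_mid:
  assumes MN: "0 < M" "0 < N" and pq: "0 < p" "0 \<le> q" and nested: "q * M \<le> N * p"
  shows "\<exists>u v. even_unique \<rho> \<sigma> A B M N u v"
proof -
  define b where "b = root 3 (3 * M / (2 * p))"
  define c where "c = root 3 ((3 * N / 2 + \<sigma> * p * b ^ 3) / B)"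
  have b: "0 < b" "b ^ 3 = 3 * M / (2 * p)" using MN pq by (simp_all add: b_def real_root_pow_pos)
  have Np: "0 < 3 * N / 2 + \<sigma> * p * b ^ 3" using MN pq pos b by (simp add: add_pos_pos)
  have c: "0 < c" "B * c ^ 3 = 3 * N / 2 + \<sigma> * p * b ^ 3" using Np pos by (simp_all add: c_def real_root_pow_pos)
  have "B * b ^ 3 = q * b ^ 3 + \<sigma> * p * b ^ 3" using B_eq by algebra
  also have "q * b ^ 3 \<le> 3 * N / 2" using nested pq by (simp add: b(2) field_simps)
  finally have "B * b ^ 3 \<le> B * c ^ 3" using c(2) by simp
  then have bc: "b \<le> c" using pos c(1) b(1) by (simp add: power_mono_iff)
  have "\<sigma> * p * b\<^sup>2 \<le> B * b\<^sup>2" using B_eq pq by (intro mult_right_mono) auto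
  also have "\<dots> \<le> B * c\<^sup>2" using pos bc b by (simp add: power_mono)
  finally have g: "half_profile 0 b c" using b bc pq by (simp add: half_profile_def)
  have "M = 2 * p * b ^ 3 / 3" using b(2) pq by simp
  moreover have "N = 2 * (B * c ^ 3 - \<sigma> * p * b ^ 3) / 3" using c(2) by simp
  ultimately have w: "weak_sol \<rho> \<sigma> A B M N (hu 0 b) (hv 0 b c)" "even_pair (hu 0 b) (hv 0 b c)"
    using nested_weak_sol[OF g] by blast+
  then have "even_unique \<rho> \<sigma> A B M N (hu 0 b) (hv 0 b c)"
    unfolding even_unique_def using weak_sol_unique_mid[OF _ w(1)] pq MN by auto
  then show ?thesis by blast
qed

end

context cross_high
begin

text \<open>chi 0 \<ge> 0 says that, with u scaled to mass M, the component v with inner radius 0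
  and v 0 = 0 has mass at most N. Hence the outer radius c dictated by N is at least
  \<open>h * cc 0\<close>, which is nonnegativity of v at the centre.\<close>

lemma even_unique_nested:
  assumes chi0: "0 \<le> chi 0"
  shows "\<exists>u v. even_unique \<rho> \<sigma> A B M N u v"
proof -
  define b where "b = root 3 (3 * M / (2 * p))"
  define c where "c = root 3 ((3 * N / 2 + \<sigma> * p * b ^ 3) / B)"
  have b: "0 < b" "b ^ 3 = 3 * M / (2 * p)" using MN p_pos by (simp_all add: b_def real_root_pow_pos)
  have Np: "0 < 3 * N / 2 + \<sigma> * p * b ^ 3" using MN p_pos pos b by (simp add: add_pos_pos)
  have c: "0 < c" "B * c ^ 3 = 3 * N / 2 + \<sigma> * p * b ^ 3" using Np pos by (simp_all add: c_def real_root_pow_pos)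
  have M: "M = 2 * p * b ^ 3 / 3" using b(2) p_pos by simp
  have N: "N = 2 * (B * c ^ 3 - \<sigma> * p * b ^ 3) / 3" using c(2) by simp
  define h where "h = b / bb 0"
  have h: "0 < h" "b = h * bb 0" using b bb(1)[of 0] by (simp_all add: h_def)
  have "2 * (h ^ 3 * phi 0) = 3 * M" using M h(2) by (simp add: phi_def power_mult_distrib algebra_simps)
  moreover have "M * (2 * (h ^ 3 * psi 0)) \<le> N * (2 * (h ^ 3 * phi 0))"
  proof -
    have "0 \<le> 2 * h ^ 3 * chi 0" using chi0 h by simp
    then show ?thesis by (simp add: chi_def algebra_simps)
  qed
  ultimately have "M * (2 * (h ^ 3 * psi 0)) \<le> M * (3 * N)" by (simp add: mult.commute mult.left_commute)
  then have "2 * (h ^ 3 * psi 0) \<le> 3 * N" using MN by simp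
  then have "B * (h * cc 0) ^ 3 \<le> B * c ^ 3"
    using c(2) h(2) by (simp add: psi_def power_mult_distrib algebra_simps)
  then have "(h * cc 0) ^ 3 \<le> c ^ 3" using pos by simp
  moreover have cc0: "0 < cc 0" "bb 0 \<le> cc 0" using cc(1,3)[of 0] smax by simp_all
  ultimately have hc: "h * cc 0 \<le> c" using c(1) h(1) power_mono_iff[of "h * cc 0" c 3] by simp
  have bc: "b \<le> c" using hc cc0 h by (smt (verit) mult_left_mono)
  have "\<sigma> * p * b\<^sup>2 = B * (h * cc 0)\<^sup>2" using cc(2)[of 0] bb(2)[of 0] smax(1) h(2)
    by (simp add: power_mult_distrib)
  also have "\<dots> \<le> B * c\<^sup>2" using pos hc h cc0 by (simp add: power_mono)
  finally have g: "half_profile 0 b c" using b bc p_pos by (simp add: half_profile_def)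
  have "eq_ae f (hu 0 b) \<and> eq_ae k (hv 0 b c)" if w: "weak_sol \<rho> \<sigma> A B M N f k" for f k
  proof -
    obtain b' c' where s: "half_profile 0 b' c'" "0 < b'" "M = 2 * p * b' ^ 3 / 3" "N = 2 * (B * c' ^ 3 - \<sigma> * p * b' ^ 3) / 3"
      "eq_ae f (hu 0 b')" "eq_ae k (hv 0 b' c')"
      using weak_sol_nested[OF w chi0] by blast
    have "b' ^ 3 = b ^ 3" using s(3) M p_pos by simp
    then have b': "b' = b" by (rule cube_eq_imp_eq) (use s(2) b(1) in auto)
    then have "c' ^ 3 = c ^ 3" using s(4) N pos by simp
    moreover have "0 \<le> c'" using s(1) b' b by (auto simp: half_profile_def)
    ultimately have "c' = c" by (rule cube_eq_imp_eq) (use c(1) in auto)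
    then show ?thesis using s b' by simp
  qed
  then have "even_unique \<rho> \<sigma> A B M N (hu 0 b) (hv 0 b c)"
    unfolding even_unique_def using nested_weak_sol[OF g M N] by blast
  then show ?thesis by blast
qed

section \<open>Parametrisation of the curve by the value of chi\<close>

definition "sinv t = inv_into {0..smax} chi t"

lemma chi_inj: "inj_on chi {0..smax}"
  by (rule inj_onI) (metis chi_less_iff linorder_neq_iff less_irrefl)

lemma sinv_chi: "s \<in> {0..smax} \<Longrightarrow> sinv (chi s) = s"
  unfolding sinv_def using chi_inj by (rule inv_into_f_f)

lemma chi_image: "chi ` {0..smax} = {chi 0..chi smax}"
proof
  show "chi ` {0..smax} \<subseteq> {chi 0..chi smax}" using smax by (auto simp: chi_le_iff)
  show "{chi 0..chi smax} \<subseteq> chi ` {0..smax}"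
  proof
    fix t assume "t \<in> {chi 0..chi smax}"
    then obtain s where "0 \<le> s" "s \<le> smax" "chi s = t"
      using IVT'[of chi 0 t smax] smax continuous_on_chi by auto
    then show "t \<in> chi ` {0..smax}" by auto
  qed
qed

lemma sinv:
  assumes "t \<in> {chi 0..chi smax}"
  shows "sinv t \<in> {0..smax}" "chi (sinv t) = t"
  using assms unfolding chi_image[symmetric] sinv_def by (auto intro: inv_into_into f_inv_into_f simp del: atLeastAtMost_iff)

lemma continuous_on_sinv: "continuous_on {chi 0..chi smax} sinv"
  unfolding chi_image[symmetric]
  by (rule continuous_on_inv) (auto intro: continuous_on_chi sinv_chi)

lemma sinv_less:
  assumes "s \<in> {chi 0..chi smax}" "t \<in> {chi 0..chi smax}" "s < t"
  shows "sinv s < sinv t"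
  using sinv[OF assms(1)] sinv[OF assms(2)] assms(3) chi_less_iff by metis

lemma sinv_ends: "sinv (chi 0) = 0" "sinv (chi smax) = smax"
  using sinv_chi smax by simp_all

lemma sinv_interior:
  assumes "chi 0 < t" "t < chi smax"
  shows "0 < sinv t" "sinv t < smax"
  using sinv_less[of "chi 0" t] sinv_less[of t "chi smax"] assms sinv_ends by auto

lemma real_holo_bb: "real_holo bb s"
  unfolding bb_def[abs_def]
  by (rule real_holo_compose[where k=sqrt])
    (use rq_sq[of s] p_pos in \<open>auto intro!: real_holo_divide real_holo_diff real_holo_mult real_holo_power
      real_holo_const real_holo_ident real_holo_sqrt continuous_intros\<close>)

lemma real_holo_cc: "0 \<le> s \<Longrightarrow> s \<le> smax \<Longrightarrow> real_holo cc s"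
  unfolding cc_def[abs_def]
  by (rule real_holo_compose[where k=sqrt])
    (use cc_arg_pos(2)[of s] pos in \<open>auto intro!: real_holo_divide real_holo_add real_holo_mult real_holo_power
      real_holo_const real_holo_ident real_holo_sqrt continuous_intros\<close>)

lemma real_holo_phi: "real_holo phi s"
  unfolding phi_def[abs_def]
  by (intro real_holo_add real_holo_mult real_holo_power real_holo_const real_holo_ident real_holo_bb)

lemma real_holo_chi: "0 \<le> s \<Longrightarrow> s \<le> smax \<Longrightarrow> real_holo chi s"
  unfolding chi_def[abs_def] psi_def[abs_def]
  by (intro real_holo_diff real_holo_mult real_holo_power real_holo_const real_holo_ident real_holo_bb real_holo_cc real_holo_phi)

lemma real_holo_sinv:
  assumes t: "chi 0 < t" "t < chi smax"
  shows "real_holo sinv t"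
proof -
  have s: "0 < sinv t" "sinv t < smax" using sinv_interior[OF t] .
  obtain D where D: "(chi has_real_derivative D) (at (sinv t))" "D \<noteq> 0"
    using DERIV_chi_nonzero[OF s] by blast
  have o: "eventually (\<lambda>y. y \<in> {chi 0<..<chi smax}) (nhds t)"
    by (rule eventually_nhds_in_open) (use t in auto)
  show ?thesis
  proof (rule real_holo_inverse[where f=chi and s=sinv and t=t, OF _ D])
    show "real_holo chi (sinv t)" using s by (intro real_holo_chi) auto
    have "continuous_on {chi 0<..<chi smax} sinv"
      using continuous_on_sinv by (rule continuous_on_subset) auto
    then show "isCont sinv t" using t by (simp add: continuous_on_eq_continuous_at)
    show "eventually (\<lambda>y. chi (sinv y) = y) (nhds t)"
      using o by eventually_elim (rule sinv, auto)
  qed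
qed

text \<open>The parameter is t = chi s = - chi s1, so t and - t must both lie in the range of
  \<open>chi\<close>; this gives a symmetric interval. The radii of the left half line are those of
  the right one at - t, and reflecting the pair is the same as t -> - t.\<close>

definition "T = min (- chi 0) (chi smax)"
definition "hh t = root 3 (3 * M / (phi (sinv t) + phi (sinv (- t))))"
definition "ra t = hh t * sinv t"
definition "rb t = hh t * bb (sinv t)"
definition "rc t = hh t * cc (sinv t)"
definition "Uf t = glue (hu (ra t) (rb t)) (hu (ra (- t)) (rb (- t)))"
definition "Vf t = glue (hv (ra t) (rb t) (rc t)) (hv (ra (- t)) (rb (- t)) (rc (- t)))"
definition "mass_right t = (B * rc t ^ 3 - \<sigma> * p * rb t ^ 3 - q * ra t ^ 3) / 3"

lemma hh_even: "hh (- t) = hh t"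
  by (simp add: hh_def add.commute)

end

section \<open>The regime with non-symmetric solutions\<close>

locale cross_family = cross_high +
  assumes chi_0_neg: "chi 0 < 0"
begin

lemma T_pos: "0 < T"
  using chi_0_neg chi_smax MN pos by (simp add: T_def)

lemma dom:
  assumes "t \<in> {-T..T}"
  shows "t \<in> {chi 0..chi smax}" "- t \<in> {chi 0..chi smax}" "- t \<in> {-T..T}"
  using assms by (auto simp: T_def)

lemma dom_interior:
  assumes "t \<in> {-T<..<T}"
  shows "chi 0 < t" "t < chi smax" "chi 0 < - t" "- t < chi smax"
  using assms by (auto simp: T_def)

lemma sinv_bounds:
  assumes "t \<in> {-T..T}"
  shows "0 \<le> sinv t" "sinv t \<le> smax" "0 \<le> sinv (- t)" "sinv (- t) \<le> smax"
  using sinv(1)[OF dom(1)[OF assms]] sinv(1)[OF dom(2)[OF assms]] by auto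

lemma hh_pos:
  assumes "t \<in> {-T..T}"
  shows "0 < hh t" "hh t ^ 3 * (phi (sinv t) + phi (sinv (- t))) = 3 * M"
    "hh t ^ 3 * (psi (sinv t) + psi (sinv (- t))) = 3 * N"
proof -
  have ph: "0 < phi (sinv t) + phi (sinv (- t))"
    using phi_pos sinv_bounds[OF assms] by (simp add: add_pos_pos)
  then show "0 < hh t" using MN by (simp add: hh_def)
  show 1: "hh t ^ 3 * (phi (sinv t) + phi (sinv (- t))) = 3 * M"
    using ph MN by (simp add: hh_def real_root_pow_pos)
  \<comment> \<open>\<open>hh\<close> was chosen to give the mass M; the vanishing of this sum turns
    that into the equation for N.\<close>
  have "chi (sinv t) + chi (sinv (- t)) = 0"
    using sinv(2)[OF dom(1)[OF assms]] sinv(2)[OF dom(2)[OF assms]] by simp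
  then have "M * (psi (sinv t) + psi (sinv (- t))) = N * (phi (sinv t) + phi (sinv (- t)))"
    by (simp add: chi_def algebra_simps)
  then have "M * (hh t ^ 3 * (psi (sinv t) + psi (sinv (- t)))) = N * (hh t ^ 3 * (phi (sinv t) + phi (sinv (- t))))"
    by algebra
  then have "M * (hh t ^ 3 * (psi (sinv t) + psi (sinv (- t)))) = M * (3 * N)" using 1 by algebra
  then show "hh t ^ 3 * (psi (sinv t) + psi (sinv (- t))) = 3 * N"
    using MN(1) by simp
qed

lemma family_profile:
  assumes "t \<in> {-T..T}"
  shows "half_profile (ra t) (rb t) (rc t)" "hu (ra t) (rb t) 0 = (hh t)\<^sup>2 / 2" "hv (ra t) (rb t) (rc t) 0 = 0" "0 < rb t"
  using scale_half_profile[OF hh_pos(1)[OF assms] sinv_bounds(1,2)[OF assms]] hh_pos(1)[OF assms] bb(1)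
  by (simp_all add: ra_def rb_def rc_def)

lemma family_radii:
  assumes "t \<in> {-T..T}"
  shows "0 \<le> ra t" "ra t \<le> rb t" "rb t \<le> rc t"
  using family_profile(1)[OF assms] by (auto simp: half_profile_def)

lemma family_masses:
  assumes "t \<in> {-T..T}"
  shows "M = (p * (rb t ^ 3 + rb (- t) ^ 3) + \<rho> * q * (ra t ^ 3 + ra (- t) ^ 3)) / 3"
    "N = (B * (rc t ^ 3 + rc (- t) ^ 3) - \<sigma> * p * (rb t ^ 3 + rb (- t) ^ 3) - q * (ra t ^ 3 + ra (- t) ^ 3)) / 3"
proof -
  show "M = (p * (rb t ^ 3 + rb (- t) ^ 3) + \<rho> * q * (ra t ^ 3 + ra (- t) ^ 3)) / 3"
    using hh_pos(2)[OF assms] by (simp add: rb_def ra_def hh_even phi_def power_mult_distrib algebra_simps)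
  show "N = (B * (rc t ^ 3 + rc (- t) ^ 3) - \<sigma> * p * (rb t ^ 3 + rb (- t) ^ 3) - q * (ra t ^ 3 + ra (- t) ^ 3)) / 3"
    using hh_pos(3)[OF assms] by (simp add: rb_def ra_def rc_def hh_even psi_def power_mult_distrib algebra_simps)
qed

lemma family_at_0:
  assumes "t \<in> {-T..T}"
  shows "hu (ra t) (rb t) 0 = hu (ra (- t)) (rb (- t)) 0"
    "hv (ra t) (rb t) (rc t) 0 = hv (ra (- t)) (rb (- t)) (rc (- t)) 0"
  using family_profile[OF assms] family_profile[OF dom(3)[OF assms]] hh_even by simp_all

lemma family_weak_sol:
  assumes "t \<in> {-T..T}"
  shows "weak_sol \<rho> \<sigma> A B M N (Uf t) (Vf t)"
  unfolding Uf_def Vf_def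
  by (rule profile_weak_sol[OF family_profile(1)[OF assms] family_profile(1)[OF dom(3)[OF assms]]
        family_at_0[OF assms] family_masses[OF assms]])

lemma family_complete:
  assumes w: "weak_sol \<rho> \<sigma> A B M N u v"
  shows "\<exists>t\<in>{-T..T}. eq_ae u (Uf t) \<and> eq_ae v (Vf t)"
  using w
proof (cases rule: weak_sol_cases)
  case (nested b c)
  then have "0 \<le> chi 0" by (intro nested_imp_chi_0_nonneg)
  then show ?thesis using chi_0_neg by simp
next
  case (split h s s1)
  define t where "t = chi s"
  have t1: "- t = chi s1" using split(6) by (simp add: t_def)
  have s: "s \<in> {0..smax}" "s1 \<in> {0..smax}" using split by auto
  have st: "sinv t = s" "sinv (- t) = s1" using sinv_chi s t_def t1 by simp_all
  have "chi s \<in> {chi 0..chi smax}" "chi s1 \<in> {chi 0..chi smax}" using s chi_image by blast+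
  then have t: "t \<in> {-T..T}" using t_def t1 by (auto simp: T_def)
  have "h ^ 3 * (phi s + phi s1) = hh t ^ 3 * (phi s + phi s1)"
    using hh_pos(2)[OF t] split(7) st by simp
  moreover have "0 < phi s + phi s1" using phi_pos split by (simp add: add_pos_pos)
  ultimately have "h ^ 3 = hh t ^ 3" by simp
  then have h: "h = hh t" by (rule cube_eq_imp_eq) (use split(1) hh_pos(1)[OF t] in auto)
  have "eq_ae u (Uf t)" "eq_ae v (Vf t)"
    using split(8,9) by (simp_all add: Uf_def Vf_def ra_def rb_def rc_def hh_even st h)
  then show ?thesis using t by blast
qed

lemma continuous_on_Uf: "t \<in> {-T..T} \<Longrightarrow> continuous_on UNIV (Uf t)"
  unfolding Uf_def using family_at_0(1)[of t]
  by (intro continuous_on_glue) (auto simp: hu_def[abs_def] intro!: continuous_intros continuous_on_bump)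

lemma continuous_on_Vf: "t \<in> {-T..T} \<Longrightarrow> continuous_on UNIV (Vf t)"
  unfolding Vf_def using family_at_0(2)[of t]
  by (intro continuous_on_glue) (auto simp: hv_def[abs_def] intro!: continuous_intros continuous_on_bump)

lemma sinv_order:
  assumes "t \<in> {-T..T}" "0 < t"
  shows "sinv (- t) < sinv t"
  using sinv_less[OF dom(2,1)[OF assms(1)]] assms(2) by simp

lemma family_even: "even_pair (Uf 0) (Vf 0)"
  by (auto simp: even_pair_def even_ae_def Uf_def Vf_def glue_same hu_even hv_even)

text \<open>The outer radii of u can be read off from its positivity set, so evenness makes them
  equal. The scale is common to both sides and \<open>bb\<close> determines s, so the two scaled
  inner radii coincide and t = - t.\<close>

lemma family_non_symmetric:
  assumes t: "t \<in> {-T..T}" "t \<noteq> 0"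
  shows "non_symmetric (Uf t) (Vf t)"
  unfolding non_symmetric_def
proof
  assume "even_pair (Uf t) (Vf t)"
  then have ae: "AE x in lebesgue. Uf t (- x) = Uf t x" by (simp add: even_pair_def even_ae_def)
  note g = family_profile[OF t(1)] family_profile[OF dom(3)[OF t(1)]]
  have "(\<lambda>x. Uf t (- x)) = Uf t"
  proof (rule AE_eq_continuous_imp_eq[OF ae])
    show "continuous_on UNIV (\<lambda>x. Uf t (- x))"
      by (rule continuous_on_compose2[OF continuous_on_Uf[OF t(1)]]) (auto intro!: continuous_intros)
  qed (rule continuous_on_Uf[OF t(1)])
  then have ev: "Uf t (- x) = Uf t x" for x by metis
  have eq: "hu (ra t) (rb t) x = hu (ra (- t)) (rb (- t)) x" if "0 < x" for x
    using ev[of x] that by (simp add: Uf_def glue_def hu_even)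
  have "rb t = rb (- t)"
  proof (rule ccontr)
    assume ne: "rb t \<noteq> rb (- t)"
    define x where "x = min (rb t) (rb (- t))"
    have x: "0 < x" using g(4,8) by (simp add: x_def)
    show False using eq[OF x] hu_pos_iff[OF g(1), of x] hu_pos_iff[OF g(5), of x] x ne
      by (auto simp: x_def min_def split: if_splits)
  qed
  then have "bb (sinv t) = bb (sinv (- t))" using hh_pos(1)[OF t(1)] by (simp add: rb_def hh_even)
  then have "1 - \<rho> * q * (sinv t)\<^sup>2 = 1 - \<rho> * q * (sinv (- t))\<^sup>2" using bb(2) by metis
  then have "(sinv t)\<^sup>2 = (sinv (- t))\<^sup>2" using pos q_neg by simp
  then have "sinv t = sinv (- t)" by (rule power2_eq_imp_eq) (use sinv_bounds[OF t(1)] in auto)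
  then have "t = - t" using sinv(2)[OF dom(1)[OF t(1)]] sinv(2)[OF dom(2)[OF t(1)]] by metis
  then show False using t(2) by simp
qed

text \<open>The right half line carries the fraction psi s / (psi s + psi s1) of the mass N. Along
  increasing t, s grows and s1 shrinks while \<open>psi\<close> is decreasing, so this fraction
  falls; the proof compares the cross-multiplied fractions.\<close>

lemma mass_right_less:
  assumes "s \<in> {-T..T}" "t \<in> {-T..T}" "s < t"
  shows "mass_right t < mass_right s"
proof -
  have eq: "mass_right t * (psi (sinv t) + psi (sinv (- t))) = N * psi (sinv t)"
    "0 < psi (sinv t) + psi (sinv (- t))" if "t \<in> {-T..T}" for t
  proof -
    have "3 * mass_right t = B * rc t ^ 3 - \<sigma> * p * rb t ^ 3 - q * ra t ^ 3"
      by (simp add: mass_right_def)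
    then have m: "3 * mass_right t = hh t ^ 3 * psi (sinv t)"
      by (simp add: ra_def rb_def rc_def psi_def power_mult_distrib algebra_simps)
    then show "mass_right t * (psi (sinv t) + psi (sinv (- t))) = N * psi (sinv t)"
      using hh_pos(3)[OF that] by algebra
    have "0 < hh t ^ 3 * (psi (sinv t) + psi (sinv (- t)))" using hh_pos(3)[OF that] MN by simp
    then show "0 < psi (sinv t) + psi (sinv (- t))" using hh_pos(1)[OF that] by (simp add: zero_less_mult_iff)
  qed
  define x y x' y' where "x = psi (sinv s)" and "y = psi (sinv (- s))" and "x' = psi (sinv t)" and "y' = psi (sinv (- t))"
  have "sinv s < sinv t" "sinv (- t) < sinv (- s)"
    using sinv_less dom assms by simp_all
  then have "x' < x" "y < y'" unfolding x_def y_def x'_def y'_def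
    using psi_less sinv_bounds assms(1,2) by blast+
  moreover have nn: "0 \<le> x'" "0 \<le> y" unfolding x'_def y_def using psi_nonneg sinv_bounds assms(1,2) by blast+
  ultimately have "x' * y < x * y'"
    by (smt (verit) mult_left_mono mult_strict_right_mono)
  then have "x' * (x + y) < x * (x' + y')" by (simp add: algebra_simps)
  then have "N * x' * (x + y) < N * x * (x' + y')" using MN by (simp add: mult.assoc)
  then have "(mass_right t * (x' + y')) * (x + y) < (mass_right s * (x + y)) * (x' + y')"
    using eq(1)[OF assms(1)] eq(1)[OF assms(2)] unfolding x_def y_def x'_def y'_def by simp
  then have "mass_right t * ((x + y) * (x' + y')) < mass_right s * ((x + y) * (x' + y'))" by (simp add: algebra_simps)
  moreover have "0 < (x + y) * (x' + y')"
    using eq(2)[OF assms(1)] eq(2)[OF assms(2)] unfolding x_def y_def x'_def y'_def by simp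
  ultimately show ?thesis by (rule mult_less_cancel_right_pos[THEN iffD1, rotated])
qed

section \<open>Energy along the curve\<close>

definition "En t = (LINT x|lebesgue. energy_density (Uf t x) (Vf t x) x)"

lemma En_gap:
  assumes "s \<in> {-T..T}" "t \<in> {-T..T}"
  shows "\<rho> * (B * ((rc s)\<^sup>2 - (rc (- s))\<^sup>2) / 2) * (mass_right t - mass_right s) \<le> En t - En s"
  unfolding En_def Uf_def Vf_def mass_right_def
  by (rule energy_gap[OF family_profile(1)[OF assms(1)] family_profile(1)[OF dom(3)[OF assms(1)]]
        family_profile(4)[OF assms(1)] family_at_0[OF assms(1)] family_masses[OF assms(1)]
        family_profile(1)[OF assms(2)] family_profile(1)[OF dom(3)[OF assms(2)]]
        family_at_0[OF assms(2)] family_masses[OF assms(2)] less_imp_le[OF q_neg] MN(1)])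

text \<open>Since th q < 0, a larger scaled inner radius gives a smaller outer radius; so for s > 0
  the constant potential of v is lower on the right.\<close>

lemma rc_order:
  assumes "s \<in> {-T..T}" "0 < s"
  shows "B * (rc s)\<^sup>2 < B * (rc (- s))\<^sup>2"
proof -
  have "(sinv (- s))\<^sup>2 < (sinv s)\<^sup>2"
    using sinv_order[OF assms] sinv_bounds[OF assms(1)] by (simp add: power_strict_mono)
  moreover have "th * q < 0" using th_pos q_neg by (simp add: mult_pos_neg)
  ultimately have "th * q * (sinv s)\<^sup>2 < th * q * (sinv (- s))\<^sup>2" by (rule mult_strict_left_mono_neg)
  then have "B * (cc (sinv s))\<^sup>2 < B * (cc (sinv (- s)))\<^sup>2"
    using cc(2) sinv_bounds[OF assms(1)] by simp
  then have "(hh s)\<^sup>2 * (B * (cc (sinv s))\<^sup>2) < (hh s)\<^sup>2 * (B * (cc (sinv (- s)))\<^sup>2)"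
    using hh_pos(1)[OF assms(1)] by simp
  then show ?thesis by (simp add: rc_def hh_even power_mult_distrib mult.left_commute)
qed

text \<open>Moving further away from 0 carries mass of v out of the half line with the lower
  constant potential into the one with the higher, so the first-order lower bound of
  \<open>En_gap\<close> is positive.\<close>

lemma En_strict:
  assumes "s \<in> {-T..T}" "t \<in> {-T..T}" "0 < s \<and> s < t \<or> t < s \<and> s < 0"
  shows "En s < En t"
proof -
  have "0 < (B * (rc s)\<^sup>2 - B * (rc (- s))\<^sup>2) * (mass_right t - mass_right s)"
    using assms(3)
  proof
    assume "0 < s \<and> s < t"
    then show ?thesis using rc_order[of s] mass_right_less[of s t] assms(1,2) by (intro mult_neg_neg) auto
  next
    assume "t < s \<and> s < 0"
    then show ?thesis using rc_order[of "- s"] mass_right_less[of t s] assms(1,2) by (intro mult_pos_pos) auto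
  qed
  then have "0 < \<rho> * ((B * (rc s)\<^sup>2 - B * (rc (- s))\<^sup>2) * (mass_right t - mass_right s)) / 2" using pos by simp
  also have "\<dots> = \<rho> * (B * ((rc s)\<^sup>2 - (rc (- s))\<^sup>2) / 2) * (mass_right t - mass_right s)" by (simp add: algebra_simps)
  also have "\<dots> \<le> En t - En s" by (rule En_gap[OF assms(1,2)])
  finally show ?thesis by simp
qed

lemma En_min: "t \<in> {-T..T} \<Longrightarrow> En 0 \<le> En t"
  using En_gap[of 0 t] T_pos by simp

lemma energy_monotone: "strict_mono_on {0..T} En" "strict_antimono_on {-T..0} En"
proof -
  have pos: "En s < En t" if "0 \<le> s" "s < t" "t \<le> T" for s t
  proof (cases "s = 0")
    case True
    \<comment> \<open>At 0 both constants agree and the gap is only known to be nonnegative;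
      strictness comes from the intermediate parameter t / 2.\<close>
    have "En 0 \<le> En (t / 2)" by (rule En_min) (use that in auto)
    also have "\<dots> < En t" by (rule En_strict) (use that in auto)
    finally show ?thesis using True by simp
  qed (use that En_strict[of s t] in auto)
  have neg: "En s < En t" if "s \<le> 0" "t < s" "-T \<le> t" for s t
  proof (cases "s = 0")
    case True
    have "En 0 \<le> En (t / 2)" by (rule En_min) (use that in auto)
    also have "\<dots> < En t" by (rule En_strict) (use that in auto)
    finally show ?thesis using True by simp
  qed (use that En_strict[of s t] T_pos in auto)
  show "strict_mono_on {0..T} En" by (rule strict_mono_onI) (use pos in auto)
  show "strict_antimono_on {-T..0} En" by (auto simp: monotone_on_def neg)
qed

section \<open>Continuity and analyticity of the radii\<close>

lemma continuous_on_hh: "continuous_on {-T..T} hh"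
proof -
  have s: "continuous_on {-T..T} sinv"
    by (rule continuous_on_subset[OF continuous_on_sinv]) (use dom(1) in blast)
  have s1: "continuous_on {-T..T} (\<lambda>t. sinv (- t))"
    by (rule continuous_on_compose2[OF s]) (auto intro!: continuous_intros)
  have "continuous_on {-T..T} (\<lambda>t. phi (sinv t))" "continuous_on {-T..T} (\<lambda>t. phi (sinv (- t)))"
    by (rule continuous_on_compose2[OF continuous_on_phi[of UNIV]], use s s1 in auto)+
  moreover have "phi (sinv t) + phi (sinv (- t)) \<noteq> 0" if "t \<in> {-T..T}" for t
    using phi_pos sinv_bounds[OF that] by (metis add_pos_pos less_irrefl)
  ultimately show ?thesis unfolding hh_def[abs_def] by (intro continuous_intros) auto
qed

lemma continuous_on_radii: "continuous_on {-T..T} ra" "continuous_on {-T..T} rb" "continuous_on {-T..T} rc"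
proof -
  have s: "continuous_on {-T..T} sinv"
    by (rule continuous_on_subset[OF continuous_on_sinv]) (use dom(1) in blast)
  have "continuous_on {-T..T} (\<lambda>t. bb (sinv t))" "continuous_on {-T..T} (\<lambda>t. cc (sinv t))"
    by (rule continuous_on_compose2[OF continuous_on_bb[of UNIV]] continuous_on_compose2[OF continuous_on_cc[of UNIV]], use s in auto)+
  then show "continuous_on {-T..T} ra" "continuous_on {-T..T} rb" "continuous_on {-T..T} rc"
    unfolding ra_def[abs_def] rb_def[abs_def] rc_def[abs_def]
    using s continuous_on_hh by (auto intro!: continuous_intros)
qed

lemma real_holo_radii:
  assumes t: "t \<in> {-T<..<T}"
  shows "real_holo ra t" "real_holo rb t" "real_holo rc t"
proof -
  have tt: "t \<in> {-T..T}" using t by auto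
  note s = real_holo_sinv[OF dom_interior(1,2)[OF t]] real_holo_sinv[OF dom_interior(3,4)[OF t]]
  have s1: "real_holo (\<lambda>t. sinv (- t)) t" using s(2) by (rule real_holo_uminus_arg)
  note c = real_holo_isCont[OF s(1)] real_holo_isCont[OF s1]
  have ph: "real_holo (\<lambda>t. phi (sinv t)) t" "real_holo (\<lambda>t. phi (sinv (- t))) t"
    using real_holo_compose[OF s(1) real_holo_phi c(1)] real_holo_compose[OF s1 real_holo_phi c(2)] .
  have pp: "0 < phi (sinv t) + phi (sinv (- t))"
    using phi_pos sinv_bounds[OF tt] by (simp add: add_pos_pos)
  have d: "real_holo (\<lambda>t. 3 * M / (phi (sinv t) + phi (sinv (- t)))) t"
    using pp ph by (intro real_holo_divide real_holo_add real_holo_const) auto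
  have hh: "real_holo hh t"
    unfolding hh_def[abs_def]
    by (rule real_holo_compose[where k="root 3", OF d _ real_holo_isCont[OF d]])
      (use pp MN in \<open>auto intro!: real_holo_root3\<close>)
  have "real_holo (\<lambda>t. bb (sinv t)) t" by (rule real_holo_compose[OF s(1) real_holo_bb c(1)])
  moreover have "real_holo (\<lambda>t. cc (sinv t)) t"
    using sinv_bounds[OF tt] by (intro real_holo_compose[OF s(1) real_holo_cc c(1)])
  ultimately show "real_holo ra t" "real_holo rb t" "real_holo rc t"
    unfolding ra_def[abs_def] rb_def[abs_def] rc_def[abs_def]
    using hh s(1) by (auto intro!: real_holo_mult)
qed

section \<open>Connectedness of the supports\<close>

lemma connected_supp_Uf: "t \<in> {-T..T} \<Longrightarrow> connected (supp (Uf t))"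
  unfolding Uf_def
  by (rule connected_supp_hu) (use family_profile dom(3) family_at_0 in blast)+

lemma Vf_nonzero:
  assumes t: "t \<in> {-T..T}"
  shows "{x. Vf t x \<noteq> 0} = {- rc (- t)<..<- ra (- t)} \<union> {ra t<..<rc t}"
proof (rule set_eqI)
  fix x
  note g = family_profile[OF t] family_profile[OF dom(3)[OF t]]
  note r = family_radii[OF t] family_radii[OF dom(3)[OF t]]
  show "x \<in> {x. Vf t x \<noteq> 0} \<longleftrightarrow> x \<in> {- rc (- t)<..<- ra (- t)} \<union> {ra t<..<rc t}"
  proof (cases "0 \<le> x")
    case True
    then show ?thesis using hv_pos_iff[OF g(1) q_neg g(3) True] half_profile_nonneg(2)[OF g(1), of x] r
      by (auto simp: Vf_def glue_def)
  next
    case False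
    then show ?thesis using hv_pos_iff[OF g(5) q_neg g(7), of "- x"] half_profile_nonneg(2)[OF g(5), of x] r
      by (auto simp: Vf_def glue_def hv_even)
  qed
qed

text \<open>At s = smax the inner and outer radius of that side coincide, so v lives on the other
  half line only.\<close>

lemma connected_supp_Vf:
  assumes t: "t \<in> {-T..T}" and e: "sinv t = smax \<or> sinv (- t) = smax"
  shows "connected (supp (Vf t))"
proof -
  have "ra t = rc t \<or> ra (- t) = rc (- t)" using e at_smax by (auto simp: ra_def rc_def)
  then have "{x. Vf t x \<noteq> 0} = {- rc (- t)<..<- ra (- t)} \<or> {x. Vf t x \<noteq> 0} = {ra t<..<rc t}"
    unfolding Vf_nonzero[OF t] by auto
  then have "connected {x. Vf t x \<noteq> 0}" by auto
  then show ?thesis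
    using supp_continuous[OF continuous_on_Vf[OF t]] by (simp add: connected_imp_connected_closure)
qed

lemma disconnected_supp_Vf:
  assumes t: "t \<in> {-T..T}" and s: "sinv t < smax" "sinv (- t) < smax" "0 < sinv t \<or> 0 < sinv (- t)"
  shows "\<not> connected (supp (Vf t))"
proof
  assume con: "connected (supp (Vf t))"
  have t1: "- t \<in> {-T..T}" using dom(3)[OF t] .
  have h: "0 < hh t" "0 < hh (- t)" using hh_pos(1)[OF t] hh_even by simp_all
  have lt: "ra t < rc t" "ra (- t) < rc (- t)"
    unfolding ra_def rc_def using h less_bb[of "sinv t"] less_bb[of "sinv (- t)"] cc(3)[of "sinv t"] cc(3)[of "sinv (- t)"]
      sinv_bounds[OF t] s by auto
  have r: "0 \<le> ra t" "0 \<le> ra (- t)" using family_radii t t1 by auto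
  have gap: "- ra (- t) < ra t"
    using s(3)
  proof
    assume "0 < sinv t"
    then have "0 < ra t" unfolding ra_def using h(1) by (intro mult_pos_pos)
    then show ?thesis using r by simp
  next
    assume "0 < sinv (- t)"
    then have "0 < ra (- t)" unfolding ra_def using h(2) by (intro mult_pos_pos)
    then show ?thesis using r by simp
  qed
  have cl: "supp (Vf t) = closure {x. Vf t x \<noteq> 0}" by (rule supp_continuous[OF continuous_on_Vf[OF t]])
  have "{x. Vf t x \<noteq> 0} \<subseteq> {..- ra (- t)} \<union> {ra t..}" unfolding Vf_nonzero[OF t] by auto
  then have "supp (Vf t) \<subseteq> {..- ra (- t)} \<union> {ra t..}"
    unfolding cl by (rule closure_minimal) (intro closed_Un closed_atMost closed_atLeast)
  \<comment> \<open>The midpoint of the gap between the two arches; it is outside the support but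
    between two of its points.\<close>
  then have z: "(ra t - ra (- t)) / 2 \<notin> supp (Vf t)" using gap by (auto simp: field_simps)
  have m: "(ra t + rc t) / 2 \<in> {x. Vf t x \<noteq> 0}" "- (ra (- t) + rc (- t)) / 2 \<in> {x. Vf t x \<noteq> 0}"
    unfolding Vf_nonzero[OF t] using lt by (auto simp: field_simps)
  have sub: "{x. Vf t x \<noteq> 0} \<subseteq> supp (Vf t)" unfolding cl by (rule closure_subset)
  have "{- (ra (- t) + rc (- t)) / 2..(ra t + rc t) / 2} \<subseteq> supp (Vf t)"
    by (rule connected_contains_Icc[OF con subsetD[OF sub m(2)] subsetD[OF sub m(1)]])
  moreover have "(ra t - ra (- t)) / 2 \<in> {- (ra (- t) + rc (- t)) / 2..(ra t + rc t) / 2}"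
    using lt r gap by (auto simp: field_simps)
  ultimately show False using z by blast
qed

lemma disconnected_interior:
  assumes t: "t \<in> {-T..T} - {-T, T}"
  shows "\<not> connected (supp (Vf t))"
proof -
  have tt: "t \<in> {-T<..<T}" using t by auto
  show ?thesis
    using sinv_interior[OF dom_interior(1,2)[OF tt]] sinv_interior[OF dom_interior(3,4)[OF tt]] t
    by (intro disconnected_supp_Vf) auto
qed

text \<open>Here the curve stops because \<open>chi smax\<close> is reached: at t = T the right half
  line has lost v, at t = -T the left one.\<close>

lemma connected_ends:
  assumes e: "chi smax \<le> - chi 0" and t: "t \<in> {-T, T}"
  shows "connected (supp (Vf t))"
proof -
  have "T = chi smax" using e by (simp add: T_def)
  then show ?thesis using t sinv_ends T_pos by (intro connected_supp_Vf) auto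
qed

text \<open>Here the curve stops at the value \<open>chi 0\<close>: one inner radius is 0 and the
  other lies strictly inside its range, so both arches survive with a gap between them.\<close>

lemma disconnected_ends:
  assumes e: "- chi 0 < chi smax" and t: "t \<in> {-T, T}"
  shows "\<not> connected (supp (Vf t))"
proof -
  have T: "T = - chi 0" using e by (simp add: T_def)
  have "0 < sinv T" "sinv T < smax" "sinv (- T) = 0"
    using sinv_interior[of T] T e T_pos chi_0_neg sinv_ends by auto
  then show ?thesis using t T_pos smax by (intro disconnected_supp_Vf) auto
qed

end

section \<open>Thresholds and the original system\<close>

lemma has_weak_derivative_cmult:
  assumes "has_weak_derivative u v"
  shows "has_weak_derivative (\<lambda>x. k * u x) (\<lambda>x. k * v x)"
  using assms unfolding has_weak_derivative_def locally_integrable_def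
  by (auto simp: mult.assoc)

lemma H1_cmult:
  assumes "u \<in> H1"
  shows "(\<lambda>x. k * u x) \<in> H1"
proof -
  have L2: "(\<lambda>x. k * w x) \<in> L2" if "w \<in> L2" for w
    using that by (auto simp: L2_def power_mult_distrib)
  show ?thesis using assms L2 has_weak_derivative_cmult unfolding H1_def by blast
qed

lemma admissible_cmult:
  assumes "admissible m u" "0 < k"
  shows "admissible (k * m) (\<lambda>x. k * u x)"
proof -
  have "integrable lebesgue (\<lambda>x. k * ((1 + x\<^sup>2) * u x))" using assms(1) unfolding admissible_def
    by (intro integrable_mult_right) auto
  moreover have "(\<lambda>x. k * ((1 + x\<^sup>2) * u x)) = (\<lambda>x. (1 + x\<^sup>2) * (k * u x))" by (auto simp: algebra_simps)
  moreover have "AE x in lebesgue. 0 \<le> k * u x"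
    using assms unfolding admissible_def by (auto elim!: eventually_mono)
  ultimately show ?thesis using assms H1_cmult[of u k] by (auto simp: admissible_def)
qed

lemma K_space_H1_iff: "u \<in> K_space \<inter> H1 \<longleftrightarrow> admissible 1 u"
proof -
  have eq: "norm_L1 u = (LINT x|lebesgue. u x)" if "u \<in> borel_measurable lebesgue" "AE x in lebesgue. 0 \<le> u x"
    unfolding norm_L1_def
    by (rule integral_cong_AE) (use that in \<open>auto elim!: eventually_mono\<close>)
  show ?thesis using eq by (auto simp: K_space_def admissible_def H1_def)
qed

lemma eq_ae_cmult: "k \<noteq> 0 \<Longrightarrow> eq_ae (\<lambda>x. k * u x) v \<longleftrightarrow> eq_ae u (\<lambda>x. v x / k)"
  unfolding eq_ae_def by (rule arg_cong[where f="\<lambda>P. eventually P _"]) (auto simp: field_simps)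

text \<open>Evenness almost everywhere is to be transferred between almost everywhere equal
  functions, which also requires equality at the reflected points; reflection, being differentiable,
  preserves null sets.\<close>

lemma AE_reflect:
  fixes P :: "real \<Rightarrow> bool"
  assumes "AE x in lebesgue. P x"
  shows "AE x in lebesgue. P (- x)"
proof -
  have "negligible {x. \<not> P x}"
    using assms by (auto simp: eventually_ae_filter negligible_iff_null_sets intro: null_sets_completion_subset)
  then have "negligible (uminus ` {x. \<not> P x})"
    by (rule negligible_differentiable_image_negligible[rotated]) (auto intro!: derivative_intros)
  moreover have "uminus ` {x. \<not> P x} = {x. \<not> P (- x)}"
    by (auto simp: image_iff) (metis minus_minus)
  ultimately have "{x. \<not> P (- x)} \<in> null_sets lebesgue" by (simp add: negligible_iff_null_sets)
  then show ?thesis by (rule AE_I') auto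
qed

lemma even_ae_cong:
  assumes "eq_ae u v" "even_ae u"
  shows "even_ae v"
  using assms(1)[unfolded eq_ae_def] AE_reflect[OF assms(1)[unfolded eq_ae_def]] assms(2) unfolding even_ae_def
  by eventually_elim simp

lemma (in cross) integral_energy_density:
  assumes i: "integrable lebesgue (\<lambda>x. (u x)\<^sup>2)" "integrable lebesgue (\<lambda>x. (v x)\<^sup>2)" "integrable lebesgue (\<lambda>x. u x * v x)"
    "integrable lebesgue (\<lambda>x. u x * x\<^sup>2)" "integrable lebesgue (\<lambda>x. v x * x\<^sup>2)"
  shows "(LINT x|lebesgue. energy_density (u x) (v x) x) =
    \<sigma> / 2 * (LINT x|lebesgue. (u x)\<^sup>2) + \<rho> * \<sigma> * (LINT x|lebesgue. u x * v x) + \<rho> / 2 * (LINT x|lebesgue. (v x)\<^sup>2)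
    + \<sigma> * A / 2 * (LINT x|lebesgue. u x * x\<^sup>2) + \<rho> * B / 2 * (LINT x|lebesgue. v x * x\<^sup>2)"
proof -
  have "energy_density (u x) (v x) x = \<sigma> / 2 * (u x)\<^sup>2 + \<rho> * \<sigma> * (u x * v x) + \<rho> / 2 * (v x)\<^sup>2
    + \<sigma> * A / 2 * (u x * x\<^sup>2) + \<rho> * B / 2 * (v x * x\<^sup>2)" for x
    by (simp add: energy_density_def field_simps)
  then show ?thesis using i by simp
qed

text \<open>Comparison of coefficients: with u = \<open>\<eta>\<^sup>2 * F\<close> the energy is a
  fixed positive multiple of the integral of \<open>energy_density\<close>. Continuity and compact
  support make the five integrals involved finite.\<close>

lemma continuous_compact_energy:
  fixes u v :: "real \<Rightarrow> real"
  assumes c: "continuous_on UNIV u" "continuous_on UNIV v" and z: "\<And>x. k < \<bar>x\<bar> \<Longrightarrow> u x = 0 \<and> v x = 0"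
    and pos: "0 < R" "0 < R\<mu>" "0 < \<eta>"
  shows "energy R R\<mu> \<eta> (\<lambda>x. u x / \<eta>\<^sup>2) v = (1 + R) / \<eta>\<^sup>2 *
    (LINT x|lebesgue. cross.energy_density (R / (1 + R)) 1 (1 / (3 * (1 + R))) (1 / (3 * R\<mu>)) (u x) (v x) x)"
proof -
  have cr: "cross (R / (1 + R)) 1 (1 / (3 * (1 + R))) (1 / (3 * R\<mu>))"
    using pos by unfold_locales auto
  have i: "integrable lebesgue (\<lambda>x. (u x)\<^sup>2)" "integrable lebesgue (\<lambda>x. (v x)\<^sup>2)" "integrable lebesgue (\<lambda>x. u x * v x)"
    "integrable lebesgue (\<lambda>x. u x * x\<^sup>2)" "integrable lebesgue (\<lambda>x. v x * x\<^sup>2)"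
    by (rule integrable_continuous_compact_support[where k=k]; use c z in \<open>auto intro!: continuous_intros\<close>)+
  define I1 I2 I3 I4 I5 where "I1 = (LINT x|lebesgue. (u x)\<^sup>2)" and "I2 = (LINT x|lebesgue. (v x)\<^sup>2)"
    and "I3 = (LINT x|lebesgue. u x * v x)" and "I4 = (LINT x|lebesgue. u x * x\<^sup>2)" and "I5 = (LINT x|lebesgue. v x * x\<^sup>2)"
  have n1: "(norm_L2 (\<lambda>x. u x / \<eta>\<^sup>2))\<^sup>2 = I1 / \<eta> ^ 4"
  proof -
    have "(norm_L2 (\<lambda>x. u x / \<eta>\<^sup>2))\<^sup>2 = (LINT x|lebesgue. (u x / \<eta>\<^sup>2)\<^sup>2)"
      unfolding norm_L2_def by (rule real_sqrt_pow2) (rule integral_nonneg_AE, simp)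
    also have "\<dots> = I1 / \<eta> ^ 4" unfolding I1_def by (simp add: power_divide flip: power_mult)
    finally show ?thesis .
  qed
  have n2: "(norm_L2 (\<lambda>x. \<eta> * (u x / \<eta>\<^sup>2) + v x / \<eta>))\<^sup>2 = (I1 + 2 * I3 + I2) / \<eta>\<^sup>2"
  proof -
    have "(norm_L2 (\<lambda>x. \<eta> * (u x / \<eta>\<^sup>2) + v x / \<eta>))\<^sup>2 = (LINT x|lebesgue. (\<eta> * (u x / \<eta>\<^sup>2) + v x / \<eta>)\<^sup>2)"
      unfolding norm_L2_def by (rule real_sqrt_pow2) (rule integral_nonneg_AE, simp)
    also have "\<dots> = (LINT x|lebesgue. ((u x)\<^sup>2 + 2 * (u x * v x) + (v x)\<^sup>2) / \<eta>\<^sup>2)"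
      by (rule Bochner_Integration.integral_cong) (use pos in \<open>auto simp: field_simps power2_eq_square\<close>)
    also have "\<dots> = (I1 + 2 * I3 + I2) / \<eta>\<^sup>2" using i by (simp add: I1_def I2_def I3_def)
    finally show ?thesis .
  qed
  have n3: "(LINT x|lebesgue. (u x / \<eta>\<^sup>2 + R / (\<eta>\<^sup>2 * R\<mu>) * v x) * x\<^sup>2) = (I4 + R / R\<mu> * I5) / \<eta>\<^sup>2"
  proof -
    have "(LINT x|lebesgue. (u x / \<eta>\<^sup>2 + R / (\<eta>\<^sup>2 * R\<mu>) * v x) * x\<^sup>2) = (LINT x|lebesgue. (u x * x\<^sup>2 + R / R\<mu> * (v x * x\<^sup>2)) / \<eta>\<^sup>2)"
      by (rule Bochner_Integration.integral_cong) (use pos in \<open>auto simp: field_simps\<close>)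
    also have "\<dots> = (I4 + R / R\<mu> * I5) / \<eta>\<^sup>2" using i by (simp add: I4_def I5_def)
    finally show ?thesis .
  qed
  have n4: "(LINT x|lebesgue. cross.energy_density (R / (1 + R)) 1 (1 / (3 * (1 + R))) (1 / (3 * R\<mu>)) (u x) (v x) x)
      = I1 / 2 + R / (1 + R) * I3 + R / (1 + R) / 2 * I2 + 1 / (3 * (1 + R)) / 2 * I4 + R / (1 + R) * (1 / (3 * R\<mu>)) / 2 * I5"
    using cross.integral_energy_density[OF cr i] by (simp add: I1_def I2_def I3_def I4_def I5_def)
  have "energy R R\<mu> \<eta> (\<lambda>x. u x / \<eta>\<^sup>2) v = \<eta>\<^sup>2 / 2 * (I1 / \<eta> ^ 4) + R / 2 * ((I1 + 2 * I3 + I2) / \<eta>\<^sup>2) + 1 / 6 * ((I4 + R / R\<mu> * I5) / \<eta>\<^sup>2)"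
    unfolding energy_def Let_def n1 n2 n3 ..
  also have "\<eta>\<^sup>2 / 2 * (I1 / \<eta> ^ 4) = I1 / (2 * \<eta>\<^sup>2)" using pos by (simp add: field_simps power4_eq_xxxx power2_eq_square)
  also have "I1 / (2 * \<eta>\<^sup>2) + R / 2 * ((I1 + 2 * I3 + I2) / \<eta>\<^sup>2) + 1 / 6 * ((I4 + R / R\<mu> * I5) / \<eta>\<^sup>2)
     = (I1 / 2 + R / 2 * (I1 + 2 * I3 + I2) + (I4 + R / R\<mu> * I5) / 6) / \<eta>\<^sup>2"
    using pos by (simp add: field_simps)
  also have "I1 / 2 + R / 2 * (I1 + 2 * I3 + I2) + (I4 + R / R\<mu> * I5) / 6
     = (1 + R) * (I1 / 2 + R / (1 + R) * I3 + R / (1 + R) / 2 * I2 + 1 / (3 * (1 + R)) / 2 * I4 + R / (1 + R) * (1 / (3 * R\<mu>)) / 2 * I5)"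
  proof -
    \<comment> \<open>Naming the fractions leaves a polynomial identity, given the three relations
      in \<open>c\<close>.\<close>
    define r t w where "r = R / (1 + R)" and "t = 1 / (3 * (1 + R))" and "w = 1 / (3 * R\<mu>)"
    have c: "(1 + R) * r = R" "(1 + R) * t = 1 / 3" "R / R\<mu> = 3 * (R * w)" using pos by (simp_all add: r_def t_def w_def)
    have "(1 + R) * (I1 / 2 + r * I3 + r / 2 * I2 + t / 2 * I4 + r * w / 2 * I5)
       = (1 + R) * I1 / 2 + (1 + R) * r * I3 + (1 + R) * r / 2 * I2 + (1 + R) * t / 2 * I4 + (1 + R) * r * w / 2 * I5"
      by (simp add: algebra_simps add_divide_distrib)
    then show ?thesis unfolding r_def[symmetric] t_def[symmetric] w_def[symmetric] c
      by (simp add: algebra_simps add_divide_distrib)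
  qed
  finally show ?thesis unfolding n4 by simp
qed

text \<open>Dividing the first potential by 1 + R and the second by R\<mu> normalises both
  self-interactions to 1; the product conditions are insensitive to nonzero factors, in the density
  as well as in the derivative.\<close>

lemma stationary_solution_iff:
  assumes pos: "0 < R" "0 < R\<mu>" "0 < \<eta>"
  shows "stationary_solution R R\<mu> \<eta> F G \<longleftrightarrow>
    weak_sol (R / (1 + R)) 1 (1 / (3 * (1 + R))) (1 / (3 * R\<mu>)) (\<eta>\<^sup>2) 1 (\<lambda>x. \<eta>\<^sup>2 * F x) G"
proof -
  have e: "0 < \<eta>\<^sup>2" using pos by simp
  have adm: "admissible 1 F \<longleftrightarrow> admissible (\<eta>\<^sup>2) (\<lambda>x. \<eta>\<^sup>2 * F x)"
    using admissible_cmult[of 1 F "\<eta>\<^sup>2"] admissible_cmult[of "\<eta>\<^sup>2" "\<lambda>x. \<eta>\<^sup>2 * F x" "1 / \<eta>\<^sup>2"] e pos by auto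
  have P1: "(\<lambda>x. (1 + R) * \<eta>\<^sup>2 * F x + R * G x + x\<^sup>2 / 6)
      = (\<lambda>x. (1 + R) * (\<eta>\<^sup>2 * F x + R / (1 + R) * G x + 1 / (3 * (1 + R)) * x\<^sup>2 / 2))"
  proof
    fix x
    define r s where "r = R / (1 + R)" and "s = 1 / (3 * (1 + R))"
    have c: "(1 + R) * r = R" "(1 + R) * s = 1 / 3" using pos by (simp_all add: r_def s_def)
    have "(1 + R) * (\<eta>\<^sup>2 * F x + r * G x + s * x\<^sup>2 / 2) = (1 + R) * \<eta>\<^sup>2 * F x + (1 + R) * r * G x + (1 + R) * s * x\<^sup>2 / 2"
      by (simp add: algebra_simps add_divide_distrib)
    then show "(1 + R) * \<eta>\<^sup>2 * F x + R * G x + x\<^sup>2 / 6 = (1 + R) * (\<eta>\<^sup>2 * F x + R / (1 + R) * G x + 1 / (3 * (1 + R)) * x\<^sup>2 / 2)"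
      unfolding r_def[symmetric] s_def[symmetric] c by simp
  qed
  have P2: "(\<lambda>x. R\<mu> * \<eta>\<^sup>2 * F x + R\<mu> * G x + x\<^sup>2 / 6)
      = (\<lambda>x. R\<mu> * (1 * (\<eta>\<^sup>2 * F x) + G x + 1 / (3 * R\<mu>) * x\<^sup>2 / 2))"
    using pos by (auto simp: field_simps)
  have ex: "(\<exists>D. has_weak_derivative (\<lambda>x. k * P x) D \<and> (AE x in lebesgue. w x * D x = 0))
     \<longleftrightarrow> (\<exists>D. has_weak_derivative P D \<and> (AE x in lebesgue. l * w x * D x = 0))" if "k \<noteq> 0" "l \<noteq> 0" for k l :: real and P w
  proof
    assume "\<exists>D. has_weak_derivative (\<lambda>x. k * P x) D \<and> (AE x in lebesgue. w x * D x = 0)"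
    then obtain D where D: "has_weak_derivative (\<lambda>x. k * P x) D" "AE x in lebesgue. w x * D x = 0" by blast
    have "has_weak_derivative P (\<lambda>x. 1 / k * D x)"
      using has_weak_derivative_cmult[OF D(1), of "1 / k"] that by simp
    moreover have "AE x in lebesgue. l * w x * (1 / k * D x) = 0" using D(2) by eventually_elim auto
    ultimately show "\<exists>D. has_weak_derivative P D \<and> (AE x in lebesgue. l * w x * D x = 0)" by blast
  next
    assume "\<exists>D. has_weak_derivative P D \<and> (AE x in lebesgue. l * w x * D x = 0)"
    then obtain D where D: "has_weak_derivative P D" "AE x in lebesgue. l * w x * D x = 0" by blast
    have "has_weak_derivative (\<lambda>x. k * P x) (\<lambda>x. k * D x)" using D(1) by (rule has_weak_derivative_cmult)
    moreover have "AE x in lebesgue. w x * (k * D x) = 0" using D(2) by eventually_elim (use that in auto)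
    ultimately show "\<exists>D. has_weak_derivative (\<lambda>x. k * P x) D \<and> (AE x in lebesgue. w x * D x = 0)" by blast
  qed
  have "stationary_solution R R\<mu> \<eta> F G \<longleftrightarrow> admissible 1 F \<and> admissible 1 G \<and>
      (\<exists>D. has_weak_derivative (\<lambda>x. (1 + R) * \<eta>\<^sup>2 * F x + R * G x + x\<^sup>2 / 6) D \<and> (AE x in lebesgue. F x * D x = 0)) \<and>
      (\<exists>D. has_weak_derivative (\<lambda>x. R\<mu> * \<eta>\<^sup>2 * F x + R\<mu> * G x + x\<^sup>2 / 6) D \<and> (AE x in lebesgue. G x * D x = 0))"
    unfolding stationary_solution_def K_space_H1_iff by blast
  also have "\<dots> \<longleftrightarrow> weak_sol (R / (1 + R)) 1 (1 / (3 * (1 + R))) (1 / (3 * R\<mu>)) (\<eta>\<^sup>2) 1 (\<lambda>x. \<eta>\<^sup>2 * F x) G"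
    unfolding P1 P2 weak_sol_def adm
    using ex[of "1 + R" "\<eta>\<^sup>2" _ F] ex[of "R\<mu>" 1 _ G] pos by (simp; blast)
  finally show ?thesis .
qed

section \<open>The two threshold equations\<close>

definition "threshold_fun R e s = sqrt (s - R) * (e - sqrt ((1 + R) / s))"

text \<open>Both factors increase, but for their product to increase the second one has to be
  positive; this is what positivity of the value at s provides.\<close>

lemma threshold_fun_less:
  assumes R: "0 < R" and s: "R + 1 < s" "s < t" and pos: "0 < threshold_fun R e s"
  shows "threshold_fun R e s < threshold_fun R e t"
proof -
  have "0 < sqrt (s - R)" using s by simp
  then have e: "0 < e - sqrt ((1 + R) / s)" using pos unfolding threshold_fun_def by (simp add: zero_less_mult_iff)
  have "(1 + R) / t < (1 + R) / s" using R s by (intro divide_strict_left_mono) auto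
  then have "e - sqrt ((1 + R) / s) < e - sqrt ((1 + R) / t)" by simp
  moreover have "sqrt (s - R) < sqrt (t - R)" using s by simp
  ultimately show ?thesis unfolding threshold_fun_def using e s by (intro mult_strict_mono) auto
qed

lemma threshold_high:
  assumes R: "0 < R" and e: "0 < e"
  shows "\<exists>RM. R + ((1 + e) / e)\<^sup>2 < RM \<and> {s. R + 1 < s \<and> threshold_fun R e s = 1 + e} = {RM} \<and>
    (\<forall>s. R + 1 < s \<longrightarrow> (1 + e \<le> threshold_fun R e s \<longleftrightarrow> RM \<le> s))"
proof -
  define r where "r = (1 + e) / e"
  have r: "1 < r" "r * e = 1 + e" using e by (auto simp: r_def field_simps)
  have r2: "1 < r\<^sup>2" using r by (simp add: one_less_power)
  \<comment> \<open>Large enough for sqrt (X - R) \<ge> 2 r and e - sqrt ((1 + R) / X) \<ge> e / 2,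
    so that the product is at least r e = 1 + e.\<close>
  define X where "X = R + 4 * r\<^sup>2 + 4 * (1 + R) / e\<^sup>2"
  have X: "R + 4 * r\<^sup>2 \<le> X" "4 * (1 + R) / e\<^sup>2 \<le> X" "R + r\<^sup>2 \<le> X" using R e by (auto simp: X_def)
  \<comment> \<open>At R + r^2 the first factor is r, and r e = 1 + e, so the subtracted root leaves
    the value strictly below. This point is \<open>R\<mu>_plus\<close> when e is the square of
    \<eta>, hence the strict inequality between the two thresholds.\<close>
  have low: "threshold_fun R e (R + r\<^sup>2) < 1 + e"
  proof -
    have "0 < R + r\<^sup>2" using R r2 by linarith
    then have "0 < r * sqrt ((1 + R) / (R + r\<^sup>2))" using R r by simp
    then show ?thesis using r by (simp add: threshold_fun_def right_diff_distrib)
  qed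
  have high: "1 + e \<le> threshold_fun R e X"
  proof -
    have "2 * r = sqrt ((2 * r)\<^sup>2)" by (rule real_sqrt_unique[OF refl, symmetric]) (use r in simp)
    also have "\<dots> \<le> sqrt (X - R)" using X(1) by (intro real_sqrt_le_mono) (simp add: power_mult_distrib)
    finally have 1: "2 * r \<le> sqrt (X - R)" .
    have X0: "0 < X" and XR: "R \<le> X" using X(1) R r2 by simp_all
    have "(1 + R) / X \<le> (e / 2)\<^sup>2" using X(2) X0 e by (simp add: field_simps power2_eq_square)
    then have "sqrt ((1 + R) / X) \<le> sqrt ((e / 2)\<^sup>2)" by (rule real_sqrt_le_mono)
    then have 2: "e / 2 \<le> e - sqrt ((1 + R) / X)" using e by simp
    have "2 * r * (e / 2) \<le> threshold_fun R e X"
      unfolding threshold_fun_def using 1 2 r e XR by (intro mult_mono) auto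
    then show ?thesis using r by simp
  qed
  have "continuous_on {R + r\<^sup>2..X} (threshold_fun R e)"
    unfolding threshold_fun_def[abs_def] using R r2 by (auto intro!: continuous_intros)
  then obtain RM where RM: "R + r\<^sup>2 \<le> RM" "RM \<le> X" "threshold_fun R e RM = 1 + e"
    using IVT'[of "threshold_fun R e" "R + r\<^sup>2" "1 + e" X] low high X(3) by auto
  have gt: "R + r\<^sup>2 < RM" using RM(1,3) low by (cases "RM = R + r\<^sup>2") auto
  then have RM1: "R + 1 < RM" using r2 by simp
  have below: "threshold_fun R e s < 1 + e" if "R + 1 < s" "s < RM" for s
  proof (cases "0 < threshold_fun R e s")
    case True
    then show ?thesis using threshold_fun_less[OF R that, of e] RM(3) by simp
  next
    case False
    then show ?thesis using e by linarith
  qed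
  have above: "1 + e < threshold_fun R e s" if "RM < s" for s
    using threshold_fun_less[OF R RM1 that, of e] RM(3) e by simp
  have iff: "1 + e \<le> threshold_fun R e s \<longleftrightarrow> RM \<le> s" if "R + 1 < s" for s
    using below[OF that] above[of s] RM(3) by (cases s RM rule: linorder_cases) simp_all
  have uniq: "s = RM" if "R + 1 < s" "threshold_fun R e s = 1 + e" for s
    using below[OF that(1)] above[of s] that(2) by (cases s RM rule: linorder_cases) simp_all
  have set: "{s. R + 1 < s \<and> threshold_fun R e s = 1 + e} = {RM}"
  proof (rule set_eqI)
    fix s show "s \<in> {s. R + 1 < s \<and> threshold_fun R e s = 1 + e} \<longleftrightarrow> s \<in> {RM}"
      using uniq[of s] RM1 RM(3) by (cases "s = RM") auto
  qed
  show ?thesis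
  proof (intro exI[of _ RM] conjI allI impI)
    show "R + ((1 + e) / e)\<^sup>2 < RM" using gt by (simp only: r_def)
    show "1 + e \<le> threshold_fun R e s \<longleftrightarrow> RM \<le> s" if "R + 1 < s" for s using that by (rule iff)
  qed (rule set)
qed

text \<open>The involution D s = R (1 + R) / s exchanges (0, R) and (R + 1, \<infinity>) and turns
  this equation into the upper one with e = 1 / k, up to a factor k. So Rm = D RM, and D reverses
  all inequalities.\<close>

lemma threshold_low:
  assumes R: "0 < R" and k: "0 < k"
  shows "\<exists>Rm. 0 < Rm \<and> Rm < R * (1 + R) / (R + (1 + k)\<^sup>2) \<and>
    {s. 0 < s \<and> s < R \<and> sqrt (1 + R - s) * (sqrt (R / s) - k) = 1 + k} = {Rm} \<and>
    (\<forall>s. 0 < s \<and> s < R \<longrightarrow> (1 + k \<le> sqrt (1 + R - s) * (sqrt (R / s) - k) \<longleftrightarrow> s \<le> Rm))"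
proof -
  define D where "D s = R * (1 + R) / s" for s
  have k1: "0 < 1 / k" using k by simp
  have k2: "(1 + 1 / k) / (1 / k) = 1 + k" using k by (simp add: field_simps)
  obtain RM where RM: "R + (1 + k)\<^sup>2 < RM" "{s. R + 1 < s \<and> threshold_fun R (1 / k) s = 1 + 1 / k} = {RM}"
    "\<And>s. R + 1 < s \<Longrightarrow> 1 + 1 / k \<le> threshold_fun R (1 / k) s \<longleftrightarrow> RM \<le> s"
    using threshold_high[OF R k1] unfolding k2 by auto
  have "1 < (1 + k)\<^sup>2" by (rule one_less_power) (use k in auto)
  then have RM1: "R + 1 < RM" using RM(1) by linarith
  have Dr: "R + 1 < D s \<longleftrightarrow> s < R" if "0 < s" for s
  proof -
    have "R + 1 < D s \<longleftrightarrow> (1 + R) * s < (1 + R) * R" using that by (simp add: D_def field_simps)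
    then show ?thesis using R by (simp only: mult_less_cancel_left_pos)
  qed
  have DD: "D (D s) = s" if "0 < s" for s using that R by (simp add: D_def)
  have Dle: "D s \<le> t \<longleftrightarrow> D t \<le> s" if "0 < s" "0 < t" for s t using that by (simp add: D_def field_simps)
  have Dpos: "0 < D s" if "0 < s" for s using that R by (simp add: D_def)
  have f: "sqrt (1 + R - s) * (sqrt (R / s) - k) = k * threshold_fun R (1 / k) (D s)" if s: "0 < s" "s < R" for s
  proof -
    have 1: "D s - R = (1 + R - s) * (R / s)" using s by (simp add: D_def field_simps)
    have 2: "(1 + R) / D s = s / R"
    proof -
      have "s * D s = R * (1 + R)" using s by (simp add: D_def)
      then show ?thesis using R Dpos[OF s(1)] by (simp add: field_simps)
    qed
    have 3: "sqrt (R / s) * sqrt (s / R) = 1" using s by (simp flip: real_sqrt_mult)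
    have "k * threshold_fun R (1 / k) (D s) = sqrt (1 + R - s) * (sqrt (R / s) * (k * (1 / k)) - k * (sqrt (R / s) * sqrt (s / R)))"
      unfolding threshold_fun_def 1 2 real_sqrt_mult by (simp add: algebra_simps)
    then show ?thesis using k 3 by simp
  qed
  define Rm where "Rm = D RM"
  have Rm: "0 < Rm" "Rm < R" "D Rm = RM"
  proof -
    have RM0: "0 < RM" using RM1 R by simp
    show 0: "0 < Rm" unfolding Rm_def by (rule Dpos[OF RM0])
    show 1: "D Rm = RM" unfolding Rm_def by (rule DD[OF RM0])
    show "Rm < R" using Dr[OF 0] 1 RM1 by simp
  qed
  have eq: "sqrt (1 + R - s) * (sqrt (R / s) - k) = 1 + k \<longleftrightarrow> threshold_fun R (1 / k) (D s) = 1 + 1 / k" if s: "0 < s" "s < R" for s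
    using f[OF s] k by (simp add: field_simps)
  show ?thesis
  proof (intro exI[of _ Rm] conjI allI impI)
    show "0 < Rm" by (rule Rm)
    have "0 < R + (1 + k)\<^sup>2" using R by (simp add: add_pos_nonneg)
    then show "Rm < R * (1 + R) / (R + (1 + k)\<^sup>2)"
      unfolding Rm_def D_def using RM(1) R by (intro divide_strict_left_mono) auto
    have "s = Rm" if "0 < s" "s < R" "sqrt (1 + R - s) * (sqrt (R / s) - k) = 1 + k" for s
    proof -
      have "D s \<in> {s. R + 1 < s \<and> threshold_fun R (1 / k) s = 1 + 1 / k}" using that eq Dr by auto
      then have "D s = RM" unfolding RM(2) by simp
      then show ?thesis using DD[of s] that by (simp add: Rm_def)
    qed
    moreover have "sqrt (1 + R - Rm) * (sqrt (R / Rm) - k) = 1 + k"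
      using RM(2) eq[OF Rm(1,2)] Rm(3) by auto
    ultimately show "{s. 0 < s \<and> s < R \<and> sqrt (1 + R - s) * (sqrt (R / s) - k) = 1 + k} = {Rm}"
      using Rm by blast
    fix s assume "0 < s \<and> s < R"
    then have s: "0 < s" "s < R" by auto
    show "1 + k \<le> sqrt (1 + R - s) * (sqrt (R / s) - k) \<longleftrightarrow> s \<le> Rm"
    proof -
      have "1 + k \<le> k * threshold_fun R (1 / k) (D s) \<longleftrightarrow> 1 + 1 / k \<le> threshold_fun R (1 / k) (D s)"
        using k by (simp add: field_simps)
      also have "\<dots> \<longleftrightarrow> RM \<le> D s" using RM(3)[of "D s"] s Dr by simp
      also have "\<dots> \<longleftrightarrow> s \<le> Rm" using Dle[of Rm "D s"] Rm DD[of s] Dpos[of s] s by simp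
      finally show ?thesis using f[OF s] by simp
    qed
  qed
qed

section \<open>Comparison with the prescribed profiles\<close>

context cross_family
begin

text \<open>The central formula uses the left radii although it also holds to the right of 0: both
  sides have the same value at the centre.\<close>

lemma Uf_explicit:
  assumes t: "t \<in> {-T..T}"
  shows "Uf t x =
     (if x \<in> {- rb (- t)..- ra (- t)} then p * ((rb (- t))\<^sup>2 - x\<^sup>2) / 2
      else if x \<in> {- ra (- t)..ra t} then (p * (rb (- t))\<^sup>2 + \<rho> * q * (ra (- t))\<^sup>2 - A * x\<^sup>2) / 2
      else if x \<in> {ra t..rb t} then p * ((rb t)\<^sup>2 - x\<^sup>2) / 2 else 0)"
proof -
  note g = family_profile(1)[OF t] family_profile(1)[OF dom(3)[OF t]]
  note r = family_radii[OF t] family_radii[OF dom(3)[OF t]]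
  have u0: "p * (rb t)\<^sup>2 + \<rho> * q * (ra t)\<^sup>2 = p * (rb (- t))\<^sup>2 + \<rho> * q * (ra (- t))\<^sup>2"
    using family_at_0(1)[OF t] r by (simp add: profile_at_0)
  consider "0 < x" | "x < 0" | "x = 0" by linarith
  then show ?thesis
  proof cases
    case 1
    then have "Uf t x = hu (ra t) (rb t) x" by (simp add: Uf_def glue_def)
    then show ?thesis using half_profile_values(1-3)[OF g(1), of x] 1 r u0 by auto
  next
    case 2
    then have "Uf t x = hu (ra (- t)) (rb (- t)) (- x)" by (simp add: Uf_def glue_def hu_even)
    then show ?thesis using half_profile_values(1-3)[OF g(2), of "- x"] 2 r by auto
  next
    case 3
    have "Uf t 0 = (p * (rb (- t))\<^sup>2 + \<rho> * q * (ra (- t))\<^sup>2) / 2"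
      using r u0 by (simp add: Uf_def glue_def profile_at_0)
    then show ?thesis using 3 r by auto
  qed
qed

text \<open>The matching condition \<open>v0\<close> turns B c^2 - \<sigma> p b^2 - q x^2 into q
  (a^2 - x^2), the form in which the profiles are prescribed between the inner and middle
  radii.\<close>

lemma Vf_explicit:
  assumes t: "t \<in> {-T..T}"
  shows "Vf t x =
     (if x \<in> {- rc (- t)..- rb (- t)} then B * ((rc (- t))\<^sup>2 - x\<^sup>2) / 2
      else if x \<in> {- rb (- t)..- ra (- t)} then q * ((ra (- t))\<^sup>2 - x\<^sup>2) / 2
      else if x \<in> {ra t..rb t} then q * ((ra t)\<^sup>2 - x\<^sup>2) / 2
      else if x \<in> {rb t..rc t} then B * ((rc t)\<^sup>2 - x\<^sup>2) / 2 else 0)"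
proof -
  note g = family_profile(1)[OF t] family_profile(1)[OF dom(3)[OF t]]
  note r = family_radii[OF t] family_radii[OF dom(3)[OF t]]
  have v0: "B * (rc t)\<^sup>2 = \<sigma> * p * (rb t)\<^sup>2 + q * (ra t)\<^sup>2"
    "B * (rc (- t))\<^sup>2 = \<sigma> * p * (rb (- t))\<^sup>2 + q * (ra (- t))\<^sup>2"
    using family_profile(3)[OF t] family_profile(3)[OF dom(3)[OF t]] r by (simp_all add: profile_at_0)
  have z: "Vf t 0 = 0" using family_profile(3)[OF t] by (simp add: Vf_def glue_def)
  have b: "0 < rb t" "0 < rb (- t)" using family_profile(4)[OF t] family_profile(4)[OF dom(3)[OF t]] by simp_all
  consider "0 < x" | "x < 0" | "x = 0" by linarith
  then show ?thesis
  proof cases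
    case 1
    then have e: "Vf t x = hv (ra t) (rb t) (rc t) x" by (simp add: Vf_def glue_def)
    consider "x < ra t" | "ra t \<le> x" "x \<le> rb t" | "rb t < x" by linarith
    then show ?thesis
    proof cases
      case 2
      then have "Vf t x = q * ((ra t)\<^sup>2 - x\<^sup>2) / 2"
        using half_profile_values(5)[OF g(1), of x] e v0(1) 1 by (simp add: right_diff_distrib)
      then show ?thesis using 1 2 r by auto
    qed (use half_profile_values(4,6,7)[OF g(1), of x] 1 r e in auto)
  next
    case 2
    then have e: "Vf t x = hv (ra (- t)) (rb (- t)) (rc (- t)) (- x)" by (simp add: Vf_def glue_def hv_even)
    consider "- x < ra (- t)" | "ra (- t) \<le> - x" "- x < rb (- t)" | "rb (- t) \<le> - x" by linarith
    then show ?thesis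
    proof cases
      case 2
      then have "Vf t x = q * ((ra (- t))\<^sup>2 - x\<^sup>2) / 2"
        using half_profile_values(5)[OF g(2), of "- x"] e v0(2) \<open>x < 0\<close> by (simp add: right_diff_distrib)
      then show ?thesis using \<open>x < 0\<close> 2 r by auto
    qed (use half_profile_values(4,6,7)[OF g(2), of "- x"] \<open>x < 0\<close> r e in auto)
  next
    case 3
    then show ?thesis using z r b by auto
  qed
qed

lemma family_zero_outside:
  assumes t: "t \<in> {-T..T}" and x: "max (rc t) (rc (- t)) < \<bar>x\<bar>"
  shows "Uf t x = 0" "Vf t x = 0"
  using x family_radii[OF t] family_radii[OF dom(3)[OF t]]
  by (auto simp: Uf_def Vf_def glue_def hu_def hv_def bump_eq_0)

definition "radii_params t = (- rc (- t), - rb (- t), - ra (- t), ra t, rb t, rc t)"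

lemma continuous_on_radii_params: "continuous_on {-T..T} radii_params"
proof -
  have "continuous_on {-T..T} (\<lambda>t. f (- t))" if "continuous_on {-T..T} f" for f :: "real \<Rightarrow> real"
    by (rule continuous_on_compose2[OF that]) (auto intro!: continuous_intros)
  then show ?thesis unfolding radii_params_def[abs_def] using continuous_on_radii
    by (intro continuous_intros) auto
qed

lemma analytic_radii_params: "radii_params real_analytic_on {-T<..<T}"
proof -
  have 1: "ra real_analytic_on {-T<..<T}" "rb real_analytic_on {-T<..<T}" "rc real_analytic_on {-T<..<T}"
    using real_holo_radii by (auto intro!: real_analytic_onI)
  have r: "real_holo (\<lambda>t. - f (- t)) t" if "\<And>t. t \<in> {-T<..<T} \<Longrightarrow> real_holo f t" "t \<in> {-T<..<T}" for f t
    using that by (intro real_holo_uminus real_holo_uminus_arg) auto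
  have 2: "(\<lambda>t. - ra (- t)) real_analytic_on {-T<..<T}" "(\<lambda>t. - rb (- t)) real_analytic_on {-T<..<T}"
    "(\<lambda>t. - rc (- t)) real_analytic_on {-T<..<T}"
    by (rule real_analytic_onI, rule r, rule real_holo_radii, assumption, assumption)+
  show ?thesis unfolding radii_params_def[abs_def]
    by (intro real_analytic_on_Pair 1 2)
qed

lemma ordered_radii_params: "t \<in> {-T..T} \<Longrightarrow> ordered_params (radii_params t)"
  using family_radii[of t] family_radii[OF dom(3)[of t]] by (simp add: ordered_params_def radii_params_def)

end

section \<open>Assembling the conclusion for a fixed R\<mu>\<close>

lemma even_pair_cong: "eq_ae u u' \<Longrightarrow> eq_ae v v' \<Longrightarrow> even_pair u v \<Longrightarrow> even_pair u' v'"
  using even_ae_cong by (auto simp: even_pair_def)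

lemma even_ae_divide: "c \<noteq> 0 \<Longrightarrow> even_ae (\<lambda>x. u x / c) \<longleftrightarrow> even_ae u"
  by (simp add: even_ae_def)

lemma supp_divide: "c \<noteq> 0 \<Longrightarrow> supp (\<lambda>x. u x / c) = supp u"
  by (simp add: supp_def)

lemma (in cross) energy_density_swap: "cross.energy_density \<sigma> \<rho> B A t s x = energy_density s t x"
  unfolding energy_density_def cross.energy_density_def[OF swap] by (simp add: algebra_simps)

lemma (in cross_family) outer_radius_sq:
  assumes "t \<in> {-T..T}"
  shows "B * (rc t)\<^sup>2 = \<sigma> * p * (rb t)\<^sup>2 + q * (ra t)\<^sup>2"
  using family_profile(3)[OF assms] family_radii[OF assms] by (simp add: profile_at_0)

text \<open>The conclusion of the theorem for one value of R\<mu>, with the thresholds as arguments;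
  its body has to match the final statement literally, because there it is only unfolded.\<close>

definition solution_family where
  "solution_family R \<eta> RM Rm R\<mu> lm lp F G \<longleftrightarrow>
        (stationary_solution R R\<mu> \<eta> (F 0) (G 0) \<and> even_pair (F 0) (G 0) \<and>
         (\<forall>F' G'. stationary_solution R R\<mu> \<eta> F' G' \<and> even_pair F' G' \<longrightarrow>
            eq_ae F' (F 0) \<and> eq_ae G' (G 0))) \<and>
        (R\<mu> \<notin> {R\<mu>_minus R \<eta>..R\<mu>_plus R \<eta>} \<longrightarrow>
           lm < 0 \<and> 0 < lp \<and>
           (\<forall>l\<in>{lm..lp}. stationary_solution R R\<mu> \<eta> (F l) (G l)) \<and>
           (\<forall>l\<in>{lm..lp}. l \<noteq> 0 \<longrightarrow> non_symmetric (F l) (G l)) \<and>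
           (\<exists>\<zeta> :: real \<Rightarrow> params.
              continuous_on {lm..lp} \<zeta> \<and> \<zeta> real_analytic_on {lm<..<lp} \<and>
              (\<forall>l\<in>{lm..lp}. ordered_params (\<zeta> l) \<and>
                 given_by_profiles R R\<mu> \<eta> (\<zeta> l) (F l) (G l)))) \<and>
        (R\<mu> \<in> {R\<mu>_minus R \<eta>..R\<mu>_plus R \<eta>} \<longrightarrow> lm = 0 \<and> lp = 0) \<and>
        (\<forall>F' G'. stationary_solution R R\<mu> \<eta> F' G' \<longrightarrow>
           (\<exists>l\<in>{lm..lp}. eq_ae F' (F l) \<and> eq_ae G' (G l))) \<and>
        (strict_antimono_on {lm..0} (\<lambda>l. energy R R\<mu> \<eta> (F l) (G l)) \<and>
         strict_mono_on {0..lp} (\<lambda>l. energy R R\<mu> \<eta> (F l) (G l))) \<and>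
        (R\<mu> \<notin> {R\<mu>_minus R \<eta>..R\<mu>_plus R \<eta>} \<longrightarrow>
           (\<forall>l\<in>{lm..lp} - {lm, lp}. \<not> connected (supp (F l)) \<or> \<not> connected (supp (G l)))) \<and>
        (R\<mu> \<notin> {Rm<..<RM} \<longrightarrow>
           (\<forall>l\<in>{lm, lp}. connected (supp (F l)) \<and> connected (supp (G l)))) \<and>
        (R\<mu> \<in> {Rm<..<R\<mu>_minus R \<eta>} \<union> {R\<mu>_plus R \<eta><..<RM} \<longrightarrow>
           (\<forall>l\<in>{lm, lp}. \<not> connected (supp (F l)) \<or> \<not> connected (supp (G l))))"

text \<open>Uniqueness of the even solution is derived, not assumed: by completeness an even
  solution is some member l of the family, and non-symmetry for l \<noteq> 0 leaves l = 0. The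
  energy enters up to a positive factor C.\<close>

lemma solution_familyI:
  assumes T: "0 < T" and out: "R\<mu> \<notin> {R\<mu>_minus R \<eta>..R\<mu>_plus R \<eta>}"
    and st: "\<And>l. l \<in> {-T..T} \<Longrightarrow> stationary_solution R R\<mu> \<eta> (F l) (G l)"
    and ns: "\<And>l. l \<in> {-T..T} \<Longrightarrow> l \<noteq> 0 \<Longrightarrow> non_symmetric (F l) (G l)"
    and ev: "even_pair (F 0) (G 0)"
    and comp: "\<And>F' G'. stationary_solution R R\<mu> \<eta> F' G' \<Longrightarrow> \<exists>l\<in>{-T..T}. eq_ae F' (F l) \<and> eq_ae G' (G l)"
    and z: "continuous_on {-T..T} \<zeta>" "\<zeta> real_analytic_on {-T<..<T}"
      "\<And>l. l \<in> {-T..T} \<Longrightarrow> ordered_params (\<zeta> l)" "\<And>l. l \<in> {-T..T} \<Longrightarrow> given_by_profiles R R\<mu> \<eta> (\<zeta> l) (F l) (G l)"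
    and C: "0 < C" "\<And>l. l \<in> {-T..T} \<Longrightarrow> energy R R\<mu> \<eta> (F l) (G l) = C * E l"
      "strict_antimono_on {-T..0} E" "strict_mono_on {0..T} E"
    and dis: "\<And>l. l \<in> {-T..T} - {-T, T} \<Longrightarrow> \<not> connected (supp (F l)) \<or> \<not> connected (supp (G l))"
    and con: "\<And>l. R\<mu> \<notin> {Rm<..<RM} \<Longrightarrow> l \<in> {-T, T} \<Longrightarrow> connected (supp (F l)) \<and> connected (supp (G l))"
    and dis_ends: "\<And>l. R\<mu> \<in> {Rm<..<R\<mu>_minus R \<eta>} \<union> {R\<mu>_plus R \<eta><..<RM} \<Longrightarrow> l \<in> {-T, T} \<Longrightarrow>
      \<not> connected (supp (F l)) \<or> \<not> connected (supp (G l))"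
  shows "solution_family R \<eta> RM Rm R\<mu> (-T) T F G"
proof -
  have uniq: "eq_ae F' (F 0) \<and> eq_ae G' (G 0)" if s: "stationary_solution R R\<mu> \<eta> F' G'" and e: "even_pair F' G'" for F' G'
  proof -
    obtain l where l: "l \<in> {-T..T}" "eq_ae F' (F l)" "eq_ae G' (G l)" using comp[OF s] by blast
    then have "even_pair (F l) (G l)" using even_pair_cong e by blast
    then have "l = 0" using ns[OF l(1)] by (auto simp: non_symmetric_def)
    then show ?thesis using l by simp
  qed
  have m1: "strict_antimono_on {-T..0} (\<lambda>l. energy R R\<mu> \<eta> (F l) (G l))"
    using C(1,3) T unfolding monotone_on_def by (auto simp: C(2))
  have m2: "strict_mono_on {0..T} (\<lambda>l. energy R R\<mu> \<eta> (F l) (G l))"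
    using C(1,4) T unfolding monotone_on_def by (auto simp: C(2))
  have s0: "stationary_solution R R\<mu> \<eta> (F 0) (G 0)" using st T by simp
  have a1: "\<forall>F' G'. stationary_solution R R\<mu> \<eta> F' G' \<and> even_pair F' G' \<longrightarrow> eq_ae F' (F 0) \<and> eq_ae G' (G 0)"
    using uniq by blast
  have a2: "\<forall>l\<in>{-T..T}. stationary_solution R R\<mu> \<eta> (F l) (G l)" using st by blast
  have a3: "\<forall>l\<in>{-T..T}. l \<noteq> 0 \<longrightarrow> non_symmetric (F l) (G l)" using ns by blast
  have a4: "\<exists>\<zeta>. continuous_on {- T..T} \<zeta> \<and> \<zeta> real_analytic_on {- T<..<T} \<and>
         (\<forall>l\<in>{- T..T}. ordered_params (\<zeta> l) \<and> given_by_profiles R R\<mu> \<eta> (\<zeta> l) (F l) (G l))"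
    using z by blast
  have a5: "\<forall>F' G'. stationary_solution R R\<mu> \<eta> F' G' \<longrightarrow> (\<exists>l\<in>{-T..T}. eq_ae F' (F l) \<and> eq_ae G' (G l))"
    using comp by blast
  have a6: "\<forall>l\<in>{-T..T} - {-T, T}. \<not> connected (supp (F l)) \<or> \<not> connected (supp (G l))"
    using dis by blast
  have a7: "\<forall>l\<in>{-T, T}. connected (supp (F l)) \<and> connected (supp (G l))" if "R\<mu> \<notin> {Rm<..<RM}"
    using con[OF that] by blast
  have a8: "\<forall>l\<in>{-T, T}. \<not> connected (supp (F l)) \<or> \<not> connected (supp (G l))"
    if "R\<mu> \<in> {Rm<..<R\<mu>_minus R \<eta>} \<union> {R\<mu>_plus R \<eta><..<RM}"
    using dis_ends[OF that] by blast
  have neg: "- T < 0" using T by simp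
  show ?thesis
    unfolding solution_family_def
    by (intro conjI impI)
      (rule s0 ev a1 neg T a2 a3 a4 a5 m1 m2 a6 | (erule a7) | (erule a8) | (erule notE[OF out]))+
qed

text \<open>Between the thresholds the family is constant. By \<open>thr\<close> the value of R\<mu>
  lies strictly between Rm and RM, so the statements about the supports at the ends are
  vacuous.\<close>

lemma solution_family_single:
  assumes u: "even_unique (R / (1 + R)) 1 (1 / (3 * (1 + R))) (1 / (3 * R\<mu>)) (\<eta>\<^sup>2) 1 u v"
    and pos: "0 < R" "0 < R\<mu>" "0 < \<eta>" and R: "R\<mu> \<in> {R\<mu>_minus R \<eta>..R\<mu>_plus R \<eta>}"
    and thr: "R\<mu>_plus R \<eta> < RM" "Rm < R\<mu>_minus R \<eta>"
  shows "solution_family R \<eta> RM Rm R\<mu> 0 0 (\<lambda>_ x. u x / \<eta>\<^sup>2) (\<lambda>_. v)"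
proof -
  have e: "\<eta>\<^sup>2 \<noteq> 0" using pos by simp
  have w: "stationary_solution R R\<mu> \<eta> (\<lambda>x. u x / \<eta>\<^sup>2) v"
    unfolding stationary_solution_iff[OF pos] using u e by (simp add: even_unique_def)
  have ev: "even_pair (\<lambda>x. u x / \<eta>\<^sup>2) v" using u e by (simp add: even_unique_def even_pair_def even_ae_divide)
  have uq: "eq_ae F' (\<lambda>x. u x / \<eta>\<^sup>2) \<and> eq_ae G' v" if "stationary_solution R R\<mu> \<eta> F' G'" for F' G'
  proof -
    have "eq_ae (\<lambda>x. \<eta>\<^sup>2 * F' x) u \<and> eq_ae G' v"
      using that u unfolding stationary_solution_iff[OF pos] even_unique_def by blast
    then show ?thesis unfolding eq_ae_cmult[OF e] .
  qed
  show ?thesis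
    unfolding solution_family_def using w ev uq R thr by (auto simp: monotone_on_def)
qed

section \<open>Coefficients and thresholds of the original system\<close>

context
  fixes R R\<mu> \<eta> :: real
  assumes prm: "0 < R" "0 < R\<mu>" "0 < \<eta>"
begin

lemma concrete_cross: "cross (R / (1 + R)) 1 (1 / (3 * (1 + R))) (1 / (3 * R\<mu>))"
  using prm by unfold_locales auto

lemma concrete_th: "cross.th (R / (1 + R)) 1 = 1 / (1 + R)"
  unfolding cross.th_def[OF concrete_cross] using prm by (simp add: field_simps)

lemma concrete_p: "cross.p (R / (1 + R)) 1 (1 / (3 * (1 + R))) (1 / (3 * R\<mu>)) = (R\<mu> - R) / (3 * R\<mu>)"
proof -
  have "1 / (3 * (1 + R)) - R / (1 + R) * (1 / (3 * R\<mu>)) = (1 / (1 + R)) * ((R\<mu> - R) / (3 * R\<mu>))"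
  proof -
    define a b where "a = 1 / (1 + R)" and "b = 1 / (3 * R\<mu>)"
    have e: "1 / (3 * (1 + R)) = a / 3" "R / (1 + R) = R * a" "(R\<mu> - R) / (3 * R\<mu>) = (R\<mu> - R) * b"
      "a / 3 = a * (R\<mu> * b)" using prm by (simp_all add: a_def b_def)
    show ?thesis unfolding e(1-3) unfolding e(4) a_def[symmetric] b_def[symmetric] by (simp add: algebra_simps)
  qed
  then show ?thesis unfolding cross.p_def[OF concrete_cross] concrete_th using prm by simp
qed

lemma concrete_q: "cross.q (R / (1 + R)) 1 (1 / (3 * (1 + R))) (1 / (3 * R\<mu>)) = (1 + R - R\<mu>) / (3 * R\<mu>)"
proof -
  have "1 / (3 * R\<mu>) - 1 * (1 / (3 * (1 + R))) = (1 / (1 + R)) * ((1 + R - R\<mu>) / (3 * R\<mu>))"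
  proof -
    define a b where "a = 1 / (1 + R)" and "b = 1 / (3 * R\<mu>)"
    have e: "1 / (3 * (1 + R)) = a / 3" "(1 + R - R\<mu>) / (3 * R\<mu>) = (1 + R - R\<mu>) * b"
      "a / 3 = a * (R\<mu> * b)" "a * (1 + R) = 1" using prm by (simp_all add: a_def b_def)
    have "b - a / 3 = a * (1 + R) * b - a * (R\<mu> * b)" unfolding e(3,4) by simp
    then show ?thesis unfolding e(1,2) unfolding a_def[symmetric] b_def[symmetric] by (simp add: algebra_simps)
  qed
  then show ?thesis unfolding cross.q_def[OF concrete_cross] concrete_th using prm by simp
qed

lemma concrete_swap: "cross 1 (R / (1 + R)) (1 / (3 * R\<mu>)) (1 / (3 * (1 + R)))"
  by (rule cross.swap[OF concrete_cross])

lemma concrete_swap_p: "cross.p 1 (R / (1 + R)) (1 / (3 * R\<mu>)) (1 / (3 * (1 + R))) = (1 + R - R\<mu>) / (3 * R\<mu>)"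
  using cross.swap_p[OF concrete_cross] concrete_q by simp

lemma concrete_swap_q: "cross.q 1 (R / (1 + R)) (1 / (3 * R\<mu>)) (1 / (3 * (1 + R))) = (R\<mu> - R) / (3 * R\<mu>)"
  using cross.swap_q[OF concrete_cross] concrete_p by simp

lemma high_locale:
  assumes "R + 1 < R\<mu>"
  shows "cross_high (R / (1 + R)) 1 (1 / (3 * (1 + R))) (1 / (3 * R\<mu>)) (\<eta>\<^sup>2) 1"
proof -
  have "(1 + R - R\<mu>) / (3 * R\<mu>) < 0" using assms prm by (intro divide_neg_pos) auto
  then show ?thesis
    unfolding cross_high_def cross_high_axioms_def concrete_q using concrete_cross prm by simp
qed

lemma low_locale:
  assumes "R\<mu> < R"
  shows "cross_high 1 (R / (1 + R)) (1 / (3 * R\<mu>)) (1 / (3 * (1 + R))) 1 (\<eta>\<^sup>2)"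
proof -
  have "(R\<mu> - R) / (3 * R\<mu>) < 0" using assms prm by (intro divide_neg_pos) auto
  then show ?thesis
    unfolding cross_high_def cross_high_axioms_def concrete_swap_q using concrete_swap prm by simp
qed

text \<open>With k = \<open>\<eta>\<^sup>2 * ((1 + R) / R)\<close>, the constant of the lower
  threshold equation, \<open>R\<mu>_minus\<close> becomes the image of R + (1 + k)^2 under s -> R (1
  + R) / s, the form used in \<open>threshold_low\<close>.\<close>

lemma R\<mu>_minus_eq: "R\<mu>_minus R \<eta> = R * (1 + R) / (R + (1 + \<eta>\<^sup>2 * ((1 + R) / R))\<^sup>2)"
proof -
  define k where "k = \<eta>\<^sup>2 * ((1 + R) / R)"
  have k: "\<eta>\<^sup>2 * (1 + R) = R * k" using prm by (simp add: k_def)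
  have "R ^ 3 * (1 + R) / (R ^ 3 + (\<eta>\<^sup>2 * (1 + R) + R)\<^sup>2) = (R\<^sup>2 * (R * (1 + R))) / (R\<^sup>2 * (R + (1 + k)\<^sup>2))"
    unfolding k by (rule arg_cong2[where f="(/)"]) (simp_all add: power2_eq_square power3_eq_cube algebra_simps)
  also have "\<dots> = R * (1 + R) / (R + (1 + k)\<^sup>2)" using prm by simp
  finally show ?thesis by (simp add: R\<mu>_minus_def k_def)
qed

text \<open>The thresholds lie beyond the sign changes of the slopes, p at R and q at R + 1. Hence
  outside the closed range between them one slope is negative, and \<open>cross_high\<close> applies
  directly or after exchanging the components.\<close>

lemma R\<mu>_bounds: "R\<mu>_minus R \<eta> < R" "R + 1 < R\<mu>_plus R \<eta>"
proof -
  define k where "k = \<eta>\<^sup>2 * ((1 + R) / R)"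
  have "0 < k" using prm by (simp add: k_def)
  then have "1 < (1 + k)\<^sup>2" by (intro one_less_power) auto
  then have "R * (1 + R) < R * (R + (1 + k)\<^sup>2)" "0 < R + (1 + k)\<^sup>2" using prm by simp_all
  then show "R\<mu>_minus R \<eta> < R" unfolding R\<mu>_minus_eq k_def[symmetric] by (simp add: pos_divide_less_eq)
  have "1 < (1 + \<eta>\<^sup>2) / \<eta>\<^sup>2" using prm by simp
  then have "1 < ((1 + \<eta>\<^sup>2) / \<eta>\<^sup>2)\<^sup>2" by (rule one_less_power) simp
  then show "R + 1 < R\<mu>_plus R \<eta>" by (simp add: R\<mu>_plus_def)
qed

text \<open>With d = sqrt (R\<mu> - R) one finds chi 0 = (w / d) ((1 + e) - e d), so chi 0 < 0 reads
  d > (1 + e) / e, and squaring gives \<open>R\<mu>_plus\<close>. Since chi smax = a, multiplying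
  the second inequality by d / w gives the comparison with \<open>threshold_fun\<close>.\<close>

lemma high_chi:
  assumes "R + 1 < R\<mu>"
  shows "cross_high.chi (R / (1 + R)) 1 (1 / (3 * (1 + R))) (1 / (3 * R\<mu>)) (\<eta>\<^sup>2) 1 0 < 0 \<longleftrightarrow> R\<mu>_plus R \<eta> < R\<mu>"
    "cross_high.chi (R / (1 + R)) 1 (1 / (3 * (1 + R))) (1 / (3 * R\<mu>)) (\<eta>\<^sup>2) 1 (cross_high.smax (1 / (3 * (1 + R))))
      \<le> - cross_high.chi (R / (1 + R)) 1 (1 / (3 * (1 + R))) (1 / (3 * R\<mu>)) (\<eta>\<^sup>2) 1 0 \<longleftrightarrow> 1 + \<eta>\<^sup>2 \<le> threshold_fun R (\<eta>\<^sup>2) R\<mu>"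
proof -
  interpret cross_high "R / (1 + R)" 1 "1 / (3 * (1 + R))" "1 / (3 * R\<mu>)" "\<eta>\<^sup>2" 1 by (rule high_locale[OF assms])
  define w d a e where "w = sqrt (3 * R\<mu>)" and "d = sqrt (R\<mu> - R)" and "a = sqrt (3 * (1 + R))" and "e = \<eta>\<^sup>2"
  have p: "0 < w" "0 < d" "0 < a" "0 < e" using prm assms by (simp_all add: w_def d_def a_def e_def)
  have c0: "chi 0 = (w / d) * ((1 + e) - e * d)"
  proof -
    have "chi 0 = (1 + e) / (d / w) - e * w"
      unfolding chi_0 concrete_p by (simp add: real_sqrt_divide w_def d_def e_def)
    then show ?thesis using p by (simp add: field_simps)
  qed
  have c1: "chi smax = a" unfolding chi_smax by (simp add: real_sqrt_divide a_def)
  have "chi 0 < 0 \<longleftrightarrow> (1 + e) / e < d"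
    unfolding c0 using p by (simp add: mult_less_0_iff divide_less_eq mult.commute)
  also have "\<dots> \<longleftrightarrow> sqrt (((1 + e) / e)\<^sup>2) < sqrt (R\<mu> - R)" using p by (simp add: d_def)
  also have "\<dots> \<longleftrightarrow> ((1 + e) / e)\<^sup>2 < R\<mu> - R" by (rule real_sqrt_less_iff)
  also have "\<dots> \<longleftrightarrow> R\<mu>_plus R \<eta> < R\<mu>" unfolding R\<mu>_plus_def e_def by linarith
  finally show "chi 0 < 0 \<longleftrightarrow> R\<mu>_plus R \<eta> < R\<mu>" .
  have t: "threshold_fun R e R\<mu> = d * (e - a / w)"
  proof -
    have "(1 + R) / R\<mu> = (3 * (1 + R)) / (3 * R\<mu>)" by (rule mult_divide_mult_cancel_left[symmetric]) simp
    then have "sqrt ((1 + R) / R\<mu>) = a / w" unfolding a_def w_def by (simp only: real_sqrt_divide)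
    then show ?thesis by (simp add: threshold_fun_def d_def)
  qed
  have "chi smax \<le> - chi 0 \<longleftrightarrow> a \<le> (w / d) * (e * d - (1 + e))"
    unfolding c0 c1 by (simp add: algebra_simps)
  also have "\<dots> \<longleftrightarrow> 1 + e \<le> d * (e - a / w)" using p by (simp add: field_simps)
  finally show "chi smax \<le> - chi 0 \<longleftrightarrow> 1 + \<eta>\<^sup>2 \<le> threshold_fun R (\<eta>\<^sup>2) R\<mu>" unfolding e_def[symmetric] t .
qed

text \<open>Here \<open>\<eta>\<^sup>2\<close> = r k, where r = R / (1 + R) is an interaction
  coefficient of the exchanged system. The factor r comes out of chi 0 and of chi smax, leaving k as
  the only trace of \<eta>.\<close>

lemma low_chi:
  assumes "R\<mu> < R"
  shows "cross_high.chi 1 (R / (1 + R)) (1 / (3 * R\<mu>)) (1 / (3 * (1 + R))) 1 (\<eta>\<^sup>2) 0 < 0 \<longleftrightarrow> R\<mu> < R\<mu>_minus R \<eta>"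
    "cross_high.chi 1 (R / (1 + R)) (1 / (3 * R\<mu>)) (1 / (3 * (1 + R))) 1 (\<eta>\<^sup>2) (cross_high.smax (1 / (3 * R\<mu>)))
      \<le> - cross_high.chi 1 (R / (1 + R)) (1 / (3 * R\<mu>)) (1 / (3 * (1 + R))) 1 (\<eta>\<^sup>2) 0 \<longleftrightarrow>
     1 + \<eta>\<^sup>2 * ((1 + R) / R) \<le> sqrt (1 + R - R\<mu>) * (sqrt (R / R\<mu>) - \<eta>\<^sup>2 * ((1 + R) / R))"
proof -
  interpret cross_high 1 "R / (1 + R)" "1 / (3 * R\<mu>)" "1 / (3 * (1 + R))" 1 "\<eta>\<^sup>2" by (rule low_locale[OF assms])
  define w d v r k where "w = sqrt (3 * R\<mu>)" and "d = sqrt (1 + R - R\<mu>)" and "v = sqrt (3 * R)" and "r = R / (1 + R)"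
    and "k = \<eta>\<^sup>2 * ((1 + R) / R)"
  have p: "0 < w" "0 < d" "0 < v" "0 < r" "0 < k" using prm assms by (simp_all add: w_def d_def v_def r_def k_def)
  have e: "\<eta>\<^sup>2 = r * k" using prm by (simp add: r_def k_def)
  have sv: "R / (1 + R) / (1 / (3 * (1 + R))) = 3 * R" using prm by (simp add: field_simps)
  have c0: "chi 0 = r * ((1 + k) * (w / d) - v)"
  proof -
    have "chi 0 = (\<eta>\<^sup>2 + r) / (d / w) - r * v"
      unfolding chi_0 concrete_swap_p sv by (simp add: real_sqrt_divide w_def d_def v_def r_def)
    then have "chi 0 = (r * k + r) / (d / w) - r * v" by (simp only: e)
    then show ?thesis using p by (simp add: field_simps)
  qed
  have c1: "chi smax = r * (k * w)"
  proof -
    have "chi smax = \<eta>\<^sup>2 * w" unfolding chi_smax by (simp add: real_sqrt_divide w_def)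
    then show ?thesis by (simp only: e mult.assoc)
  qed
  have "chi 0 < 0 \<longleftrightarrow> (1 + k) * (w / d) - v < 0"
    unfolding c0 using p by (simp add: mult_less_0_iff)
  also have "\<dots> \<longleftrightarrow> (1 + k) * w < v * d" using p by (simp add: field_simps)
  also have "\<dots> \<longleftrightarrow> sqrt ((1 + k)\<^sup>2 * (3 * R\<mu>)) < sqrt (3 * R * (1 + R - R\<mu>))"
    using p by (simp add: real_sqrt_mult w_def v_def d_def)
  also have "\<dots> \<longleftrightarrow> (1 + k)\<^sup>2 * (3 * R\<mu>) < 3 * R * (1 + R - R\<mu>)" by (rule real_sqrt_less_iff)
  also have "\<dots> \<longleftrightarrow> R\<mu> * (R + (1 + k)\<^sup>2) < R * (1 + R)" by (simp add: algebra_simps) linarith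
  also have "\<dots> \<longleftrightarrow> R\<mu> < R\<mu>_minus R \<eta>"
  proof -
    have "0 < R + (1 + k)\<^sup>2" using prm by (simp add: add_pos_nonneg)
    then show ?thesis unfolding R\<mu>_minus_eq k_def[symmetric] by (simp add: pos_less_divide_eq)
  qed
  finally show "chi 0 < 0 \<longleftrightarrow> R\<mu> < R\<mu>_minus R \<eta>" .
  have t: "sqrt (R / R\<mu>) = v / w" by (simp add: v_def w_def real_sqrt_divide real_sqrt_mult)
  have "chi smax \<le> - chi 0 \<longleftrightarrow> r * (k * w) \<le> r * (v - (1 + k) * (w / d))"
    unfolding c0 c1 by (simp add: algebra_simps)
  also have "\<dots> \<longleftrightarrow> k * w \<le> v - (1 + k) * (w / d)" using p by simp
  also have "\<dots> \<longleftrightarrow> 1 + k \<le> d * (v / w - k)" using p by (simp add: field_simps)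
  finally show "chi smax \<le> - chi 0 \<longleftrightarrow> 1 + \<eta>\<^sup>2 * ((1 + R) / R) \<le> sqrt (1 + R - R\<mu>) * (sqrt (R / R\<mu>) - \<eta>\<^sup>2 * ((1 + R) / R))"
    unfolding t d_def k_def .
qed

text \<open>a, b, c stand for the squares of the inner, middle and outer radius. The prescribed
  profile expresses u near the centre through the middle and outer radii, so the inner one is
  eliminated by the matching condition.\<close>

lemma high_core:
  assumes "1 / (3 * R\<mu>) * c = (R\<mu> - R) / (3 * R\<mu>) * b + (1 + R - R\<mu>) / (3 * R\<mu>) * a"
  shows "((R\<mu> - R) / (3 * R\<mu>) * b + R / (1 + R) * ((1 + R - R\<mu>) / (3 * R\<mu>)) * a - 1 / (3 * (1 + R)) * y) / 2
    = (R * c + (R\<mu> - R) * b) / (6 * (1 + R) * R\<mu>) - y / (6 * (1 + R))"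
proof -
  define k m where "k = 1 / (1 + R)" and "m = 1 / R\<mu>"
  have k: "k * (1 + R) = 1" and m: "m * R\<mu> = 1" using prm by (simp_all add: k_def m_def)
  have e: "(R\<mu> - R) / (3 * R\<mu>) = (R\<mu> - R) * m / 3" "(1 + R - R\<mu>) / (3 * R\<mu>) = (1 + R - R\<mu>) * m / 3" "1 / (3 * R\<mu>) = m / 3"
    "R / (1 + R) = R * k" "1 / (3 * (1 + R)) = k / 3" "\<And>t. t / (6 * (1 + R) * R\<mu>) = t * k * m / 6" "y / (6 * (1 + R)) = k * y / 6"
    using prm by (simp_all add: k_def m_def)
  have "m * c = m * ((R\<mu> - R) * b + (1 + R - R\<mu>) * a)" using assms unfolding e by (simp add: field_simps)
  then have "(R\<mu> - R) * m * b + R * k * ((1 + R - R\<mu>) * m) * a - k * y = (R * c + (R\<mu> - R) * b) * k * m - k * y"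
    using k by algebra
  then show ?thesis unfolding e by (simp add: diff_divide_distrib add_divide_distrib)
qed

lemma solution_family_mid:
  assumes R: "R\<mu> \<in> {R\<mu>_minus R \<eta>..R\<mu>_plus R \<eta>}" and thr: "R\<mu>_plus R \<eta> < RM" "Rm < R\<mu>_minus R \<eta>"
  shows "\<exists>lm lp F G. solution_family R \<eta> RM Rm R\<mu> lm lp F G"
proof -
  have e: "0 < \<eta>\<^sup>2" using prm by simp
  have "\<exists>u v. even_unique (R / (1 + R)) 1 (1 / (3 * (1 + R))) (1 / (3 * R\<mu>)) (\<eta>\<^sup>2) 1 u v"
  proof -
    consider "R + 1 < R\<mu>" | "R\<mu> < R" | "R \<le> R\<mu>" "R\<mu> \<le> R + 1" by linarith
    then show ?thesis
    proof cases
      case 1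
      then show ?thesis
        using cross_high.even_unique_nested[OF high_locale[OF 1]] high_chi(1)[OF 1] R by simp
    next
      case 2
      then have "\<exists>v u. even_unique 1 (R / (1 + R)) (1 / (3 * R\<mu>)) (1 / (3 * (1 + R))) 1 (\<eta>\<^sup>2) v u"
        using cross_high.even_unique_nested[OF low_locale[OF 2]] low_chi(1)[OF 2] R by simp
      then show ?thesis using even_unique_swap by blast
    next
      case 3
      define p q where "p = (R\<mu> - R) / (3 * R\<mu>)" and "q = (1 + R - R\<mu>) / (3 * R\<mu>)"
      have pq: "0 \<le> p" "0 \<le> q" "0 < p \<or> 0 < q" using 3 prm by (auto simp: p_def q_def zero_less_divide_iff)
      show ?thesis
      \<comment> \<open>The component with the smaller support has to come first; comparing q times
        the mass \<open>\<eta>\<^sup>2\<close> with p decides which one it is. At R\<mu> = R, where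
        p = 0, the exchanged form is the one that applies.\<close>
      proof (cases "0 < p \<and> q * \<eta>\<^sup>2 \<le> 1 * p")
        case True
        then show ?thesis using cross.even_unique_mid[OF concrete_cross e zero_less_one] pq
          unfolding concrete_p concrete_q p_def[symmetric] q_def[symmetric] by simp
      next
        case False
        then have q: "0 < q" "p * 1 \<le> \<eta>\<^sup>2 * q" using pq e by (auto simp: mult.commute intro: less_imp_le)
        have "\<exists>v u. even_unique 1 (R / (1 + R)) (1 / (3 * R\<mu>)) (1 / (3 * (1 + R))) 1 (\<eta>\<^sup>2) v u"
          using cross.even_unique_mid[OF concrete_swap zero_less_one e] pq q
          unfolding concrete_swap_p concrete_swap_q p_def[symmetric] q_def[symmetric] by simp
        then show ?thesis using even_unique_swap by blast
      qed
    qed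
  qed
  then show ?thesis using solution_family_single[OF _ prm R thr] by blast
qed

lemma solution_family_high:
  assumes R: "R\<mu>_plus R \<eta> < R\<mu>" and thr: "0 < Rm" "Rm < R\<mu>_minus R \<eta>" "1 + \<eta>\<^sup>2 \<le> threshold_fun R (\<eta>\<^sup>2) R\<mu> \<longleftrightarrow> RM \<le> R\<mu>"
  shows "\<exists>lm lp F G. solution_family R \<eta> RM Rm R\<mu> lm lp F G"
proof -
  have R1: "R + 1 < R\<mu>" using R R\<mu>_bounds by linarith
  have out: "R\<mu> \<notin> {R\<mu>_minus R \<eta>..R\<mu>_plus R \<eta>}" "\<not> R\<mu> < R\<mu>_minus R \<eta>" using R R\<mu>_bounds by auto
  interpret cross_high "R / (1 + R)" 1 "1 / (3 * (1 + R))" "1 / (3 * R\<mu>)" "\<eta>\<^sup>2" 1 by (rule high_locale[OF R1])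
  interpret cross_family "R / (1 + R)" 1 "1 / (3 * (1 + R))" "1 / (3 * R\<mu>)" "\<eta>\<^sup>2" 1
    by unfold_locales (rule iffD2[OF high_chi(1)[OF R1] R])
  have e: "\<eta>\<^sup>2 \<noteq> 0" using prm by simp
  have ends: "chi smax \<le> - chi 0 \<longleftrightarrow> RM \<le> R\<mu>" by (rule trans[OF high_chi(2)[OF R1] thr(3)])
  have "solution_family R \<eta> RM Rm R\<mu> (-T) T (\<lambda>l x. Uf l x / \<eta>\<^sup>2) Vf"
  proof (rule solution_familyI[where \<zeta>=radii_params and C="(1 + R) / \<eta>\<^sup>2" and E=En])
    show "stationary_solution R R\<mu> \<eta> (\<lambda>x. Uf l x / \<eta>\<^sup>2) (Vf l)" if "l \<in> {-T..T}" for l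
      unfolding stationary_solution_iff[OF prm] using family_weak_sol[OF that] e by simp
    show "non_symmetric (\<lambda>x. Uf l x / \<eta>\<^sup>2) (Vf l)" if "l \<in> {-T..T}" "l \<noteq> 0" for l
      using family_non_symmetric[OF that] e by (simp add: non_symmetric_def even_pair_def even_ae_divide)
    show "even_pair (\<lambda>x. Uf 0 x / \<eta>\<^sup>2) (Vf 0)" using family_even e by (simp add: even_pair_def even_ae_divide)
    show "\<exists>l\<in>{-T..T}. eq_ae F' (\<lambda>x. Uf l x / \<eta>\<^sup>2) \<and> eq_ae G' (Vf l)" if "stationary_solution R R\<mu> \<eta> F' G'" for F' G'
      using family_complete that unfolding stationary_solution_iff[OF prm] eq_ae_cmult[OF e, symmetric] by blast
    show "energy R R\<mu> \<eta> (\<lambda>x. Uf l x / \<eta>\<^sup>2) (Vf l) = (1 + R) / \<eta>\<^sup>2 * En l" if "l \<in> {-T..T}" for l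
      unfolding En_def
      by (rule continuous_compact_energy[where k="max (rc l) (rc (- l))"])
        (use continuous_on_Uf continuous_on_Vf family_zero_outside that prm in auto)
    show "given_by_profiles R R\<mu> \<eta> (radii_params l) (\<lambda>x. Uf l x / \<eta>\<^sup>2) (Vf l)" if l: "l \<in> {-T..T}" for l
    proof -
      have m: "(cross.p (R / (1 + R)) 1 (1 / (3 * (1 + R))) (1 / (3 * R\<mu>)) * (rb (- l))\<^sup>2
          + R / (1 + R) * cross.q (R / (1 + R)) 1 (1 / (3 * (1 + R))) (1 / (3 * R\<mu>)) * (ra (- l))\<^sup>2 - 1 / (3 * (1 + R)) * x\<^sup>2) / 2
        = (R * (rc (- l))\<^sup>2 + (R\<mu> - R) * (rb (- l))\<^sup>2) / (6 * (1 + R) * R\<mu>) - x\<^sup>2 / (6 * (1 + R))" for x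
      proof -
        have "1 / (3 * R\<mu>) * (rc (- l))\<^sup>2 = (R\<mu> - R) / (3 * R\<mu>) * (rb (- l))\<^sup>2 + (1 + R - R\<mu>) / (3 * R\<mu>) * (ra (- l))\<^sup>2"
          using outer_radius_sq[OF dom(3)[OF l]] unfolding concrete_p concrete_q by (simp only: mult_1)
        then show ?thesis unfolding concrete_p concrete_q by (rule high_core)
      qed
      have "Uf l x = profile_F_high R R\<mu> (radii_params l) x" for x
        unfolding Uf_explicit[OF l] m unfolding concrete_p profile_F_high_def radii_params_def by simp
      moreover have "Vf l x = profile_G_high R R\<mu> (radii_params l) x" for x
        unfolding Vf_explicit[OF l] concrete_q profile_G_high_def radii_params_def by simp
      ultimately show ?thesis using out(2) e by (simp add: given_by_profiles_def eq_ae_def)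
    qed
    show "\<not> connected (supp (\<lambda>x. Uf l x / \<eta>\<^sup>2)) \<or> \<not> connected (supp (Vf l))" if "l \<in> {-T..T} - {-T, T}" for l
      using disconnected_interior[OF that] by blast
    show "connected (supp (\<lambda>x. Uf l x / \<eta>\<^sup>2)) \<and> connected (supp (Vf l))" if "R\<mu> \<notin> {Rm<..<RM}" "l \<in> {-T, T}" for l
    proof -
      have "l \<in> {-T..T}" using that(2) T_pos by auto
      moreover have "RM \<le> R\<mu>" using that(1) thr out by auto
      ultimately show ?thesis using connected_supp_Uf connected_ends[OF _ that(2)] ends e by (simp add: supp_divide)
    qed
    show "\<not> connected (supp (\<lambda>x. Uf l x / \<eta>\<^sup>2)) \<or> \<not> connected (supp (Vf l))"
      if "R\<mu> \<in> {Rm<..<R\<mu>_minus R \<eta>} \<union> {R\<mu>_plus R \<eta><..<RM}" "l \<in> {-T, T}" for l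
    proof -
      have "- chi 0 < chi smax" using ends that(1) out by auto
      then show ?thesis using disconnected_ends[OF _ that(2)] by blast
    qed
  qed (use T_pos out continuous_on_radii_params analytic_radii_params ordered_radii_params energy_monotone prm in auto)
  then show ?thesis by blast
qed

text \<open>The locale is instantiated with the components exchanged: its first component is G and
  its second is \<open>\<eta>\<^sup>2 * F\<close>.\<close>

lemma solution_family_low:
  assumes R: "R\<mu> < R\<mu>_minus R \<eta>" and thr: "R\<mu>_plus R \<eta> < RM"
    "1 + \<eta>\<^sup>2 * ((1 + R) / R) \<le> sqrt (1 + R - R\<mu>) * (sqrt (R / R\<mu>) - \<eta>\<^sup>2 * ((1 + R) / R)) \<longleftrightarrow> R\<mu> \<le> Rm"
  shows "\<exists>lm lp F G. solution_family R \<eta> RM Rm R\<mu> lm lp F G"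
proof -
  have R1: "R\<mu> < R" using R R\<mu>_bounds by linarith
  have out: "R\<mu> \<notin> {R\<mu>_minus R \<eta>..R\<mu>_plus R \<eta>}" "\<not> R\<mu>_plus R \<eta> < R\<mu>" using R R\<mu>_bounds by auto
  interpret cross_high 1 "R / (1 + R)" "1 / (3 * R\<mu>)" "1 / (3 * (1 + R))" 1 "\<eta>\<^sup>2" by (rule low_locale[OF R1])
  interpret cross_family 1 "R / (1 + R)" "1 / (3 * R\<mu>)" "1 / (3 * (1 + R))" 1 "\<eta>\<^sup>2"
    by unfold_locales (rule iffD2[OF low_chi(1)[OF R1] R])
  have e: "\<eta>\<^sup>2 \<noteq> 0" using prm by simp
  have ends: "chi smax \<le> - chi 0 \<longleftrightarrow> R\<mu> \<le> Rm" by (rule trans[OF low_chi(2)[OF R1] thr(2)])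
  have "solution_family R \<eta> RM Rm R\<mu> (-T) T (\<lambda>l x. Vf l x / \<eta>\<^sup>2) Uf"
  proof (rule solution_familyI[where \<zeta>=radii_params and C="(1 + R) / \<eta>\<^sup>2" and E=En])
    show "stationary_solution R R\<mu> \<eta> (\<lambda>x. Vf l x / \<eta>\<^sup>2) (Uf l)" if "l \<in> {-T..T}" for l
      unfolding stationary_solution_iff[OF prm] using family_weak_sol[OF that] weak_sol_swap e by simp
    show "non_symmetric (\<lambda>x. Vf l x / \<eta>\<^sup>2) (Uf l)" if "l \<in> {-T..T}" "l \<noteq> 0" for l
      using family_non_symmetric[OF that] e by (auto simp: non_symmetric_def even_pair_def even_ae_divide)
    show "even_pair (\<lambda>x. Vf 0 x / \<eta>\<^sup>2) (Uf 0)" using family_even e by (simp add: even_pair_def even_ae_divide)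
    show "\<exists>l\<in>{-T..T}. eq_ae F' (\<lambda>x. Vf l x / \<eta>\<^sup>2) \<and> eq_ae G' (Uf l)" if "stationary_solution R R\<mu> \<eta> F' G'" for F' G'
    proof -
      have "weak_sol 1 (R / (1 + R)) (1 / (3 * R\<mu>)) (1 / (3 * (1 + R))) 1 (\<eta>\<^sup>2) G' (\<lambda>x. \<eta>\<^sup>2 * F' x)"
        using that unfolding stationary_solution_iff[OF prm] by (subst weak_sol_swap)
      from family_complete[OF this] show ?thesis unfolding eq_ae_cmult[OF e, symmetric] by blast
    qed
    show "energy R R\<mu> \<eta> (\<lambda>x. Vf l x / \<eta>\<^sup>2) (Uf l) = (1 + R) / \<eta>\<^sup>2 * En l" if "l \<in> {-T..T}" for l
      unfolding En_def cross.energy_density_swap[OF concrete_cross]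
      by (rule continuous_compact_energy[where k="max (rc l) (rc (- l))"])
        (use continuous_on_Uf continuous_on_Vf family_zero_outside that prm in auto)
    show "given_by_profiles R R\<mu> \<eta> (radii_params l) (\<lambda>x. Vf l x / \<eta>\<^sup>2) (Uf l)" if l: "l \<in> {-T..T}" for l
    proof -
      have m: "(cross.p 1 (R / (1 + R)) (1 / (3 * R\<mu>)) (1 / (3 * (1 + R))) * (rb (- l))\<^sup>2
          + 1 * cross.q 1 (R / (1 + R)) (1 / (3 * R\<mu>)) (1 / (3 * (1 + R))) * (ra (- l))\<^sup>2 - 1 / (3 * R\<mu>) * x\<^sup>2) / 2
        = ((R\<mu> - R) * (ra (- l))\<^sup>2 + (1 + R - R\<mu>) * (rb (- l))\<^sup>2) / (6 * R\<mu>) - x\<^sup>2 / (6 * R\<mu>)" for x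
        unfolding concrete_swap_p concrete_swap_q using prm by (simp add: field_simps)
      have "Uf l x = profile_G_low R R\<mu> (radii_params l) x" for x
        unfolding Uf_explicit[OF l] m unfolding concrete_swap_p profile_G_low_def radii_params_def by simp
      moreover have "Vf l x = profile_F_low R R\<mu> (radii_params l) x" for x
        unfolding Vf_explicit[OF l] concrete_swap_q profile_F_low_def radii_params_def by simp
      ultimately show ?thesis using out(2) e by (simp add: given_by_profiles_def eq_ae_def)
    qed
    show "\<not> connected (supp (\<lambda>x. Vf l x / \<eta>\<^sup>2)) \<or> \<not> connected (supp (Uf l))" if "l \<in> {-T..T} - {-T, T}" for l
      using disconnected_interior[OF that] e by (simp add: supp_divide)
    show "connected (supp (\<lambda>x. Vf l x / \<eta>\<^sup>2)) \<and> connected (supp (Uf l))" if "R\<mu> \<notin> {Rm<..<RM}" "l \<in> {-T, T}" for l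
    proof -
      have "l \<in> {-T..T}" using that(2) T_pos by auto
      moreover have "R\<mu> \<le> Rm" using that(1) thr R R\<mu>_bounds by auto
      ultimately show ?thesis using connected_supp_Uf connected_ends[OF _ that(2)] ends e by (simp add: supp_divide)
    qed
    show "\<not> connected (supp (\<lambda>x. Vf l x / \<eta>\<^sup>2)) \<or> \<not> connected (supp (Uf l))"
      if "R\<mu> \<in> {Rm<..<R\<mu>_minus R \<eta>} \<union> {R\<mu>_plus R \<eta><..<RM}" "l \<in> {-T, T}" for l
    proof -
      have "- chi 0 < chi smax" using ends that(1) out by auto
      then show ?thesis using disconnected_ends[OF _ that(2)] e by (simp add: supp_divide)
    qed
  qed (use T_pos out continuous_on_radii_params analytic_radii_params ordered_radii_params energy_monotone prm in auto)
  then show ?thesis by blast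
qed

end

theorem theorem2p1:
  fixes R \<eta> :: real
  assumes "R > 0" and "\<eta> > 0"
  shows "\<exists>RM Rm :: real.
    R\<mu>_plus R \<eta> < RM \<and> 0 < Rm \<and> Rm < R\<mu>_minus R \<eta> \<and>
    {s. R + 1 < s \<and> sqrt (s - R) * (\<eta>\<^sup>2 - sqrt ((1 + R) / s)) = 1 + \<eta>\<^sup>2} = {RM} \<and>
    {s. 0 < s \<and> s < R \<and>
        sqrt (1 + R - s) * (sqrt (R / s) - \<eta>\<^sup>2 * ((1 + R) / R)) = 1 + \<eta>\<^sup>2 * ((1 + R) / R)} = {Rm} \<and>
    (\<forall>R\<mu> :: real. 0 < R\<mu> \<longrightarrow>
      (\<exists>(lm :: real) (lp :: real) (F :: real \<Rightarrow> real \<Rightarrow> real) (G :: real \<Rightarrow> real \<Rightarrow> real).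
        (stationary_solution R R\<mu> \<eta> (F 0) (G 0) \<and> even_pair (F 0) (G 0) \<and>
         (\<forall>F' G'. stationary_solution R R\<mu> \<eta> F' G' \<and> even_pair F' G' \<longrightarrow>
            eq_ae F' (F 0) \<and> eq_ae G' (G 0))) \<and>
        (R\<mu> \<notin> {R\<mu>_minus R \<eta>..R\<mu>_plus R \<eta>} \<longrightarrow>
           lm < 0 \<and> 0 < lp \<and>
           (\<forall>l\<in>{lm..lp}. stationary_solution R R\<mu> \<eta> (F l) (G l)) \<and>
           (\<forall>l\<in>{lm..lp}. l \<noteq> 0 \<longrightarrow> non_symmetric (F l) (G l)) \<and>
           (\<exists>\<zeta> :: real \<Rightarrow> params.
              continuous_on {lm..lp} \<zeta> \<and> \<zeta> real_analytic_on {lm<..<lp} \<and>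
              (\<forall>l\<in>{lm..lp}. ordered_params (\<zeta> l) \<and>
                 given_by_profiles R R\<mu> \<eta> (\<zeta> l) (F l) (G l)))) \<and>
        (R\<mu> \<in> {R\<mu>_minus R \<eta>..R\<mu>_plus R \<eta>} \<longrightarrow> lm = 0 \<and> lp = 0) \<and>
        (\<forall>F' G'. stationary_solution R R\<mu> \<eta> F' G' \<longrightarrow>
           (\<exists>l\<in>{lm..lp}. eq_ae F' (F l) \<and> eq_ae G' (G l))) \<and>
        (strict_antimono_on {lm..0} (\<lambda>l. energy R R\<mu> \<eta> (F l) (G l)) \<and>
         strict_mono_on {0..lp} (\<lambda>l. energy R R\<mu> \<eta> (F l) (G l))) \<and>
        (R\<mu> \<notin> {R\<mu>_minus R \<eta>..R\<mu>_plus R \<eta>} \<longrightarrow>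
           (\<forall>l\<in>{lm..lp} - {lm, lp}. \<not> connected (supp (F l)) \<or> \<not> connected (supp (G l)))) \<and>
        (R\<mu> \<notin> {Rm<..<RM} \<longrightarrow>
           (\<forall>l\<in>{lm, lp}. connected (supp (F l)) \<and> connected (supp (G l)))) \<and>
        (R\<mu> \<in> {Rm<..<R\<mu>_minus R \<eta>} \<union> {R\<mu>_plus R \<eta><..<RM} \<longrightarrow>
           (\<forall>l\<in>{lm, lp}. \<not> connected (supp (F l)) \<or> \<not> connected (supp (G l))))))"
proof -
  note R = \<open>R > 0\<close> and e = \<open>\<eta> > 0\<close>
  define k where "k = \<eta>\<^sup>2 * ((1 + R) / R)"
  have e2: "0 < \<eta>\<^sup>2" and k: "0 < k" using R e by (simp_all add: k_def)
  obtain RM where RM: "R\<mu>_plus R \<eta> < RM" "{s. R + 1 < s \<and> threshold_fun R (\<eta>\<^sup>2) s = 1 + \<eta>\<^sup>2} = {RM}"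
    "\<forall>s. R + 1 < s \<longrightarrow> (1 + \<eta>\<^sup>2 \<le> threshold_fun R (\<eta>\<^sup>2) s \<longleftrightarrow> RM \<le> s)"
    using threshold_high[OF R e2] unfolding R\<mu>_plus_def by auto
  \<comment> \<open>The number 1 fills the slot of R\<mu>, which does not occur in this
    identity.\<close>
  have minus: "R\<mu>_minus R \<eta> = R * (1 + R) / (R + (1 + k)\<^sup>2)"
    unfolding k_def by (rule R\<mu>_minus_eq[OF R zero_less_one e])
  obtain Rm where Rm: "0 < Rm" "Rm < R\<mu>_minus R \<eta>"
    "{s. 0 < s \<and> s < R \<and> sqrt (1 + R - s) * (sqrt (R / s) - k) = 1 + k} = {Rm}"
    "\<forall>s. 0 < s \<and> s < R \<longrightarrow> (1 + k \<le> sqrt (1 + R - s) * (sqrt (R / s) - k) \<longleftrightarrow> s \<le> Rm)"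
    using threshold_low[OF R k] unfolding minus by auto
  have fam: "\<exists>lm lp F G. solution_family R \<eta> RM Rm R\<mu> lm lp F G" if pos: "0 < R\<mu>" for R\<mu>
  proof -
    note bounds = R\<mu>_bounds[OF R pos e]
    consider "R\<mu>_plus R \<eta> < R\<mu>" | "R\<mu> < R\<mu>_minus R \<eta>" | "R\<mu> \<in> {R\<mu>_minus R \<eta>..R\<mu>_plus R \<eta>}" by fastforce
    then show ?thesis
    proof cases
      case 1
      then show ?thesis using solution_family_high[OF R pos e 1 Rm(1,2)] RM(3) bounds by simp
    next
      case 2
      then have "R\<mu> < R" using bounds by simp
      then show ?thesis using solution_family_low[OF R pos e 2 RM(1)] Rm(4) pos unfolding k_def by simp
    next
      case 3
      then show ?thesis using solution_family_mid[OF R pos e 3 RM(1) Rm(2)] by simp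
    qed
  qed
  show ?thesis
    by (rule exI[of _ RM], rule exI[of _ Rm])
      (intro conjI RM(1) Rm(1,2) RM(2)[unfolded threshold_fun_def] Rm(3)[unfolded k_def] allI impI
        fam[unfolded solution_family_def])
qed

end
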